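(* Let $r_1,r_2$ be positive integers with $r_2\mid r_1$, let $A(t)\in\mathrm{GL}(4,\mathbb{R})$ be given by $A(t)e_\nu=e_\nu$, $A(t)e_{2+\nu}=e_{2+\nu}+r_\nu t\,e_\nu$ for $\nu=1,2$, and let $G=\mathbb{R}^4\rtimes_A\mathbb{R}$, $\Gamma=\mathbb{Z}^4\rtimes_A\mathbb{Z}$. Let $\mathcal{H}$ be the left-invariant distribution spanned by $s_1=e_3$, $s_2=e_4$, $s_3=b$, with the orientation and Riemannian metric $g$ making $s_1,s_2,s_3$ a positively oriented orthonormal frame. Let $\nabla$ be a left-invariant metric connection in $\mathcal{H}$ with $\sum_{i=1}^3g(\nabla_{s_i}s_j,s_i)=0$ for $j=1,2,3$, and $\varepsilon:\Gamma\to\mathbb{Z}_2$ a homomorphism. Let $D$ be the associated sub-Dirac operator on $\Gamma\setminus G$ and $\alpha=-\frac12(\Gamma_{12}^3+\Gamma_{23}^1+\Gamma_{31}^2)$. (a) If $\varepsilon_\nu=0$ for $\nu=1$ or $\nu=2$, then the numbers $\alpha+(2k+\varepsilon_{2+\nu})\pi$, $k\in\mathbb{Z}$, are eigenvalues of $D$, each of infinite multiplicity. (b) For every homomorphism $\varepsilon$, the spectrum of $D$ is a non-discrete subset of $\mathbb{R}$; namely $\alpha+\pi\,\mathrm{sgn}(r_2)\,\varepsilon_3$ is an accumulation point of $\sigma(D)$.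
   Context: The group law of $G$ is $(x,s)(y,t)=(x+A(s)y,s+t)$. The Lie algebra of $G$ has basis $e_1,\dots,e_4,b$ with the only nontrivial brackets $[b,e_3]=r_1e_1$, $[b,e_4]=r_2e_2$; elements of the Lie algebra are identified with left-invariant vector fields. $\mathbb{Z}_2=\{0,1\}$; $\varepsilon_\nu:=\varepsilon(e_\nu,0)\in\{0,1\}$ for $\nu=1,\dots,4$, viewed as integers. A metric connection in $\mathcal{H}$ differentiates sections of $\mathcal{H}$ along $\mathcal{H}$ and is compatible with $g$; $\Gamma_{ij}^k=g(\nabla_{s_i}s_j,s_k)$. $L^2(G,\varepsilon)$ is the completion of the space of continuous $\varphi:G\to\mathbb{C}$ with $\varphi(\gamma y)=e^{i\pi\varepsilon(\gamma)}\varphi(y)$ ($\gamma\in\Gamma$, $y\in G$) with respect to the $L^2$-norm over $\Gamma\setminus G$ for the normalised invariant measure. With $\Delta=\mathbb{C}^2$ and Clifford action $$s_1=\begin{pmatrix}0&i\\ i&0\end{pmatrix},\quad s_2=\begin{pmatrix}0&-1\\1&0\end{pmatrix},\quad s_3=\begin{pmatrix}i&0\\0&-i\end{pmatrix},$$ the sub-Dirac operator acts on smooth $\varepsilon$-equivariant functions $G\to\Delta$ by $$D=\sum_i d\rho(s_i)\otimes s_i+\frac14\sum_{i,j,k}\Gamma_{ij}^k\,I\otimes s_is_js_k,$$ where $d\rho(s_i)$ is differentiation along the left-invariant vector field $s_i$. Its spectrum and eigenvalues (with multiplicity $=$ dimension of the eigenspace) are understood for its closure in $L^2(G,\varepsilon)\otimes\mathbb{C}^2$.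 *)

theory Defs
  imports "HOL-Analysis.Analysis" "HOL-Algebra.Elementary_Groups"
begin

section \<open>The group, its lattice, and left-invariant vector fields\<close>

type_synonym grp = "(real^4) \<times> real"

definition shear :: "int \<Rightarrow> int \<Rightarrow> real \<Rightarrow> real^4^4" where
  "shear r1 r2 t = (\<chi> i j. if i = j then 1
     else if i = 1 \<and> j = 3 then of_int r1 * t
     else if i = 2 \<and> j = 4 then of_int r2 * t else 0)"

lemma shear_basis:
  "shear r1 r2 t *v axis 1 1 = axis 1 1"
  "shear r1 r2 t *v axis 2 1 = axis 2 1"
  "shear r1 r2 t *v axis 3 1 = axis 3 1 + (of_int r1 * t) *\<^sub>R axis 1 1"
  "shear r1 r2 t *v axis 4 1 = axis 4 1 + (of_int r2 * t) *\<^sub>R axis 2 1"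
  by (simp_all add: shear_def vec_eq_iff matrix_vector_mult_def forall_4 sum_4 axis_def)

definition semidirect :: "(real \<Rightarrow> real^4^4) \<Rightarrow> grp monoid" where
  "semidirect A = \<lparr>carrier = UNIV,
     mult = (\<lambda>(x, s) (y, t). (x + A s *v y, s + t)), one = (0, 0)\<rparr>"

definition lattice :: "grp set" where
  "lattice = {p. (\<forall>i. fst p $ i \<in> \<int>) \<and> snd p \<in> \<int>}"

lemma shear_add: "shear r1 r2 s *v (shear r1 r2 t *v x) = shear r1 r2 (s + t) *v x"
  by (simp add: shear_def vec_eq_iff matrix_vector_mult_def forall_4 sum_4 algebra_simps)

lemma shear_0: "shear r1 r2 0 *v x = x"
  by (simp add: shear_def vec_eq_iff matrix_vector_mult_def forall_4 sum_4)

lemma group_semidirect_shear: "group (semidirect (shear r1 r2))"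
proof (rule groupI)
  fix p assume "p \<in> carrier (semidirect (shear r1 r2))"
  show "\<exists>q\<in>carrier (semidirect (shear r1 r2)).
      q \<otimes>\<^bsub>semidirect (shear r1 r2)\<^esub> p = \<one>\<^bsub>semidirect (shear r1 r2)\<^esub>"
    by (rule bexI[of _ "(- (shear r1 r2 (- snd p) *v fst p), - snd p)"])
       (auto simp: semidirect_def split: prod.splits)
qed (auto simp: semidirect_def shear_0 shear_add[symmetric] matrix_vector_right_distrib add.assoc
       split: prod.splits)

lemma subgroup_lattice: "subgroup lattice (semidirect (shear r1 r2))"
proof -
  interpret group "semidirect (shear r1 r2)" by (rule group_semidirect_shear)
  have mem: "shear r1 r2 s *v x \<in> {y. \<forall>i. y $ i \<in> \<int>}" if "s \<in> \<int>" "\<forall>i. x $ i \<in> \<int>" for s x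
    using that by (simp add: shear_def matrix_vector_mult_def forall_4 sum_4)
  have inv_eq: "inv\<^bsub>semidirect (shear r1 r2)\<^esub> p = (- (shear r1 r2 (- snd p) *v fst p), - snd p)" for p
    by (rule inv_equality) (auto simp: semidirect_def split: prod.splits)
  show ?thesis
  proof (rule subgroupI)
    show "lattice \<noteq> {}" by (auto simp: lattice_def intro!: exI[of _ 0])
  next
    fix p assume p: "p \<in> lattice"
    then have "shear r1 r2 (- snd p) *v fst p \<in> {y. \<forall>i. y $ i \<in> \<int>}"
      by (intro mem) (auto simp: lattice_def)
    then show "inv\<^bsub>semidirect (shear r1 r2)\<^esub> p \<in> lattice"
      using p unfolding inv_eq by (auto simp: lattice_def)
  next
    fix p q assume pq: "p \<in> lattice" "q \<in> lattice"
    then have "shear r1 r2 (snd p) *v fst q \<in> {y. \<forall>i. y $ i \<in> \<int>}"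
      by (intro mem) (auto simp: lattice_def)
    then show "p \<otimes>\<^bsub>semidirect (shear r1 r2)\<^esub> q \<in> lattice"
      using pq by (auto simp: lattice_def semidirect_def split: prod.splits)
  qed (auto simp: semidirect_def)
qed

text \<open>The Lie algebra is the tangent space of the vector space \<open>grp\<close> at \<open>(0, 0)\<close>, i.e. \<open>grp\<close> itself;
  tangent vectors at an arbitrary point are also elements of \<open>grp\<close>, and vector fields are functions
  \<open>grp \<Rightarrow> grp\<close>.\<close>

definition left_translate_diff :: "(real \<Rightarrow> real^4^4) \<Rightarrow> grp \<Rightarrow> grp \<Rightarrow> grp \<Rightarrow> grp" where
  "left_translate_diff A a p = frechet_derivative (\<lambda>q. a \<otimes>\<^bsub>semidirect A\<^esub> q) (at p)"

definition left_invariant_field :: "(real \<Rightarrow> real^4^4) \<Rightarrow> grp \<Rightarrow> grp \<Rightarrow> grp" where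
  "left_invariant_field A v p = left_translate_diff A p (0, 0) v"

definition push_forward :: "(real \<Rightarrow> real^4^4) \<Rightarrow> grp \<Rightarrow> (grp \<Rightarrow> grp) \<Rightarrow> grp \<Rightarrow> grp" where
  "push_forward A a X q =
     (let p = inv\<^bsub>semidirect A\<^esub> a \<otimes>\<^bsub>semidirect A\<^esub> q in left_translate_diff A a p (X p))"

fun Ck :: "nat \<Rightarrow> ('a::real_normed_vector \<Rightarrow> 'b::real_normed_vector) \<Rightarrow> bool" where
  "Ck 0 f \<longleftrightarrow> continuous_on UNIV f"
| "Ck (Suc n) f \<longleftrightarrow> f differentiable_on UNIV \<and> (\<forall>v. Ck n (\<lambda>x. frechet_derivative f (at x) v))"

definition smooth :: "('a::real_normed_vector \<Rightarrow> 'b::real_normed_vector) \<Rightarrow> bool" where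
  "smooth f \<longleftrightarrow> (\<forall>n. Ck n f)"

definition deriv_along :: "(grp \<Rightarrow> grp) \<Rightarrow> (grp \<Rightarrow> 'b::real_normed_vector) \<Rightarrow> grp \<Rightarrow> 'b" where
  "deriv_along X f p = frechet_derivative f (at p) (X p)"


section \<open>The distribution, its metric, and connections\<close>

text \<open>In the index type \<open>3\<close> the elements are \<open>1\<close>, \<open>2\<close> and \<open>3 = 0\<close>.\<close>

definition frame :: "(real \<Rightarrow> real^4^4) \<Rightarrow> 3 \<Rightarrow> grp \<Rightarrow> grp" where
  "frame A i = left_invariant_field A
     (if i = 1 then (axis 3 1, 0) else if i = 2 then (axis 4 1, 0) else (0, 1))"

definition distribution :: "(real \<Rightarrow> real^4^4) \<Rightarrow> grp \<Rightarrow> grp set" where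
  "distribution A p = span (range (\<lambda>i. frame A i p))"

definition sections :: "(real \<Rightarrow> real^4^4) \<Rightarrow> (grp \<Rightarrow> grp) set" where
  "sections A = {X. smooth X \<and> (\<forall>p. X p \<in> distribution A p)}"

definition inner_product_on :: "'a::real_vector set \<Rightarrow> ('a \<Rightarrow> 'a \<Rightarrow> real) \<Rightarrow> bool" where
  "inner_product_on V h \<longleftrightarrow>
     (\<forall>u\<in>V. \<forall>v\<in>V. h u v = h v u) \<and>
     (\<forall>u\<in>V. \<forall>v\<in>V. \<forall>w\<in>V. h (u + v) w = h u w + h v w) \<and>
     (\<forall>c. \<forall>u\<in>V. \<forall>v\<in>V. h (c *\<^sub>R u) v = c * h u v) \<and>
     (\<forall>u\<in>V. u \<noteq> 0 \<longrightarrow> h u u > 0)"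

definition riemannian_metric :: "(real \<Rightarrow> real^4^4) \<Rightarrow> (grp \<Rightarrow> grp \<Rightarrow> grp \<Rightarrow> real) \<Rightarrow> bool" where
  "riemannian_metric A g \<longleftrightarrow>
     (\<forall>p. inner_product_on (distribution A p) (g p)) \<and>
     (\<forall>X\<in>sections A. \<forall>Y\<in>sections A. smooth (\<lambda>p. g p (X p) (Y p)))"

definition orthonormal_frame :: "(real \<Rightarrow> real^4^4) \<Rightarrow> (grp \<Rightarrow> grp \<Rightarrow> grp \<Rightarrow> real) \<Rightarrow> bool" where
  "orthonormal_frame A g \<longleftrightarrow>
     (\<forall>p i j. g p (frame A i p) (frame A j p) = (if i = j then 1 else 0))"

type_synonym conn = "(grp \<Rightarrow> grp) \<Rightarrow> (grp \<Rightarrow> grp) \<Rightarrow> grp \<Rightarrow> grp"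

definition connection :: "(real \<Rightarrow> real^4^4) \<Rightarrow> conn \<Rightarrow> bool" where
  "connection A nab \<longleftrightarrow>
     (\<forall>X\<in>sections A. \<forall>Y\<in>sections A. nab X Y \<in> sections A) \<and>
     (\<forall>X\<in>sections A. \<forall>X'\<in>sections A. \<forall>Y\<in>sections A.
        nab (\<lambda>p. X p + X' p) Y = (\<lambda>p. nab X Y p + nab X' Y p)) \<and>
     (\<forall>f::grp \<Rightarrow> real. smooth f \<longrightarrow> (\<forall>X\<in>sections A. \<forall>Y\<in>sections A.
        nab (\<lambda>p. f p *\<^sub>R X p) Y = (\<lambda>p. f p *\<^sub>R nab X Y p))) \<and>
     (\<forall>X\<in>sections A. \<forall>Y\<in>sections A. \<forall>Y'\<in>sections A.
        nab X (\<lambda>p. Y p + Y' p) = (\<lambda>p. nab X Y p + nab X Y' p)) \<and>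
     (\<forall>f::grp \<Rightarrow> real. smooth f \<longrightarrow> (\<forall>X\<in>sections A. \<forall>Y\<in>sections A.
        nab X (\<lambda>p. f p *\<^sub>R Y p) = (\<lambda>p. deriv_along X f p *\<^sub>R Y p + f p *\<^sub>R nab X Y p)))"

definition metric_connection ::
  "(real \<Rightarrow> real^4^4) \<Rightarrow> (grp \<Rightarrow> grp \<Rightarrow> grp \<Rightarrow> real) \<Rightarrow> conn \<Rightarrow> bool" where
  "metric_connection A g nab \<longleftrightarrow> connection A nab \<and>
     (\<forall>X\<in>sections A. \<forall>Y\<in>sections A. \<forall>Z\<in>sections A. \<forall>p.
        deriv_along X (\<lambda>q. g q (Y q) (Z q)) p = g p (nab X Y p) (Z p) + g p (Y p) (nab X Z p))"

definition left_invariant_connection :: "(real \<Rightarrow> real^4^4) \<Rightarrow> conn \<Rightarrow> bool" where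
  "left_invariant_connection A nab \<longleftrightarrow>
     (\<forall>a. \<forall>X\<in>sections A. \<forall>Y\<in>sections A.
        nab (push_forward A a X) (push_forward A a Y) = push_forward A a (nab X Y))"

definition christoffel ::
  "(real \<Rightarrow> real^4^4) \<Rightarrow> (grp \<Rightarrow> grp \<Rightarrow> grp \<Rightarrow> real) \<Rightarrow> conn \<Rightarrow> 3 \<Rightarrow> 3 \<Rightarrow> 3 \<Rightarrow> grp \<Rightarrow> real" where
  "christoffel A g nab i j k p = g p (nab (frame A i) (frame A j) p) (frame A k p)"

text \<open>For a left-invariant connection and an orthonormal left-invariant frame the Christoffel
  symbols are constant functions; they are read off at the identity.\<close>

definition alpha ::
  "(real \<Rightarrow> real^4^4) \<Rightarrow> (grp \<Rightarrow> grp \<Rightarrow> grp \<Rightarrow> real) \<Rightarrow> conn \<Rightarrow> real" where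
  "alpha A g nab = - (1 / 2) * (christoffel A g nab 1 2 3 (0, 0)
     + christoffel A g nab 2 3 1 (0, 0) + christoffel A g nab 3 1 2 (0, 0))"


section \<open>The space \<open>L\<^sup>2(G, \<epsilon>)\<close> and the sub-Dirac operator\<close>

definition sign_homs :: "(real \<Rightarrow> real^4^4) \<Rightarrow> (grp \<Rightarrow> int) set" where
  "sign_homs A = hom ((semidirect A)\<lparr>carrier := lattice\<rparr>) (integer_mod_group 2)"

definition equivariant :: "(real \<Rightarrow> real^4^4) \<Rightarrow> (grp \<Rightarrow> int) \<Rightarrow> (grp \<Rightarrow> complex) \<Rightarrow> bool" where
  "equivariant A \<epsilon> \<phi> \<longleftrightarrow> (\<forall>\<gamma>\<in>lattice. \<forall>y.
     \<phi> (\<gamma> \<otimes>\<^bsub>semidirect A\<^esub> y) = exp (\<i> * of_real pi * of_int (\<epsilon> \<gamma>)) * \<phi> y)"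

text \<open>The unit cube is a fundamental domain for the left action of the lattice, and Lebesgue measure
  is a Haar measure since \<open>det (shear r1 r2 t) = 1\<close>. Hence Lebesgue measure on the cube
  represents the normalised invariant measure on the quotient.\<close>

definition fundamental_cube :: "grp set" where
  "fundamental_cube = {p. (\<forall>i. 0 \<le> fst p $ i \<and> fst p $ i < 1) \<and> 0 \<le> snd p \<and> snd p < 1}"

definition l2_norm_sq :: "(grp \<Rightarrow> 'b::real_normed_vector) \<Rightarrow> ennreal" where
  "l2_norm_sq u = (\<integral>\<^sup>+p\<in>fundamental_cube. ennreal ((norm (u p))\<^sup>2) \<partial>lborel)"

definition l2_tendsto ::
  "(nat \<Rightarrow> grp \<Rightarrow> 'b::real_normed_vector) \<Rightarrow> (grp \<Rightarrow> 'b) \<Rightarrow> bool" where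
  "l2_tendsto \<phi> u \<longleftrightarrow> (\<lambda>n. l2_norm_sq (\<lambda>p. \<phi> n p - u p)) \<longlonglongrightarrow> 0"

definition ae_eq :: "(grp \<Rightarrow> 'b) \<Rightarrow> (grp \<Rightarrow> 'b) \<Rightarrow> bool" where
  "ae_eq u v \<longleftrightarrow> (AE p in lborel. u p = v p)"

text \<open>Elements of the completion are represented by equivariant Borel functions which are
  \<open>L\<^sup>2\<close>-limits of continuous equivariant functions; representatives are identified by \<open>ae_eq\<close>.\<close>

definition L2_space :: "(real \<Rightarrow> real^4^4) \<Rightarrow> (grp \<Rightarrow> int) \<Rightarrow> (grp \<Rightarrow> complex) set" where
  "L2_space A \<epsilon> = {u. u \<in> borel_measurable borel \<and> equivariant A \<epsilon> u \<and>
     (\<exists>\<phi>. (\<forall>n. continuous_on UNIV (\<phi> n) \<and> equivariant A \<epsilon> (\<phi> n)) \<and> l2_tendsto \<phi> u)}"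

type_synonym spinor = "grp \<Rightarrow> complex^2"

definition spinor_L2 :: "(real \<Rightarrow> real^4^4) \<Rightarrow> (grp \<Rightarrow> int) \<Rightarrow> spinor set" where
  "spinor_L2 A \<epsilon> = {\<psi>. \<forall>a. (\<lambda>p. \<psi> p $ a) \<in> L2_space A \<epsilon>}"

definition smooth_spinors :: "(real \<Rightarrow> real^4^4) \<Rightarrow> (grp \<Rightarrow> int) \<Rightarrow> spinor set" where
  "smooth_spinors A \<epsilon> = {\<psi>. smooth \<psi> \<and> (\<forall>a. equivariant A \<epsilon> (\<lambda>p. \<psi> p $ a))}"

definition clifford :: "3 \<Rightarrow> complex^2^2" where
  "clifford i =
     (if i = 1 then vector [vector [0, \<i>], vector [\<i>, 0]]
      else if i = 2 then vector [vector [0, -1], vector [1, 0]]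
      else vector [vector [\<i>, 0], vector [0, -\<i>]])"

definition dirac ::
  "(real \<Rightarrow> real^4^4) \<Rightarrow> (grp \<Rightarrow> grp \<Rightarrow> grp \<Rightarrow> real) \<Rightarrow> conn \<Rightarrow> spinor \<Rightarrow> spinor" where
  "dirac A g nab \<psi> p =
     (\<Sum>i\<in>UNIV. clifford i *v deriv_along (frame A i) \<psi> p) +
     (1 / 4) *s (\<Sum>i\<in>UNIV. \<Sum>j\<in>UNIV. \<Sum>k\<in>UNIV.
        complex_of_real (christoffel A g nab i j k p) *s
          ((clifford i ** clifford j ** clifford k) *v \<psi> p))"

definition dirac_closure ::
  "(real \<Rightarrow> real^4^4) \<Rightarrow> (grp \<Rightarrow> grp \<Rightarrow> grp \<Rightarrow> real) \<Rightarrow> conn \<Rightarrow> (grp \<Rightarrow> int) \<Rightarrow> (spinor \<times> spinor) set" where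
  "dirac_closure A g nab \<epsilon> = {(u, v). u \<in> spinor_L2 A \<epsilon> \<and> v \<in> spinor_L2 A \<epsilon> \<and>
     (\<exists>\<phi>. (\<forall>n. \<phi> n \<in> smooth_spinors A \<epsilon>) \<and>
        l2_tendsto \<phi> u \<and> l2_tendsto (\<lambda>n. dirac A g nab (\<phi> n)) v)}"


section \<open>Spectrum and multiplicities of an operator given by its graph\<close>

text \<open>\<open>z\<close> is in the resolvent set iff \<open>T - z\<close> is a bijection from the domain of \<open>T\<close> onto the
  Hilbert space \<open>H\<close> (both modulo \<open>ae_eq\<close>) with bounded inverse.\<close>

definition resolvent_set :: "spinor set \<Rightarrow> (spinor \<times> spinor) set \<Rightarrow> complex set" where
  "resolvent_set H T = {z.
     (\<forall>(u, v)\<in>T. ae_eq (\<lambda>p. v p - z *s u p) (\<lambda>p. 0) \<longrightarrow> ae_eq u (\<lambda>p. 0)) \<and>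
     (\<forall>w\<in>H. \<exists>(u, v)\<in>T. ae_eq (\<lambda>p. v p - z *s u p) w) \<and>
     (\<exists>C::real. \<forall>(u, v)\<in>T. l2_norm_sq u \<le> ennreal C * l2_norm_sq (\<lambda>p. v p - z *s u p))}"

definition spectrum :: "spinor set \<Rightarrow> (spinor \<times> spinor) set \<Rightarrow> complex set" where
  "spectrum H T = - resolvent_set H T"

definition eigenspace :: "(spinor \<times> spinor) set \<Rightarrow> complex \<Rightarrow> spinor set" where
  "eigenspace T z = {u. (u, \<lambda>p. z *s u p) \<in> T}"

definition eigenvalue :: "(spinor \<times> spinor) set \<Rightarrow> complex \<Rightarrow> bool" where
  "eigenvalue T z \<longleftrightarrow> (\<exists>u\<in>eigenspace T z. \<not> ae_eq u (\<lambda>p. 0))"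

definition ae_independent :: "spinor set \<Rightarrow> bool" where
  "ae_independent B \<longleftrightarrow> (\<forall>c::spinor \<Rightarrow> complex.
     ae_eq (\<lambda>p. \<Sum>b\<in>B. c b *s b p) (\<lambda>p. 0) \<longrightarrow> (\<forall>b\<in>B. c b = 0))"

definition eigen_multiplicity :: "(spinor \<times> spinor) set \<Rightarrow> complex \<Rightarrow> enat" where
  "eigen_multiplicity T z =
     (SUP B \<in> {B. finite B \<and> B \<subseteq> eigenspace T z \<and> ae_independent B}. enat (card B))"

end

theory Submission
  imports Defs "HOL-Library.Nat_Bijection"
begin

text \<open>
  Metric compatibility, left invariance and the trace condition reduce the zeroth order term of
  \<open>D\<close> to the scalar \<open>\<alpha>\<close>, so that \<open>D - \<alpha>\<close> is the sum of the \<open>s\<^sub>i X\<^sub>i\<close>.  Periodising a Gaussian of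
  frequency \<open>\<xi>\<close> over the lattice gives theta functions on which the \<open>X\<^sub>i\<close> act as ladder operators.
  With \<open>R\<^sub>1 = r\<^sub>1 \<xi>\<^sub>1\<close>, \<open>R\<^sub>2 = r\<^sub>2 \<xi>\<^sub>2\<close> and \<open>\<rho>\<^sup>2 = R\<^sub>1\<^sup>2 + R\<^sub>2\<^sup>2 > 0\<close>, their ground states are
  eigenfunctions with eigenvalue \<open>\<alpha> + 2 \<pi> (R\<^sub>2 \<xi>\<^sub>3 - R\<^sub>1 \<xi>\<^sub>4) / \<rho>\<close>.  If \<open>\<xi>\<^sub>1 = 0\<close> or \<open>\<xi>\<^sub>2 = 0\<close>, this
  depends on \<open>\<xi>\<^sub>3\<close> or \<open>\<xi>\<^sub>4\<close> and a sign only, whence infinite multiplicity; if \<open>\<xi>\<^sub>1 \<noteq> 0\<close> is fixed and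
  \<open>\<xi>\<^sub>2 \<rightarrow> \<infinity>\<close>, the eigenvalues converge to \<open>\<alpha> + 2 \<pi> \<xi>\<^sub>3\<close> without reaching it.

  The spectrum is real because \<open>D\<close> is symmetric and \<open>D - z\<close> has dense range for \<open>z\<close> off the real
  line.  On Hermite-type thetas \<open>(D - \<alpha>)\<^sup>2\<close> is triangular; Taylor expansion then reaches all
  profiles \<open>e\<^sup>i\<^sup>\<mu>\<^sup>s\<close> times a Gaussian, the Weierstrass theorem all compactly supported profiles, and
  Fejer summation in the abelian directions together with a tent partition of unity in the
  direction of \<open>b\<close> all continuous equivariant functions.\<close>

section \<open>The group law and the lattice\<close>

text \<open>Realness of the spectrum is read off from smooth spinors alone: symmetry bounds
  \<open>D - z\<close> from below on them, and completeness of the Hilbert space turns a dense range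
  into a full one. No orthogonal decomposition is set up; density is shown in the sup norm, which
  dominates the seminorm because the cube has finite measure, and which is controlled under
  periodisation of functions decaying like \<open>1 / (1 + s^2)\<close>. The shape of the Fourier
  part comes from the noncommutativity: left translation by \<open>b\<close> shears the frequency
  \<xi>, so the building blocks are a character in the abelian variables times a profile in the last
  variable, summed over all powers of \<open>b\<close>. For \<rho> > 0 the operator acts on such
  profiles as a first order harmonic oscillator plus a constant Clifford term; for \<rho> = 0 the
  Gaussian degenerates and characters of the whole group take its place. The limit point in (b) must
  itself lie in the spectrum, since a discrete set may well have limit points outside; the ground
  states serve as approximate eigenvectors for it.\<close>

definition gmul :: "int \<Rightarrow> int \<Rightarrow> grp \<Rightarrow> grp \<Rightarrow> grp" where
  "gmul r1 r2 p q = (fst p + shear r1 r2 (snd p) *v fst q, snd p + snd q)"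

definition ginv :: "int \<Rightarrow> int \<Rightarrow> grp \<Rightarrow> grp" where
  "ginv r1 r2 p = (- (shear r1 r2 (- snd p) *v fst p), - snd p)"

lemma semidirect_mult: "p \<otimes>\<^bsub>semidirect (shear r1 r2)\<^esub> q = gmul r1 r2 p q"
  by (simp add: semidirect_def gmul_def split: prod.splits)

lemma semidirect_inv: "inv\<^bsub>semidirect (shear r1 r2)\<^esub> p = ginv r1 r2 p"
proof -
  interpret group "semidirect (shear r1 r2)" by (rule group_semidirect_shear)
  show ?thesis
    by (rule inv_equality) (auto simp: semidirect_def ginv_def split: prod.splits)
qed

lemma gmul_assoc: "gmul r1 r2 (gmul r1 r2 p q) r = gmul r1 r2 p (gmul r1 r2 q r)"
  by (simp add: gmul_def shear_add matrix_vector_right_distrib add.assoc)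

lemma ginv_gmul: "gmul r1 r2 (ginv r1 r2 p) p = 0"
  by (simp add: gmul_def ginv_def zero_prod_def)

lemma gmul_ginv: "gmul r1 r2 p (ginv r1 r2 p) = 0"
  using matrix_vector_mult_diff_distrib[of "shear r1 r2 (snd p)" 0 "shear r1 r2 (- snd p) *v fst p"]
  by (simp add: gmul_def ginv_def zero_prod_def shear_add shear_0)

lemma gmul_0: "gmul r1 r2 0 p = p" "gmul r1 r2 p 0 = p"
  by (simp_all add: gmul_def shear_0)

lemma shear_vec: "shear r1 r2 t *v x =
    x + (of_int r1 * t * x $ 3) *\<^sub>R axis 1 1 + (of_int r2 * t * x $ 4) *\<^sub>R axis 2 1"
  by (simp add: shear_def vec_eq_iff matrix_vector_mult_def forall_4 sum_4 axis_def)

lemma shear_nth: "(shear r1 r2 t *v x) $ 1 = x $ 1 + of_int r1 * t * x $ 3"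
  "(shear r1 r2 t *v x) $ 2 = x $ 2 + of_int r2 * t * x $ 4"
  "(shear r1 r2 t *v x) $ 3 = x $ 3" "(shear r1 r2 t *v x) $ 4 = x $ 4"
  by (simp_all add: shear_vec axis_def)

lemma gmul_lattice: "p \<in> lattice \<Longrightarrow> q \<in> lattice \<Longrightarrow> gmul r1 r2 p q \<in> lattice"
  using subgroup.m_closed[OF subgroup_lattice] by (simp add: semidirect_mult)

lemma ginv_lattice: "p \<in> lattice \<Longrightarrow> ginv r1 r2 p \<in> lattice"
  using group.subgroupE(3)[OF group_semidirect_shear subgroup_lattice] by (simp add: semidirect_inv)

lemma continuous_on_shear [continuous_intros]:
  fixes f :: "'a::topological_space \<Rightarrow> real" and h :: "'a \<Rightarrow> real^4"
  shows "continuous_on S f \<Longrightarrow> continuous_on S h \<Longrightarrow> continuous_on S (\<lambda>x. shear r1 r2 (f x) *v h x)"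
  unfolding shear_vec by (intro continuous_intros)

lemma continuous_on_gmul [continuous_intros]:
  "continuous_on S f \<Longrightarrow> continuous_on S h \<Longrightarrow> continuous_on S (\<lambda>x. gmul r1 r2 (f x) (h x))"
  unfolding gmul_def by (intro continuous_intros)

lemma measurable_gmul [measurable]:
  "gmul r1 r2 p \<in> borel_measurable borel" "(\<lambda>q. gmul r1 r2 q p) \<in> borel_measurable borel"
  by (intro borel_measurable_continuous_onI continuous_intros)+

lemma countable_lattice: "countable lattice"
proof -
  have "countable (Collect (\<lambda>x::real^4. \<forall>i. x $ i \<in> \<int>))"
  proof -
    have "countable ((\<lambda>(a,b,c,d). vector [a,b,c,d]) ` (\<int> \<times> \<int> \<times> \<int> \<times> (\<int>::real set)) :: (real^4) set)"
      by (intro countable_image countable_SIGMA countable_int)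
    moreover have "Collect (\<lambda>x::real^4. \<forall>i. x $ i \<in> \<int>) \<subseteq>
        (\<lambda>(a,b,c,d). vector [a,b,c,d]) ` (\<int> \<times> \<int> \<times> \<int> \<times> (\<int>::real set))"
    proof
      fix x :: "real^4" assume "x \<in> Collect (\<lambda>x::real^4. \<forall>i. x $ i \<in> \<int>)"
      then show "x \<in> (\<lambda>(a,b,c,d). vector [a,b,c,d]) ` (\<int> \<times> \<int> \<times> \<int> \<times> (\<int>::real set))"
        by (intro image_eqI[of _ _ "(x$1,x$2,x$3,x$4)"])
           (auto simp: vec_eq_iff forall_4 vector_def)
    qed
    ultimately show ?thesis using countable_subset by blast
  qed
  then have "countable (Collect (\<lambda>x::real^4. \<forall>i. x $ i \<in> \<int>) \<times> (\<int>::real set))"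
    by (intro countable_SIGMA countable_int)
  moreover have "lattice \<subseteq> (Collect (\<lambda>x::real^4. \<forall>i. x $ i \<in> \<int>) \<times> (\<int>::real set))"
    by (auto simp: lattice_def)
  ultimately show ?thesis using countable_subset by blast
qed

section \<open>Integration over the fundamental cube\<close>

text \<open>The last coordinate of \<open>p\<close> determines the power \<open>?n\<close> of
  \<open>b\<close> by its floor; only after shearing by \<open>?n\<close> do the floors of the
  abelian coordinates determine \<open>?m\<close>.\<close>

lemma fundamental_unique: "\<exists>!\<gamma>. \<gamma> \<in> lattice \<and> gmul r1 r2 \<gamma> p \<in> fundamental_cube"
proof -
  have floor_unique': "a = - of_int \<lfloor>x\<rfloor>" if "a \<in> \<int>" "0 \<le> a + x" "a + x < 1" for a x :: real
  proof -
    obtain k where k: "a = of_int k" using \<open>a \<in> \<int>\<close> by (auto elim: Ints_cases)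
    then have "\<lfloor>x\<rfloor> = - k" using that by (intro floor_unique) auto
    then show ?thesis using k by simp
  qed
  let ?n = "- of_int \<lfloor>snd p\<rfloor> :: real"
  let ?m = "(\<chi> i. - of_int \<lfloor>(shear r1 r2 ?n *v fst p) $ i\<rfloor>) :: real^4"
  show ?thesis
  proof (rule ex1I[of _ "(?m, ?n)"])
    show "(?m, ?n) \<in> lattice \<and> gmul r1 r2 (?m, ?n) p \<in> fundamental_cube"
      unfolding lattice_def fundamental_cube_def gmul_def mem_Collect_eq fst_conv snd_conv
        vector_add_component vec_lambda_beta
      by (intro conjI allI Ints_minus Ints_of_int) linarith+
  next
    fix \<gamma> assume g: "\<gamma> \<in> lattice \<and> gmul r1 r2 \<gamma> p \<in> fundamental_cube"
    have 1: "snd \<gamma> = ?n"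
      using g by (intro floor_unique') (auto simp: lattice_def fundamental_cube_def gmul_def)
    have "fst \<gamma> $ i = ?m $ i" for i
      using g 1 unfolding vec_lambda_beta
      by (intro floor_unique') (auto simp: lattice_def fundamental_cube_def gmul_def)
    then show "\<gamma> = (?m, ?n)" using 1 by (simp add: prod_eq_iff vec_eq_iff)
  qed
qed

text \<open>The unfolding device: inserting this constant 1 under an integral spreads it over the
  lattice translates of the cube, where Tonelli and translation invariance apply.\<close>

lemma sum_indicator_fundamental:
  "(\<integral>\<^sup>+\<gamma>. indicator fundamental_cube (gmul r1 r2 \<gamma> p) \<partial>count_space lattice) = (1::ennreal)"
proof -
  from fundamental_unique[of r1 r2 p] obtain \<gamma> where *: "\<gamma> \<in> lattice \<and> gmul r1 r2 \<gamma> p \<in> fundamental_cube"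
    "\<forall>\<gamma>'. \<gamma>' \<in> lattice \<and> gmul r1 r2 \<gamma>' p \<in> fundamental_cube \<longrightarrow> \<gamma>' = \<gamma>"
    by (rule ex1E)
  have g: "\<gamma> \<in> lattice" "gmul r1 r2 \<gamma> p \<in> fundamental_cube"
    by (rule conjunct1[OF *(1)], rule conjunct2[OF *(1)])
  have g': "\<gamma>' = \<gamma>" if "\<gamma>' \<in> lattice" "gmul r1 r2 \<gamma>' p \<in> fundamental_cube" for \<gamma>'
    by (rule *(2)[rule_format, OF conjI[OF that]])
  have "indicator fundamental_cube (gmul r1 r2 \<gamma>' p) = (indicator {\<gamma>} \<gamma>' :: ennreal)" if "\<gamma>' \<in> lattice" for \<gamma>'
  proof (cases "\<gamma>' = \<gamma>")
    case False
    then have "gmul r1 r2 \<gamma>' p \<notin> fundamental_cube" using g'[OF that] by blast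
    with False show ?thesis by simp
  qed (simp add: g(2))
  then have "(\<integral>\<^sup>+\<gamma>'. indicator fundamental_cube (gmul r1 r2 \<gamma>' p) \<partial>count_space lattice)
      = (\<integral>\<^sup>+\<gamma>'. indicator {\<gamma>} \<gamma>' \<partial>count_space lattice)"
    by (intro nn_integral_cong) simp
  also have "\<dots> = 1"
    using g(1) by (subst nn_integral_indicator) (auto simp: emeasure_count_space)
  finally show ?thesis .
qed

text \<open>Inversion permutes the lattice. This form is the one that appears when an unfolded
  integral is folded back, since the translation by \<gamma> has moved to the other factor.\<close>

lemma sum_indicator_fundamental_inv:
  "(\<integral>\<^sup>+\<gamma>. indicator fundamental_cube (gmul r1 r2 (ginv r1 r2 \<gamma>) p) \<partial>count_space lattice) = (1::ennreal)"
proof -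
  have inv_inv: "ginv r1 r2 (ginv r1 r2 \<gamma>) = \<gamma>" for \<gamma>
    by (simp add: ginv_def shear_add shear_0 
        matrix_vector_mult_diff_distrib[of _ 0, simplified])
  have b: "bij_betw (ginv r1 r2) lattice lattice"
    by (rule bij_betwI[of _ _ _ "ginv r1 r2"]) (auto simp: inv_inv ginv_lattice)
  show ?thesis
    using nn_integral_bij_count_space[OF b, of "\<lambda>\<gamma>. indicator fundamental_cube (gmul r1 r2 \<gamma> p)"]
    by (simp add: sum_indicator_fundamental)
qed

section \<open>Unimodularity: Lebesgue measure is invariant under left and right
  translations\<close>

lemma lborel_distr_linear:
  fixes M :: "real^'n::{finite,wellorder}^'n::{finite,wellorder}"
  assumes "det M = 1"
  shows "distr lborel borel ((*v) M) = lborel"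
proof (rule sym, rule lborel_eqI)
  have "invertible M" using assms by (simp add: invertible_det_nz)
  then obtain N where NM: "N ** M = mat 1" "M ** N = mat 1" by (auto simp: invertible_def)
  have dN: "det N = 1" using arg_cong[OF NM(1), of det] assms by (simp add: det_mul)
  have m [measurable]: "(*v) M \<in> borel_measurable borel"
    by (intro borel_measurable_continuous_onI linear_continuous_on linear_linear[THEN iffD1] matrix_vector_mul_bounded_linear)
  fix l u :: "real^'n::{finite,wellorder}" assume lu: "\<And>b. b \<in> Basis \<Longrightarrow> l \<bullet> b \<le> u \<bullet> b"
  \<comment> \<open>Preimages under \<open>M\<close> are images under its inverse \<open>N\<close>,
    and the formula for the measure of a linear image applies to \<open>N\<close>, whose determinant
    is 1 as well.\<close>
  have "(*v) M -` box l u = (*v) N ` box l u"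
    using NM by (auto simp: image_iff matrix_vector_mul_assoc intro!: bexI[of _ "M *v _"])
  then have "emeasure (distr lborel borel ((*v) M)) (box l u) = emeasure lborel ((*v) N ` box l u)"
    by (simp add: emeasure_distr)
  also have "\<dots> = emeasure lebesgue ((*v) N ` box l u)"
    using measurable_sets_borel[OF m, of "box l u"]
    by (simp add: emeasure_completion \<open>_ = (*v) N ` box l u\<close>)
  also have "\<dots> = ennreal (measure lebesgue ((*v) N ` box l u))"
    by (intro emeasure_eq_measure2 measurable_linear_image) auto
  also have "measure lebesgue ((*v) N ` box l u) = measure lebesgue (box l u)"
    by (subst measure_linear_image) (auto simp: dN)
  also have "ennreal \<dots> = (\<Prod>b\<in>Basis. (u - l) \<bullet> b)"
    using lu by (simp add: measure_lborel_box_eq)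
  finally show "emeasure (distr lborel borel ((*v) M)) (box l u) = (\<Prod>b\<in>Basis. (u - l) \<bullet> b)" .
qed simp

text \<open>The shear arises from the identity by two row operations: a multiple of row 3 is added
  to row 1 (giving \<open>B\<close>), a multiple of row 4 to row 2.\<close>

lemma det_shear: "det (shear r1 r2 t) = 1"
proof -
  define B :: "real^4^4" where "B = (\<chi> k. if k = 1 then row 1 (mat 1) + (of_int r1 * t) *s row 3 (mat 1) else row k (mat 1))"
  have "shear r1 r2 t = (\<chi> k. if k = 2 then row 2 B + (of_int r2 * t) *s row 4 B else row k B)"
    by (auto simp: B_def vec_eq_iff forall_4 row_def mat_def shear_def)
  also have "det \<dots> = det B" by (rule det_row_operation) simp
  also have "det B = det (mat 1 :: real^4^4)" unfolding B_def by (rule det_row_operation) simp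
  finally show ?thesis by simp
qed


text \<open>Left translations are the case of constant \<open>v\<close> with \<open>M\<close> a
  shear; right translations are the case where \<open>M\<close> is the identity and \<open>v\<close>
  depends on the last coordinate. On each fibre the map is affine of determinant 1.\<close>

lemma nn_integral_fibrewise_affine:
  fixes M :: "real^4^4" and v :: "real \<Rightarrow> real^4"
  assumes "det M = 1" and v [measurable]: "v \<in> borel_measurable borel"
    and f [measurable]: "f \<in> borel_measurable (borel :: grp measure)"
  shows "(\<integral>\<^sup>+p. f (M *v fst p + v (snd p), snd p + t) \<partial>lborel) = (\<integral>\<^sup>+p. f p \<partial>lborel)"
proof -
  have m [measurable]: "(*v) M \<in> borel_measurable borel"
    by (intro borel_measurable_continuous_onI linear_continuous_on linear_linear[THEN iffD1] matrix_vector_mul_bounded_linear)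
  have [measurable]: "(\<lambda>p::grp. (M *v fst p + v (snd p), snd p + t)) \<in> borel_measurable borel"
    by (simp add: borel_prod[symmetric])
  have [measurable]: "(\<lambda>x. f (x, s)) \<in> borel_measurable borel" for s
    using f by (simp add: borel_prod[symmetric])
  have lin: "(\<integral>\<^sup>+x. h (M *v x) \<partial>lborel) = (\<integral>\<^sup>+x. h x \<partial>lborel)" if [measurable]: "h \<in> borel_measurable borel" for h :: "real^4 \<Rightarrow> ennreal"
    using nn_integral_distr[of "(*v) M" lborel borel h] by (simp add: lborel_distr_linear assms)
  have tr: "(\<integral>\<^sup>+x. h (x + a) \<partial>lborel) = (\<integral>\<^sup>+x. h x \<partial>lborel)" if [measurable]: "h \<in> borel_measurable borel"
    for h :: "'b::euclidean_space \<Rightarrow> ennreal" and a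
    using nn_integral_distr[of "(+) a" lborel borel h] lborel_distr_plus[of a] by (simp add: add.commute)
  have "(\<integral>\<^sup>+p. f (M *v fst p + v (snd p), snd p + t) \<partial>lborel) =
      (\<integral>\<^sup>+s. \<integral>\<^sup>+x. f (M *v x + v s, s + t) \<partial>lborel \<partial>lborel)"
    unfolding lborel_prod[symmetric] by (subst lborel_pair.nn_integral_snd[symmetric]) (auto simp: lborel_prod)
  also have "\<dots> = (\<integral>\<^sup>+s. \<integral>\<^sup>+x. f (x, s + t) \<partial>lborel \<partial>lborel)"
  proof (rule nn_integral_cong)
    fix s
    have [measurable]: "(\<lambda>x. f (x + v s, s + t)) \<in> borel_measurable borel"
      by (rule measurable_compose[of "\<lambda>x. x + v s" borel borel "\<lambda>x. f (x, s + t)"]) auto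
    show "(\<integral>\<^sup>+x. f (M *v x + v s, s + t) \<partial>lborel) = (\<integral>\<^sup>+x. f (x, s + t) \<partial>lborel)"
      using lin[of "\<lambda>x. f (x + v s, s + t)"] tr[of "\<lambda>x. f (x, s + t)" "v s"] by simp
  qed
  also have "\<dots> = (\<integral>\<^sup>+s. \<integral>\<^sup>+x. f (x, s) \<partial>lborel \<partial>lborel)"
    by (rule tr[of "\<lambda>s. \<integral>\<^sup>+x. f (x, s) \<partial>lborel"])
       (intro lborel.borel_measurable_nn_integral, use f in \<open>simp add: borel_prod[symmetric] measurable_split_conv\<close>)
  also have "\<dots> = (\<integral>\<^sup>+p. f p \<partial>lborel)"
    unfolding lborel_prod[symmetric] by (subst lborel_pair.nn_integral_snd) (use f in \<open>auto simp: lborel_prod\<close>)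
  finally show ?thesis .
qed

lemma nn_integral_gmul_left:
  assumes [measurable]: "f \<in> borel_measurable borel"
  shows "(\<integral>\<^sup>+p. f (gmul r1 r2 q p) \<partial>lborel) = (\<integral>\<^sup>+p. f p \<partial>lborel)"
  using nn_integral_fibrewise_affine[OF det_shear, of "\<lambda>_. fst q" f r1 r2 "snd q" "snd q"]
  by (simp add: gmul_def add.commute)

lemma nn_integral_gmul_right:
  assumes [measurable]: "f \<in> borel_measurable borel"
  shows "(\<integral>\<^sup>+p. f (gmul r1 r2 p q) \<partial>lborel) = (\<integral>\<^sup>+p. f p \<partial>lborel)"
proof -
  have "(\<lambda>s. shear r1 r2 s *v fst q) \<in> borel_measurable borel"
    by (intro borel_measurable_continuous_onI continuous_intros)
  from nn_integral_fibrewise_affine[OF det_I this, of f "snd q"] show ?thesis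
    by (simp add: gmul_def)
qed

lemma fundamental_cube_measurable [measurable]: "fundamental_cube \<in> sets borel"
proof -
  have [measurable]: "(\<lambda>p::grp. fst p $ i) \<in> borel_measurable borel" "(\<lambda>p::grp. snd p) \<in> borel_measurable borel" for i
    by (intro borel_measurable_continuous_onI continuous_intros)+
  have "{p::grp \<in> space borel. (\<forall>i. 0 \<le> fst p $ i \<and> fst p $ i < 1) \<and> 0 \<le> snd p \<and> snd p < 1} \<in> sets borel"
    unfolding forall_4 by measurable
  then show ?thesis by (simp add: fundamental_cube_def)
qed

text \<open>Both the cube and its right translate by \<open>g\<close> are fundamental domains for the lattice, so an
  invariant function has the same integral over them.\<close>

lemma nn_integral_cube_translate:
  assumes k [measurable]: "k \<in> borel_measurable borel"
    and inv: "\<And>\<gamma> p. \<gamma> \<in> lattice \<Longrightarrow> k (gmul r1 r2 \<gamma> p) = (k p :: ennreal)"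
  shows "(\<integral>\<^sup>+p\<in>fundamental_cube. k (gmul r1 r2 p g) \<partial>lborel) = (\<integral>\<^sup>+p\<in>fundamental_cube. k p \<partial>lborel)"
proof -
  let ?F = "indicator fundamental_cube :: grp \<Rightarrow> ennreal" and ?m = "gmul r1 r2" and ?i = "ginv r1 r2"
  have cancel: "?m (?m p g) (?i g) = p" for p by (simp add: gmul_assoc gmul_ginv gmul_0)
  have cancel': "?m (?i \<gamma>) (?m \<gamma> p) = p" for p \<gamma> by (simp add: gmul_assoc[symmetric] ginv_gmul gmul_0)
  have [measurable]: "?F \<in> borel_measurable borel" by simp
  have "(\<integral>\<^sup>+p. k (?m p g) * ?F p \<partial>lborel) = (\<integral>\<^sup>+p. k (?m p g) * ?F (?m (?m p g) (?i g)) \<partial>lborel)"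
    by (simp add: cancel)
  also have "\<dots> = (\<integral>\<^sup>+q. k q * ?F (?m q (?i g)) \<partial>lborel)"
    by (rule nn_integral_gmul_right) measurable
  \<comment> \<open>Inserting the sum over \<gamma> cuts the translated cube into pieces lying in
    single lattice translates of the cube; each piece is then moved back into the cube.\<close>
  also have "\<dots> = (\<integral>\<^sup>+q. \<integral>\<^sup>+\<gamma>. k q * ?F (?m q (?i g)) * ?F (?m \<gamma> q) \<partial>count_space lattice \<partial>lborel)"
    by (intro nn_integral_cong) (simp add: nn_integral_cmult sum_indicator_fundamental)
  also have "\<dots> = (\<integral>\<^sup>+\<gamma>. \<integral>\<^sup>+q. k q * ?F (?m q (?i g)) * ?F (?m \<gamma> q) \<partial>lborel \<partial>count_space lattice)"
    by (intro nn_integral_count_space_nn_integral countable_lattice) measurable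
  also have "\<dots> = (\<integral>\<^sup>+\<gamma>. \<integral>\<^sup>+q. k q * ?F (?m (?i \<gamma>) (?m q (?i g))) * ?F q \<partial>lborel \<partial>count_space lattice)"
  proof (rule nn_integral_cong)
    fix \<gamma> assume "\<gamma> \<in> space (count_space lattice)"
    then have g: "\<gamma> \<in> lattice" by simp
    have "(\<integral>\<^sup>+q. k q * ?F (?m q (?i g)) * ?F (?m \<gamma> q) \<partial>lborel) =
        (\<integral>\<^sup>+q. k (?m \<gamma> q) * ?F (?m (?i \<gamma>) (?m (?m \<gamma> q) (?i g))) * ?F (?m \<gamma> q) \<partial>lborel)"
      by (simp add: inv[OF g] gmul_assoc[of _ _ _ _ "?i g"] cancel')
    also have "\<dots> = (\<integral>\<^sup>+q. k q * ?F (?m (?i \<gamma>) (?m q (?i g))) * ?F q \<partial>lborel)"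
      by (rule nn_integral_gmul_left) measurable
    finally show "(\<integral>\<^sup>+q. k q * ?F (?m q (?i g)) * ?F (?m \<gamma> q) \<partial>lborel) =
      (\<integral>\<^sup>+q. k q * ?F (?m (?i \<gamma>) (?m q (?i g))) * ?F q \<partial>lborel)" .
  qed
  also have "\<dots> = (\<integral>\<^sup>+q. \<integral>\<^sup>+\<gamma>. k q * ?F (?m (?i \<gamma>) (?m q (?i g))) * ?F q \<partial>count_space lattice \<partial>lborel)"
    by (intro nn_integral_count_space_nn_integral[symmetric] countable_lattice) measurable
  also have "\<dots> = (\<integral>\<^sup>+q. (\<integral>\<^sup>+\<gamma>. k q * ?F q * ?F (?m (?i \<gamma>) (?m q (?i g))) \<partial>count_space lattice) \<partial>lborel)"
    by (simp add: mult_ac)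
  also have "\<dots> = (\<integral>\<^sup>+q. k q * ?F q \<partial>lborel)"
    by (intro nn_integral_cong) (simp add: nn_integral_cmult sum_indicator_fundamental_inv)
  finally show ?thesis .
qed

section \<open>Equivariant functions and the space \<open>L\<^sup>2(G, \<epsilon>)\<close>\<close>

locale sign_structure =
  fixes r1 r2 :: int and \<epsilon> :: "grp \<Rightarrow> int"
  assumes sign_hom: "\<epsilon> \<in> sign_homs (shear r1 r2)"
begin

abbreviation lmul :: "grp \<Rightarrow> grp \<Rightarrow> grp" (infixl "\<odot>" 70) where "p \<odot> q \<equiv> gmul r1 r2 p q"

definition sgc :: "grp \<Rightarrow> complex" where
  "sgc \<gamma> = exp (\<i> * of_real pi * of_int (\<epsilon> \<gamma>))"

lemma norm_sgc [simp]: "norm (sgc \<gamma>) = 1"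
proof -
  have "\<i> * of_real pi * of_int (\<epsilon> \<gamma>) = \<i> * complex_of_real (pi * of_int (\<epsilon> \<gamma>))" by simp
  then show ?thesis unfolding sgc_def by (metis norm_exp_i_times)
qed

lemma sgc_nonzero [simp]: "sgc \<gamma> \<noteq> 0"
  using norm_sgc[of \<gamma>] by fastforce

lemma eps_mult: "\<gamma> \<in> lattice \<Longrightarrow> \<delta> \<in> lattice \<Longrightarrow> \<epsilon> (\<gamma> \<odot> \<delta>) = (\<epsilon> \<gamma> + \<epsilon> \<delta>) mod 2"
  using sign_hom unfolding sign_homs_def hom_def by (simp add: semidirect_mult)

lemma eps_cases: "\<gamma> \<in> lattice \<Longrightarrow> \<epsilon> \<gamma> = 0 \<or> \<epsilon> \<gamma> = 1"
  using sign_hom unfolding sign_homs_def hom_def by (auto simp: carrier_integer_mod_group Pi_iff)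

lemma sgc_eq: "\<gamma> \<in> lattice \<Longrightarrow> sgc \<gamma> = (if \<epsilon> \<gamma> = 0 then 1 else - 1)"
  using eps_cases[of \<gamma>] by (auto simp: sgc_def mult.commute)

lemma sgc_mult: "\<gamma> \<in> lattice \<Longrightarrow> \<delta> \<in> lattice \<Longrightarrow> sgc (\<gamma> \<odot> \<delta>) = sgc \<gamma> * sgc \<delta>"
  using eps_cases[of \<gamma>] eps_cases[of \<delta>] by (auto simp: sgc_eq gmul_lattice eps_mult)

lemma equivariant_iff:
  "equivariant (shear r1 r2) \<epsilon> \<phi> \<longleftrightarrow> (\<forall>\<gamma>\<in>lattice. \<forall>y. \<phi> (\<gamma> \<odot> y) = sgc \<gamma> * \<phi> y)"
  by (simp add: equivariant_def semidirect_mult sgc_def)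

definition spinor_equivariant :: "spinor \<Rightarrow> bool" where
  "spinor_equivariant \<psi> \<longleftrightarrow> (\<forall>\<gamma>\<in>lattice. \<forall>y. \<psi> (\<gamma> \<odot> y) = sgc \<gamma> *s \<psi> y)"

lemma spinor_equivariant_iff:
  "spinor_equivariant \<psi> \<longleftrightarrow> (\<forall>a. equivariant (shear r1 r2) \<epsilon> (\<lambda>p. \<psi> p $ a))"
  by (auto simp: spinor_equivariant_def equivariant_iff vec_eq_iff)

end

lemma norm_vector_smult [simp]: "norm (z *s v) = norm z * norm (v :: complex^'n)"
  by (simp add: norm_vec_def L2_set_def norm_mult power_mult_distrib flip: sum_distrib_left)
     (simp add: real_sqrt_mult)

lemma continuous_on_vector_smult [continuous_intros]:
  fixes f :: "'a::topological_space \<Rightarrow> complex" and h :: "'a \<Rightarrow> complex^'n"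
  shows "continuous_on S f \<Longrightarrow> continuous_on S h \<Longrightarrow> continuous_on S (\<lambda>x. f x *s h x)"
  unfolding vector_scalar_mult_def by (intro continuous_intros)

lemma measurable_vec_nth_complex [measurable]:
  "f \<in> borel_measurable M \<Longrightarrow> (\<lambda>p. (f p :: complex^2) $ a) \<in> borel_measurable M"
  by (rule measurable_compose[of f M borel "\<lambda>v. v $ a"])
     (auto intro!: borel_measurable_continuous_onI continuous_intros)

lemma measurable_spinor:
  assumes "\<And>a. (\<lambda>p. (f p :: complex^2) $ a) \<in> borel_measurable M"
  shows "f \<in> borel_measurable M"
proof (rule borel_measurable_euclidean_space[THEN iffD2], rule ballI)
  fix i :: "complex^2" assume "i \<in> Basis"
  then obtain a u where i: "i = axis a u" unfolding Basis_vec_def by auto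
  note [measurable] = assms[of a]
  have "(\<lambda>p. f p $ a \<bullet> u) \<in> borel_measurable M" by measurable
  then show "(\<lambda>p. f p \<bullet> i) \<in> borel_measurable M" by (simp add: i inner_axis)
qed

subsection \<open>The seminorm\<close>

lemma emeasure_fundamental_cube_le: "emeasure lborel fundamental_cube \<le> 1"
proof -
  let ?o = "(\<chi> i. 1, 1) :: grp"
  have "emeasure lborel fundamental_cube \<le> emeasure lborel (cbox 0 ?o)"
    by (rule emeasure_mono) (auto simp: fundamental_cube_def cbox_def Basis_prod_def Basis_vec_def inner_axis less_imp_le)
  also have "\<dots> = 1"
    by (subst emeasure_lborel_cbox)
       (auto simp: Basis_prod_def Basis_vec_def inner_axis intro!: prod.neutral[THEN trans] )
  finally show ?thesis .
qed

lemma l2_norm_sq_mono: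
  assumes "\<And>p. p \<in> fundamental_cube \<Longrightarrow> norm (u p) \<le> norm (v p)"
  shows "l2_norm_sq u \<le> l2_norm_sq v"
  unfolding l2_norm_sq_def
  by (intro nn_integral_mono) (auto simp: indicator_def intro!: ennreal_leI power_mono assms)

text \<open>Since the cube has measure at most 1, sup norm estimates are \<open>L2\<close>
  estimates; all later density arguments rest on this.\<close>

lemma l2_norm_sq_le_const:
  assumes "\<And>p. p \<in> fundamental_cube \<Longrightarrow> norm (u p) \<le> c"
  shows "l2_norm_sq u \<le> ennreal (c\<^sup>2)"
proof -
  have "l2_norm_sq u \<le> (\<integral>\<^sup>+p\<in>fundamental_cube. ennreal (c\<^sup>2) \<partial>lborel)"
    unfolding l2_norm_sq_def
    by (intro nn_integral_mono) (auto simp: indicator_def intro!: ennreal_leI power_mono assms)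
  also have "\<dots> = ennreal (c\<^sup>2) * emeasure lborel fundamental_cube"
    by (subst nn_integral_cmult_indicator) auto
  also have "\<dots> \<le> ennreal (c\<^sup>2) * 1"
    by (intro mult_left_mono emeasure_fundamental_cube_le) auto
  finally show ?thesis by simp
qed

lemma norm_add_sq_le: "(norm (x + y :: 'a::real_normed_vector))\<^sup>2 \<le> 2 * (norm x)\<^sup>2 + 2 * (norm y)\<^sup>2"
proof -
  have "(norm (x + y))\<^sup>2 \<le> (norm x + norm y)\<^sup>2" by (intro power_mono norm_triangle_ineq) auto
  also have "\<dots> \<le> 2 * (norm x)\<^sup>2 + 2 * (norm y)\<^sup>2"
    using zero_le_power2[of "norm x - norm y"] by (simp add: power2_eq_square algebra_simps)
  finally show ?thesis .
qed

text \<open>The triangle inequality for squared norms, at the price of a factor 2. Working with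
  squares keeps everything inside \<open>ennreal\<close> without roots.\<close>

lemma l2_norm_sq_add_le:
  fixes u v :: "grp \<Rightarrow> 'b::{real_normed_vector, second_countable_topology}"
  assumes [measurable]: "u \<in> borel_measurable borel" "v \<in> borel_measurable borel"
  shows "l2_norm_sq (\<lambda>p. u p + v p) \<le> 2 * l2_norm_sq u + 2 * l2_norm_sq v"
proof -
  have "l2_norm_sq (\<lambda>p. u p + v p) \<le> (\<integral>\<^sup>+p. 2 * (ennreal ((norm (u p))\<^sup>2) * indicator fundamental_cube p)
      + 2 * (ennreal ((norm (v p))\<^sup>2) * indicator fundamental_cube p) \<partial>lborel)"
    unfolding l2_norm_sq_def
  proof (intro nn_integral_mono)
    fix p :: grp
    have "ennreal ((norm (u p + v p))\<^sup>2) \<le> ennreal (2 * (norm (u p))\<^sup>2 + 2 * (norm (v p))\<^sup>2)"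
      by (intro ennreal_leI norm_add_sq_le)
    also have "\<dots> = 2 * ennreal ((norm (u p))\<^sup>2) + 2 * ennreal ((norm (v p))\<^sup>2)"
      by (simp add: ennreal_plus ennreal_mult)
    finally show "ennreal ((norm (u p + v p))\<^sup>2) * indicator fundamental_cube p \<le>
       2 * (ennreal ((norm (u p))\<^sup>2) * indicator fundamental_cube p)
      + 2 * (ennreal ((norm (v p))\<^sup>2) * indicator fundamental_cube p)"
      by (auto simp: indicator_def)
  qed
  also have "\<dots> = 2 * l2_norm_sq u + 2 * l2_norm_sq v"
    unfolding l2_norm_sq_def by (subst nn_integral_add) (auto simp: nn_integral_cmult)
  finally show ?thesis .
qed

lemma l2_norm_sq_cong: "(\<And>p. norm (u p) = norm (v p)) \<Longrightarrow> l2_norm_sq u = l2_norm_sq v"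
  unfolding l2_norm_sq_def by simp

lemma l2_norm_sq_uminus: "l2_norm_sq (\<lambda>p. v p - u p) = l2_norm_sq (\<lambda>p. u p - v p)"
  by (rule l2_norm_sq_cong) (simp add: norm_minus_commute)

lemma l2_norm_sq_diff_le:
  fixes u v :: "grp \<Rightarrow> 'b::{real_normed_vector, second_countable_topology}"
  assumes [measurable]: "u \<in> borel_measurable borel" "v \<in> borel_measurable borel" "w \<in> borel_measurable borel"
  shows "l2_norm_sq (\<lambda>p. u p - w p) \<le> 2 * l2_norm_sq (\<lambda>p. u p - v p) + 2 * l2_norm_sq (\<lambda>p. v p - w p)"
  using l2_norm_sq_add_le[of "\<lambda>p. u p - v p" "\<lambda>p. v p - w p"] by simp

lemma l2_norm_sq_cmult:
  assumes [measurable]: "u \<in> borel_measurable borel"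
    and "\<And>p. norm (v p) = c * norm (u p)"
  shows "l2_norm_sq v = ennreal (c\<^sup>2) * l2_norm_sq u"
  unfolding l2_norm_sq_def
  by (subst nn_integral_cmult[symmetric]) (auto simp: assms(2) power_mult_distrib ennreal_mult mult.assoc)

lemma l2_norm_sq_spinor:
  fixes u :: spinor
  assumes [measurable]: "u \<in> borel_measurable borel"
  shows "l2_norm_sq u = l2_norm_sq (\<lambda>p. u p $ 1) + l2_norm_sq (\<lambda>p. u p $ 2)"
proof -
  have "(norm (v :: complex^2))\<^sup>2 = (norm (v $ 1))\<^sup>2 + (norm (v $ 2))\<^sup>2" for v
    by (simp add: norm_vec_def L2_set_def sum_2)
  then show ?thesis
    unfolding l2_norm_sq_def
    by (subst nn_integral_add[symmetric]) (auto simp: ennreal_plus distrib_right)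
qed

lemma l2_tendsto_const: "l2_tendsto (\<lambda>n. u) u"
  by (simp add: l2_tendsto_def l2_norm_sq_def)

text \<open>The squeeze through which all limits of combinations pass; two majorants suffice because
  spinors have two components and graphs two entries.\<close>

lemma l2_tendsto_le:
  assumes "l2_tendsto \<phi> u" "l2_tendsto \<phi>' u'"
    and "\<And>n. l2_norm_sq (\<lambda>p. \<psi> n p - v p) \<le> ennreal a * l2_norm_sq (\<lambda>p. \<phi> n p - u p) + ennreal b * l2_norm_sq (\<lambda>p. \<phi>' n p - u' p)"
  shows "l2_tendsto \<psi> v"
  unfolding l2_tendsto_def
proof (rule tendsto_sandwich[OF _ _ tendsto_const])
  have "(\<lambda>n. ennreal a * l2_norm_sq (\<lambda>p. \<phi> n p - u p) + ennreal b * l2_norm_sq (\<lambda>p. \<phi>' n p - u' p))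
      \<longlonglongrightarrow> ennreal a * 0 + ennreal b * 0"
    using assms(1,2) unfolding l2_tendsto_def by (intro tendsto_add ennreal_tendsto_cmult) auto
  then show "(\<lambda>n. ennreal a * l2_norm_sq (\<lambda>p. \<phi> n p - u p) + ennreal b * l2_norm_sq (\<lambda>p. \<phi>' n p - u' p)) \<longlonglongrightarrow> 0"
    by simp
qed (use assms(3) in auto)

context sign_structure
begin

abbreviation "L2 \<equiv> L2_space (shear r1 r2) \<epsilon>"
abbreviation "SL2 \<equiv> spinor_L2 (shear r1 r2) \<epsilon>"

text \<open>The seminorm sees only the cube whereas \<open>ae_eq\<close> speaks about the whole
  group; invariance carries the null set to the countably many translates of the cube.\<close>

lemma l2_zero_imp_ae:
  fixes u :: "grp \<Rightarrow> 'b::{real_normed_vector, second_countable_topology}"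
  assumes [measurable]: "u \<in> borel_measurable borel"
    and inv: "\<And>\<gamma> p. \<gamma> \<in> lattice \<Longrightarrow> norm (u (\<gamma> \<odot> p)) = norm (u p)"
    and z: "l2_norm_sq u = 0"
  shows "ae_eq u (\<lambda>p. 0)"
proof -
  let ?F = "indicator fundamental_cube :: grp \<Rightarrow> ennreal"
  let ?N = "\<lambda>p. ennreal ((norm (u p))\<^sup>2)"
  have "(\<integral>\<^sup>+p. ?N p \<partial>lborel) = (\<integral>\<^sup>+p. \<integral>\<^sup>+\<gamma>. ?N p * ?F (\<gamma> \<odot> p) \<partial>count_space lattice \<partial>lborel)"
    by (intro nn_integral_cong) (simp add: nn_integral_cmult sum_indicator_fundamental)
  also have "\<dots> = (\<integral>\<^sup>+\<gamma>. \<integral>\<^sup>+p. ?N p * ?F (\<gamma> \<odot> p) \<partial>lborel \<partial>count_space lattice)"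
    by (intro nn_integral_count_space_nn_integral countable_lattice) measurable
  also have "\<dots> = (\<integral>\<^sup>+\<gamma>. 0 \<partial>count_space lattice)"
  proof (rule nn_integral_cong)
    fix \<gamma> assume "\<gamma> \<in> space (count_space lattice)"
    then have g: "\<gamma> \<in> lattice" by simp
    have "(\<integral>\<^sup>+p. ?N p * ?F (\<gamma> \<odot> p) \<partial>lborel) = (\<integral>\<^sup>+p. ?N (\<gamma> \<odot> p) * ?F (\<gamma> \<odot> p) \<partial>lborel)"
      by (simp add: inv[OF g])
    also have "\<dots> = (\<integral>\<^sup>+p. ?N p * ?F p \<partial>lborel)"
      by (rule nn_integral_gmul_left) measurable
    finally show "(\<integral>\<^sup>+p. ?N p * ?F (\<gamma> \<odot> p) \<partial>lborel) = 0" using z by (simp add: l2_norm_sq_def)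
  qed
  finally have "(\<integral>\<^sup>+p. ?N p \<partial>lborel) = 0" by simp
  then have "AE p in lborel. ?N p = 0" by (subst (asm) nn_integral_0_iff_AE) auto
  then show ?thesis unfolding ae_eq_def by eventually_elim (simp add: ennreal_eq_0_iff)
qed

lemma L2_space_borel: "u \<in> L2 \<Longrightarrow> u \<in> borel_measurable borel"
  by (simp add: L2_space_def)

lemma SL2_borel: "u \<in> SL2 \<Longrightarrow> u \<in> borel_measurable borel"
  by (intro measurable_spinor) (simp add: spinor_L2_def L2_space_borel)

lemma SL2_equivariant: "u \<in> SL2 \<Longrightarrow> spinor_equivariant u"
  by (auto simp: spinor_equivariant_iff spinor_L2_def L2_space_def)

lemma continuous_in_L2:
  "continuous_on UNIV u \<Longrightarrow> equivariant (shear r1 r2) \<epsilon> u \<Longrightarrow> u \<in> L2"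
  by (auto simp: L2_space_def intro!: borel_measurable_continuous_onI exI[of _ "\<lambda>n. u"] l2_tendsto_const)

lemma continuous_in_SL2:
  "continuous_on UNIV u \<Longrightarrow> spinor_equivariant u \<Longrightarrow> u \<in> SL2"
  by (auto simp: spinor_L2_def spinor_equivariant_iff intro!: continuous_in_L2 continuous_intros)

lemma L2_add_cmult:
  assumes "u \<in> L2" "v \<in> L2"
  shows "(\<lambda>p. u p + z * v p) \<in> L2"
proof -
  obtain \<phi> \<phi>' where p: "\<And>n. continuous_on UNIV (\<phi> n)" "\<And>n. equivariant (shear r1 r2) \<epsilon> (\<phi> n)" "l2_tendsto \<phi> u"
    and p': "\<And>n. continuous_on UNIV (\<phi>' n)" "\<And>n. equivariant (shear r1 r2) \<epsilon> (\<phi>' n)" "l2_tendsto \<phi>' v"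
    using assms unfolding L2_space_def by blast
  have [measurable]: "u \<in> borel_measurable borel" "v \<in> borel_measurable borel"
    using assms by (auto simp: L2_space_borel)
  have [measurable]: "\<phi> n \<in> borel_measurable borel" "\<phi>' n \<in> borel_measurable borel" for n
    using p p' by (auto intro: borel_measurable_continuous_onI)
  have "l2_tendsto (\<lambda>n p. \<phi> n p + z * \<phi>' n p) (\<lambda>p. u p + z * v p)"
  proof (rule l2_tendsto_le[OF p(3) p'(3), where a=2 and b="2 * (norm z)\<^sup>2"])
    fix n
    have "l2_norm_sq (\<lambda>p. \<phi> n p + z * \<phi>' n p - (u p + z * v p))
        = l2_norm_sq (\<lambda>p. (\<phi> n p - u p) + z * (\<phi>' n p - v p))"
      by (simp add: algebra_simps)
    also have "\<dots> \<le> 2 * l2_norm_sq (\<lambda>p. \<phi> n p - u p) + 2 * l2_norm_sq (\<lambda>p. z * (\<phi>' n p - v p))"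
      by (rule l2_norm_sq_add_le) measurable
    also have "l2_norm_sq (\<lambda>p. z * (\<phi>' n p - v p)) = ennreal ((norm z)\<^sup>2) * l2_norm_sq (\<lambda>p. \<phi>' n p - v p)"
      by (rule l2_norm_sq_cmult) (auto simp: norm_mult)
    finally show "l2_norm_sq (\<lambda>p. \<phi> n p + z * \<phi>' n p - (u p + z * v p)) \<le>
        ennreal 2 * l2_norm_sq (\<lambda>p. \<phi> n p - u p) + ennreal (2 * (norm z)\<^sup>2) * l2_norm_sq (\<lambda>p. \<phi>' n p - v p)"
      by (simp add: ennreal_mult mult.assoc)
  qed
  moreover have "equivariant (shear r1 r2) \<epsilon> (\<lambda>p. \<phi> n p + z * \<phi>' n p)" for n
    using p(2)[of n] p'(2)[of n] by (simp add: equivariant_iff algebra_simps)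
  moreover have "equivariant (shear r1 r2) \<epsilon> (\<lambda>p. u p + z * v p)"
    using assms by (simp add: L2_space_def equivariant_iff algebra_simps)
  ultimately show ?thesis
    using p(1) p'(1) unfolding L2_space_def
    by (auto intro!: exI[of _ "\<lambda>n p. \<phi> n p + z * \<phi>' n p"] continuous_intros)
qed

lemma SL2_add_cmult:
  "u \<in> SL2 \<Longrightarrow> v \<in> SL2 \<Longrightarrow> (\<lambda>p. u p + z *s v p) \<in> SL2"
  by (simp add: spinor_L2_def L2_add_cmult)

text \<open>Riesz--Fischer. The limit is taken pointwise wherever a fast subsequence is Cauchy; that set is
  invariant under the lattice, so the limit is equivariant everywhere and not only almost everywhere.\<close>

lemma L2_complete:
  assumes c: "\<And>n. continuous_on UNIV (\<phi> n)" and e: "\<And>n. equivariant (shear r1 r2) \<epsilon> (\<phi> n)"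
    and cauchy: "\<And>\<delta>::real. \<delta> > 0 \<Longrightarrow> \<exists>N. \<forall>m\<ge>N. \<forall>n\<ge>N. l2_norm_sq (\<lambda>p. \<phi> m p - \<phi> n p) \<le> ennreal \<delta>"
  shows "\<exists>u\<in>L2. l2_tendsto \<phi> u"
proof -
  have [measurable]: "\<phi> n \<in> borel_measurable borel" for n
    using c by (auto intro: borel_measurable_continuous_onI)
  \<comment> \<open>The rate \<open>(1/8)^k\<close> survives multiplication by the weight
    \<open>4^k\<close> of \<open>a\<close> below as a summable \<open>(1/2)^k\<close>, while
    finiteness of the weighted sum forces increments of size \<open>(1/2)^k\<close>.\<close>
  have "\<exists>N. \<forall>k. \<forall>m\<ge>N k. \<forall>n\<ge>N k. l2_norm_sq (\<lambda>p. \<phi> m p - \<phi> n p) \<le> ennreal ((1/8)^k)"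
    by (intro choice allI cauchy) simp
  then obtain N where N: "\<And>k m n. m \<ge> N k \<Longrightarrow> n \<ge> N k \<Longrightarrow> l2_norm_sq (\<lambda>p. \<phi> m p - \<phi> n p) \<le> ennreal ((1/8)^k)"
    by blast
  \<comment> \<open>The sum makes \<open>r\<close> monotone and at least \<open>N k\<close>; the
    summand \<open>k\<close> makes it unbounded, so that the subsequence enters every Cauchy
    range.\<close>
  define r where "r k = (\<Sum>j\<le>k. N j) + k" for k
  have rN: "N k \<le> r k" "r k \<le> r (Suc k)" for k
    unfolding r_def using member_le_sum[of k "{..k}" N] by auto
  define g where "g k = \<phi> (r k)" for k
  have [measurable]: "g k \<in> borel_measurable borel" for k by (simp add: g_def)
  define a where "a k p = 4 ^ k * (norm (g (Suc k) p - g k p))\<^sup>2" for k p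
  have [measurable]: "a k \<in> borel_measurable borel" for k unfolding a_def by measurable
  let ?F = "indicator fundamental_cube :: grp \<Rightarrow> ennreal"
  have "(\<integral>\<^sup>+p. (\<Sum>k. ennreal (a k p) * ?F p) \<partial>lborel) = (\<Sum>k. \<integral>\<^sup>+p. ennreal (a k p) * ?F p \<partial>lborel)"
    by (rule nn_integral_suminf) measurable
  also have "\<dots> \<le> (\<Sum>k. ennreal ((1/2)^k))"
  proof (rule suminf_le)
    fix k
    have "(\<integral>\<^sup>+p. ennreal (a k p) * ?F p \<partial>lborel) = ennreal (4^k) * l2_norm_sq (\<lambda>p. g (Suc k) p - g k p)"
      unfolding l2_norm_sq_def a_def
      by (subst nn_integral_cmult[symmetric]) (auto simp: ennreal_mult mult.assoc)
    also have "\<dots> \<le> ennreal (4^k) * ennreal ((1/8)^k)"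
      unfolding g_def using rN[of k] by (intro mult_left_mono N) auto
    also have "\<dots> = ennreal ((1/2)^k)"
      by (simp add: ennreal_mult[symmetric] power_mult_distrib[symmetric])
    finally show "(\<integral>\<^sup>+p. ennreal (a k p) * ?F p \<partial>lborel) \<le> ennreal ((1/2)^k)" .
  qed auto
  also have "\<dots> < \<infinity>"
    unfolding infinity_ennreal_def less_top[symmetric]
    by (rule ennreal_suminf_neq_top) (auto intro: summable_geometric)
  finally have "(\<integral>\<^sup>+p. (\<Sum>k. ennreal (a k p) * ?F p) \<partial>lborel) \<noteq> \<infinity>" by simp
  then have "AE p in lborel. (\<Sum>k. ennreal (a k p) * ?F p) \<noteq> \<infinity>"
    by (intro nn_integral_PInf_AE) auto
  then have ae: "AE p in lborel. p \<in> fundamental_cube \<longrightarrow> Cauchy (\<lambda>k. g k p)"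
  proof eventually_elim
    case (elim p)
    show ?case
    proof
      assume "p \<in> fundamental_cube"
      then have "(\<Sum>k. ennreal (a k p)) \<noteq> \<infinity>" using elim by simp
      then have "summable (\<lambda>k. a k p)" by (intro summable_suminf_not_top) (auto simp: a_def)
      then have "Bseq (\<lambda>k. a k p)" using summable_LIMSEQ_zero convergent_def convergent_imp_Bseq by blast
      then obtain B where B: "B > 0" "\<And>k. norm (a k p) \<le> B" by (auto elim: BseqE)
      have "norm (g (Suc k) p - g k p) \<le> sqrt B * (1/2)^k" for k
      proof -
        have "(norm (g (Suc k) p - g k p) * 2^k)\<^sup>2 \<le> B"
        proof -
          have "(4::real) ^ k = 2 ^ k * 2 ^ k" by (simp flip: power_mult_distrib)
          then have "(norm (g (Suc k) p - g k p) * 2^k)\<^sup>2 = a k p"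
            by (simp only: a_def power2_eq_square mult_ac)
          then show ?thesis using B(2)[of k] by (metis abs_le_D1 real_norm_def)
        qed
        then have "norm (g (Suc k) p - g k p) * 2^k \<le> sqrt B" by (rule real_le_rsqrt)
        then show ?thesis by (simp add: field_simps)
      qed
      note bound = this
      have s: "summable (\<lambda>k. g (Suc k) p - g k p)"
      proof (rule summable_comparison_test')
        show "summable (\<lambda>k. sqrt B * (1/2)^k)"
          by (rule summable_mult) (rule summable_geometric, simp)
        show "norm (g (Suc n) p - g n p) \<le> sqrt B * (1/2)^n" for n by (rule bound)
      qed
      have "(\<lambda>n. g 0 p + (\<Sum>k<n. g (Suc k) p - g k p)) \<longlonglongrightarrow> g 0 p + (\<Sum>k. g (Suc k) p - g k p)"
        by (intro tendsto_intros summable_LIMSEQ s)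
      then have "convergent (\<lambda>n. g n p)"
        unfolding sum_lessThan_telescope[of "\<lambda>k. g k p"] by (auto simp: convergent_def)
      then show "Cauchy (\<lambda>n. g n p)" by (rule convergent_Cauchy)
    qed
  qed
  define h where "h i p = (if Cauchy (\<lambda>k. g k p) then g i p else 0)" for i p
  define u where "u p = lim (\<lambda>i. h i p)" for p
  have hlim: "(\<lambda>i. h i p) \<longlonglongrightarrow> u p" for p
    unfolding u_def h_def convergent_LIMSEQ_iff[symmetric]
    by (cases "convergent (\<lambda>k. g k p)") (auto simp: Cauchy_convergent_iff convergent_const)
  have [measurable]: "h i \<in> borel_measurable borel" for i
  proof -
    have "{p \<in> space borel. Cauchy (\<lambda>k. g k p)} \<in> sets borel" by measurable
    then show ?thesis unfolding h_def by (intro measurable_If) auto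
  qed
  have u [measurable]: "u \<in> borel_measurable borel"
    by (rule borel_measurable_LIMSEQ_metric[of h]) (auto intro: hlim)
  have "equivariant (shear r1 r2) \<epsilon> u"
    unfolding equivariant_iff
  proof (intro ballI allI)
    fix \<gamma> y assume g: "\<gamma> \<in> lattice"
    have eq: "g k (\<gamma> \<odot> y) = sgc \<gamma> * g k y" for k
      using e[of "r k"] g unfolding equivariant_iff g_def by blast
    have "Cauchy (\<lambda>k. g k (\<gamma> \<odot> y)) = Cauchy (\<lambda>k. g k y)"
      unfolding eq Cauchy_convergent_iff by (rule convergent_mult_const_iff) simp
    then have "h i (\<gamma> \<odot> y) = sgc \<gamma> * h i y" for i by (simp add: h_def eq)
    then have "(\<lambda>i. h i (\<gamma> \<odot> y)) \<longlonglongrightarrow> sgc \<gamma> * u y" using hlim[of y] by (auto intro: tendsto_intros)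
    then show "u (\<gamma> \<odot> y) = sgc \<gamma> * u y" using hlim LIMSEQ_unique by blast
  qed
  moreover have "l2_tendsto \<phi> u"
    unfolding l2_tendsto_def
  proof (rule order_tendstoI)
    fix x :: ennreal assume "0 < x"
    have "\<exists>\<delta>::real. \<delta> > 0 \<and> ennreal \<delta> < x"
    proof (cases x rule: ennreal_cases)
      case (real r)
      then show ?thesis using \<open>0 < x\<close> by (intro exI[of _ "r/2"]) (auto simp: ennreal_less_iff)
    next
      case top
      then show ?thesis by (intro exI[of _ 1]) auto
    qed
    then obtain \<delta> where d: "\<delta> > 0" "ennreal \<delta> < x" by blast
    obtain M where M: "\<And>m n. m \<ge> M \<Longrightarrow> n \<ge> M \<Longrightarrow> l2_norm_sq (\<lambda>p. \<phi> m p - \<phi> n p) \<le> ennreal \<delta>"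
      using cauchy[OF d(1)] by blast
    have "l2_norm_sq (\<lambda>p. \<phi> n p - u p) \<le> ennreal \<delta>" if n: "n \<ge> M" for n
    proof -
      \<comment> \<open>Fatou's lemma transfers the Cauchy estimate to the pointwise limit
        \<open>u\<close>.\<close>
      have "l2_norm_sq (\<lambda>p. \<phi> n p - u p) =
          (\<integral>\<^sup>+p. liminf (\<lambda>i. ennreal ((norm (\<phi> n p - h i p))\<^sup>2) * ?F p) \<partial>lborel)"
        unfolding l2_norm_sq_def
      proof (rule nn_integral_cong)
        fix p
        have "(\<lambda>i. ennreal ((norm (\<phi> n p - h i p))\<^sup>2) * ?F p) \<longlonglongrightarrow> ennreal ((norm (\<phi> n p - u p))\<^sup>2) * ?F p"
          by (cases "p \<in> fundamental_cube") (auto intro!: tendsto_intros hlim)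
        then show "ennreal ((norm (\<phi> n p - u p))\<^sup>2) * ?F p = liminf (\<lambda>i. ennreal ((norm (\<phi> n p - h i p))\<^sup>2) * ?F p)"
          using lim_imp_Liminf[OF sequentially_bot] by metis
      qed
      also have "\<dots> \<le> liminf (\<lambda>i. \<integral>\<^sup>+p. ennreal ((norm (\<phi> n p - h i p))\<^sup>2) * ?F p \<partial>lborel)"
        by (rule nn_integral_liminf) measurable
      also have "\<dots> \<le> ennreal \<delta>"
      proof (rule Liminf_le)
        show "\<forall>\<^sub>F i in sequentially. (\<integral>\<^sup>+p. ennreal ((norm (\<phi> n p - h i p))\<^sup>2) * ?F p \<partial>lborel) \<le> ennreal \<delta>"
          using eventually_ge_at_top[of M]
        proof eventually_elim
          case (elim i)
          have "(\<integral>\<^sup>+p. ennreal ((norm (\<phi> n p - h i p))\<^sup>2) * ?F p \<partial>lborel) = l2_norm_sq (\<lambda>p. \<phi> n p - \<phi> (r i) p)"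
            unfolding l2_norm_sq_def
            by (rule nn_integral_cong_AE) (use ae in \<open>eventually_elim, auto simp: h_def g_def indicator_def\<close>)
          also have "\<dots> \<le> ennreal \<delta>" using elim n by (intro M) (auto simp: r_def)
          finally show ?case .
        qed
      qed simp
      finally show ?thesis .
    qed
    then show "\<forall>\<^sub>F n in sequentially. l2_norm_sq (\<lambda>p. \<phi> n p - u p) < x"
      using d(2) unfolding eventually_sequentially by (meson le_less_trans)
  qed auto
  ultimately have "u \<in> L2" unfolding L2_space_def using c e by auto
  then show ?thesis using \<open>l2_tendsto \<phi> u\<close> by blast
qed

end

section \<open>A criterion for the resolvent set\<close>

context sign_structure
begin

text \<open>The lower bound on the core \<open>SS\<close> passes to the closure and gives
  injectivity and a bounded inverse. For surjectivity, approximate preimages of \<open>w\<close>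
  form a Cauchy sequence by the same bound, and their limit solves the equation because the operator
  is closed.\<close>

lemma resolvent_criterion:
  fixes Dop :: "spinor \<Rightarrow> spinor" and SS :: "spinor set"
  assumes sub: "\<And>\<psi> \<phi>. \<psi> \<in> SS \<Longrightarrow> \<phi> \<in> SS \<Longrightarrow> (\<lambda>p. \<psi> p - \<phi> p) \<in> SS"
    and Dsub: "\<And>\<psi> \<phi> p. \<psi> \<in> SS \<Longrightarrow> \<phi> \<in> SS \<Longrightarrow> Dop (\<lambda>p. \<psi> p - \<phi> p) p = Dop \<psi> p - Dop \<phi> p"
    and cont: "\<And>\<psi>. \<psi> \<in> SS \<Longrightarrow> continuous_on UNIV \<psi>" "\<And>\<psi>. \<psi> \<in> SS \<Longrightarrow> continuous_on UNIV (Dop \<psi>)"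
    and equi: "\<And>\<psi>. \<psi> \<in> SS \<Longrightarrow> spinor_equivariant \<psi>"
    and bound: "\<And>\<psi>. \<psi> \<in> SS \<Longrightarrow> l2_norm_sq \<psi> \<le> ennreal C * l2_norm_sq (\<lambda>p. Dop \<psi> p - z *s \<psi> p)"
    and dense: "\<And>w \<delta>. continuous_on UNIV w \<Longrightarrow> spinor_equivariant w \<Longrightarrow> \<delta> > 0 \<Longrightarrow>
       \<exists>\<psi>\<in>SS. \<forall>p. norm (Dop \<psi> p - z *s \<psi> p - w p) \<le> \<delta>"
    and C: "C \<ge> 0"
  shows "z \<in> resolvent_set SL2 {(u, v). u \<in> SL2 \<and> v \<in> SL2 \<and>
     (\<exists>\<phi>. (\<forall>n. \<phi> n \<in> SS) \<and> l2_tendsto \<phi> u \<and> l2_tendsto (\<lambda>n. Dop (\<phi> n)) v)}" (is "z \<in> resolvent_set _ ?T")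
proof -
  have meas: "\<psi> \<in> borel_measurable borel" "Dop \<psi> \<in> borel_measurable borel" if "\<psi> \<in> SS" for \<psi>
    using cont that by (auto intro: borel_measurable_continuous_onI)
  have smult [measurable]: "(\<lambda>p. c *s f p) \<in> borel_measurable borel" if "f \<in> borel_measurable borel"
    for c :: complex and f :: spinor
    by (rule measurable_compose[OF that]) (intro borel_measurable_continuous_onI continuous_intros)
  \<comment> \<open>The factor 4 comes from two uses of the triangle inequality for squares: once to
    pass from \<open>u\<close> to its approximants and once to pass back on the right-hand
    side.\<close>
  have bound': "l2_norm_sq u \<le> ennreal (4 * C) * l2_norm_sq (\<lambda>p. v p - z *s u p)" if uv: "(u, v) \<in> ?T" for u v
  proof -
    from uv obtain \<phi> where u: "u \<in> SL2" "v \<in> SL2" and p: "\<And>n. \<phi> n \<in> SS" "l2_tendsto \<phi> u" "l2_tendsto (\<lambda>n. Dop (\<phi> n)) v"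
      by blast
    note [measurable] = u[THEN SL2_borel] meas[OF p(1)]
    let ?L = "l2_norm_sq (\<lambda>p. v p - z *s u p)"
    let ?a = "\<lambda>n. l2_norm_sq (\<lambda>p. \<phi> n p - u p)"
    let ?b = "\<lambda>n. l2_norm_sq (\<lambda>p. (Dop (\<phi> n) p - z *s \<phi> n p) - (v p - z *s u p))"
    have "l2_tendsto (\<lambda>n p. Dop (\<phi> n) p - z *s \<phi> n p) (\<lambda>p. v p - z *s u p)"
    proof (rule l2_tendsto_le[OF p(3,2), where a=2 and b="2 * (norm z)\<^sup>2"])
      fix n
      have "?b n = l2_norm_sq (\<lambda>p. (Dop (\<phi> n) p - v p) + (- z) *s (\<phi> n p - u p))"
        by (rule l2_norm_sq_cong) (simp add: vec_eq_iff algebra_simps)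
      also have "\<dots> \<le> 2 * l2_norm_sq (\<lambda>p. Dop (\<phi> n) p - v p) + 2 * l2_norm_sq (\<lambda>p. (- z) *s (\<phi> n p - u p))"
        by (rule l2_norm_sq_add_le) measurable
      also have "l2_norm_sq (\<lambda>p. (- z) *s (\<phi> n p - u p)) = ennreal ((norm z)\<^sup>2) * ?a n"
        by (rule l2_norm_sq_cmult) (measurable, simp only: norm_vector_smult norm_minus_cancel)
      finally show "?b n \<le> ennreal 2 * l2_norm_sq (\<lambda>p. Dop (\<phi> n) p - v p) + ennreal (2 * (norm z)\<^sup>2) * ?a n"
        by (simp add: ennreal_mult mult.assoc)
    qed
    then have b: "?b \<longlonglongrightarrow> 0" by (simp add: l2_tendsto_def)
    have a: "?a \<longlonglongrightarrow> 0" using p(2) by (simp add: l2_tendsto_def)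
    have le: "l2_norm_sq u \<le> 2 * ?a n + 2 * (ennreal C * (2 * ?b n + 2 * ?L))" for n
    proof -
      have "l2_norm_sq u \<le> 2 * l2_norm_sq (\<lambda>p. u p - \<phi> n p) + 2 * l2_norm_sq (\<phi> n)"
        using l2_norm_sq_add_le[of "\<lambda>p. u p - \<phi> n p" "\<phi> n"] by simp
      also have "l2_norm_sq (\<lambda>p. u p - \<phi> n p) = ?a n" by (rule l2_norm_sq_uminus)
      also have "l2_norm_sq (\<phi> n) \<le> ennreal C * l2_norm_sq (\<lambda>p. Dop (\<phi> n) p - z *s \<phi> n p)"
        by (rule bound[OF p(1)])
      also have "l2_norm_sq (\<lambda>p. Dop (\<phi> n) p - z *s \<phi> n p) \<le> 2 * ?b n + 2 * ?L"
        using l2_norm_sq_add_le[of "\<lambda>p. (Dop (\<phi> n) p - z *s \<phi> n p) - (v p - z *s u p)" "\<lambda>p. v p - z *s u p"] by simp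
      finally show ?thesis by (simp add: add_left_mono mult_left_mono)
    qed
    have "(\<lambda>n. 2 * ?a n + 2 * (ennreal C * (2 * ?b n + 2 * ?L))) \<longlonglongrightarrow> 2 * 0 + 2 * (ennreal C * (2 * 0 + 2 * ?L))"
      by (intro tendsto_add ennreal_tendsto_cmult a b tendsto_const) auto
    then have "l2_norm_sq u \<le> 2 * 0 + 2 * (ennreal C * (2 * 0 + 2 * ?L))"
      by (rule LIMSEQ_le_const) (use le in auto)
    also have "\<dots> = ennreal (4 * C) * ?L"
      using C by (simp add: ennreal_mult mult_ac)
    finally show ?thesis .
  qed
  have surj: "\<exists>(u, v)\<in>?T. ae_eq (\<lambda>p. v p - z *s u p) w" if w: "w \<in> SL2" for w
  proof -
    have "\<exists>\<phi>. (\<forall>n. continuous_on UNIV (\<phi> n) \<and> equivariant (shear r1 r2) \<epsilon> (\<phi> n)) \<and> l2_tendsto \<phi> (\<lambda>p. w p $ a)" for a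
      using w by (simp add: spinor_L2_def L2_space_def)
    then obtain \<phi> where f: "\<And>a n. continuous_on UNIV (\<phi> a n)" "\<And>a n. equivariant (shear r1 r2) \<epsilon> (\<phi> a n)"
      "\<And>a. l2_tendsto (\<phi> a) (\<lambda>p. w p $ a)" by metis
    define W :: "nat \<Rightarrow> spinor" where "W n p = (\<chi> a. \<phi> a n p)" for n p
    have W: "continuous_on UNIV (W n)" "spinor_equivariant (W n)" for n
      unfolding W_def spinor_equivariant_iff using f by (auto intro!: continuous_intros)
    have "\<exists>\<psi>\<in>SS. \<forall>p. norm (Dop \<psi> p - z *s \<psi> p - W n p) \<le> 1 / real (Suc n)" for n
      by (rule dense[OF W]) simp
    then obtain \<psi> where p: "\<And>n. \<psi> n \<in> SS" "\<And>n p. norm (Dop (\<psi> n) p - z *s \<psi> n p - W n p) \<le> 1 / real (Suc n)"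
      by metis
    define B where "B n p = Dop (\<psi> n) p - z *s \<psi> n p" for n p
    note [measurable] = SL2_borel[OF w] meas[OF p(1)]
    have [measurable]: "W n \<in> borel_measurable borel" for n using W by (auto intro: borel_measurable_continuous_onI)
    have [measurable]: "B n \<in> borel_measurable borel" for n unfolding B_def by measurable
    have "l2_tendsto (\<lambda>n. W n) w"
    proof (rule l2_tendsto_le[OF f(3)[of 1] f(3)[of 2], where a=1 and b=1])
      show "l2_norm_sq (\<lambda>p. W n p - w p) \<le> ennreal 1 * l2_norm_sq (\<lambda>p. \<phi> 1 n p - w p $ 1) +
         ennreal 1 * l2_norm_sq (\<lambda>p. \<phi> 2 n p - w p $ 2)" for n
      proof -
        have "l2_norm_sq (\<lambda>p. W n p - w p) = l2_norm_sq (\<lambda>p. (W n p - w p) $ 1) + l2_norm_sq (\<lambda>p. (W n p - w p) $ 2)"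
          by (rule l2_norm_sq_spinor) measurable
        then show ?thesis by (simp add: W_def)
      qed
    qed
    moreover have "l2_tendsto (\<lambda>n p. B n p - W n p) (\<lambda>p. 0)"
      unfolding l2_tendsto_def
    proof (rule tendsto_sandwich[OF _ _ tendsto_const])
      show "\<forall>\<^sub>F n in sequentially. l2_norm_sq (\<lambda>p. B n p - W n p - 0) \<le> ennreal ((1 / real (Suc n))\<^sup>2)"
        by (intro always_eventually allI l2_norm_sq_le_const) (use p(2) in \<open>simp add: B_def\<close>)
      have "(\<lambda>n. (1 / real (Suc n))\<^sup>2) \<longlonglongrightarrow> 0\<^sup>2"
        by (intro tendsto_power LIMSEQ_Suc lim_1_over_n)
      then show "(\<lambda>n. ennreal ((1 / real (Suc n))\<^sup>2)) \<longlonglongrightarrow> 0"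
        by (subst ennreal_tendsto_0_iff) auto
    qed auto
    ultimately have Bw: "l2_tendsto B w"
    proof (rule l2_tendsto_le[where a=2 and b=2])
      fix n
      have "l2_norm_sq (\<lambda>p. B n p - w p) \<le> 2 * l2_norm_sq (\<lambda>p. B n p - W n p) + 2 * l2_norm_sq (\<lambda>p. W n p - w p)"
        by (rule l2_norm_sq_diff_le) measurable
      then show "l2_norm_sq (\<lambda>p. B n p - w p) \<le>
        ennreal 2 * l2_norm_sq (\<lambda>p. W n p - w p) + ennreal 2 * l2_norm_sq (\<lambda>p. B n p - W n p - 0)"
        by (simp add: add.commute)
    qed
    have cau: "\<exists>N. \<forall>m\<ge>N. \<forall>n\<ge>N. l2_norm_sq (\<lambda>p. \<psi> m p - \<psi> n p) \<le> ennreal \<delta>" if d: "\<delta> > 0" for \<delta> :: real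
    proof -
      \<comment> \<open>Chosen so that \<open>C * (4 * \<eta>)\<close> stays below \<delta>; the 4
        is two errors of weight 2, and \<open>C + 1\<close> avoids a division by zero.\<close>
      define \<eta> where "\<eta> = \<delta> / (4 * (C + 1))"
      have e: "\<eta> > 0" using d C by (simp add: \<eta>_def)
      have "\<forall>\<^sub>F n in sequentially. l2_norm_sq (\<lambda>p. B n p - w p) < ennreal \<eta>"
        using Bw e unfolding l2_tendsto_def by (intro order_tendstoD(2)) auto
      then obtain N where N: "\<And>n. n \<ge> N \<Longrightarrow> l2_norm_sq (\<lambda>p. B n p - w p) \<le> ennreal \<eta>"
        unfolding eventually_sequentially by (meson less_imp_le)
      have "l2_norm_sq (\<lambda>p. \<psi> m p - \<psi> n p) \<le> ennreal \<delta>" if mn: "m \<ge> N" "n \<ge> N" for m n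
      proof -
        have "l2_norm_sq (\<lambda>p. \<psi> m p - \<psi> n p) \<le>
            ennreal C * l2_norm_sq (\<lambda>p. Dop (\<lambda>p. \<psi> m p - \<psi> n p) p - z *s (\<psi> m p - \<psi> n p))"
          by (rule bound[OF sub[OF p(1) p(1)]])
        also have "l2_norm_sq (\<lambda>p. Dop (\<lambda>p. \<psi> m p - \<psi> n p) p - z *s (\<psi> m p - \<psi> n p)) = l2_norm_sq (\<lambda>p. B m p - B n p)"
          by (rule l2_norm_sq_cong) (simp add: Dsub[OF p(1) p(1)] B_def algebra_simps vec_eq_iff)
        also have "\<dots> \<le> 2 * l2_norm_sq (\<lambda>p. B m p - w p) + 2 * l2_norm_sq (\<lambda>p. w p - B n p)"
          by (rule l2_norm_sq_diff_le) measurable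
        also have "l2_norm_sq (\<lambda>p. w p - B n p) = l2_norm_sq (\<lambda>p. B n p - w p)" by (rule l2_norm_sq_uminus)
        also have "ennreal C * (2 * l2_norm_sq (\<lambda>p. B m p - w p) + 2 * l2_norm_sq (\<lambda>p. B n p - w p))
            \<le> ennreal C * (2 * ennreal \<eta> + 2 * ennreal \<eta>)"
          by (intro mult_left_mono add_mono N mn) auto
        also have "2 * ennreal \<eta> + 2 * ennreal \<eta> = 4 * ennreal \<eta>" by (simp flip: distrib_right)
        also have "ennreal C * (4 * ennreal \<eta>) = ennreal (C * (4 * \<eta>))"
          using C e by (simp add: ennreal_mult)
        also have "C * (4 * \<eta>) \<le> \<delta>"
          using C d by (simp add: \<eta>_def divide_simps)
        finally show ?thesis by (simp add: ennreal_leI mult_left_mono)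
      qed
      then show ?thesis by blast
    qed
    have "\<exists>u\<in>L2. l2_tendsto (\<lambda>n p. \<psi> n p $ a) u" for a
    proof (rule L2_complete)
      show "continuous_on UNIV (\<lambda>p. \<psi> n p $ a)" for n using cont(1)[OF p(1)] by (intro continuous_intros)
      show "equivariant (shear r1 r2) \<epsilon> (\<lambda>p. \<psi> n p $ a)" for n
        using equi[OF p(1)] by (simp add: spinor_equivariant_iff)
      fix \<delta> :: real assume "\<delta> > 0"
      from cau[OF this] obtain N where N: "\<And>m n. m \<ge> N \<Longrightarrow> n \<ge> N \<Longrightarrow> l2_norm_sq (\<lambda>p. \<psi> m p - \<psi> n p) \<le> ennreal \<delta>"
        by blast
      have "l2_norm_sq (\<lambda>p. \<psi> m p $ a - \<psi> n p $ a) \<le> l2_norm_sq (\<lambda>p. \<psi> m p - \<psi> n p)" for m n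
        by (rule l2_norm_sq_mono) (unfold vector_minus_component[symmetric], rule Finite_Cartesian_Product.norm_nth_le)
      then show "\<exists>N. \<forall>m\<ge>N. \<forall>n\<ge>N. l2_norm_sq (\<lambda>p. \<psi> m p $ a - \<psi> n p $ a) \<le> ennreal \<delta>"
        using N order_trans by blast
    qed
    then obtain U where U: "\<And>a. U a \<in> L2" "\<And>a. l2_tendsto (\<lambda>n p. \<psi> n p $ a) (U a)" by metis
    define u :: spinor where "u p = (\<chi> a. U a p)" for p
    have u: "u \<in> SL2" using U(1) by (simp add: spinor_L2_def u_def)
    note [measurable] = SL2_borel[OF u]
    have tu: "l2_tendsto \<psi> u"
    proof (rule l2_tendsto_le[OF U(2)[of 1] U(2)[of 2], where a=1 and b=1])
      show "l2_norm_sq (\<lambda>p. \<psi> n p - u p) \<le> ennreal 1 * l2_norm_sq (\<lambda>p. \<psi> n p $ 1 - U 1 p) +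
         ennreal 1 * l2_norm_sq (\<lambda>p. \<psi> n p $ 2 - U 2 p)" for n
      proof -
        have "l2_norm_sq (\<lambda>p. \<psi> n p - u p) = l2_norm_sq (\<lambda>p. (\<psi> n p - u p) $ 1) + l2_norm_sq (\<lambda>p. (\<psi> n p - u p) $ 2)"
          by (rule l2_norm_sq_spinor) measurable
        then show ?thesis by (simp add: u_def)
      qed
    qed
    define v :: spinor where "v p = w p + z *s u p" for p
    have v: "v \<in> SL2" unfolding v_def by (rule SL2_add_cmult[OF w u])
    have "l2_tendsto (\<lambda>n. Dop (\<psi> n)) v"
    proof (rule l2_tendsto_le[OF Bw tu, where a=2 and b="2 * (norm z)\<^sup>2"])
      fix n
      have "l2_norm_sq (\<lambda>p. Dop (\<psi> n) p - v p) = l2_norm_sq (\<lambda>p. (B n p - w p) + z *s (\<psi> n p - u p))"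
        by (rule l2_norm_sq_cong) (simp add: B_def v_def vec_eq_iff algebra_simps)
      also have "\<dots> \<le> 2 * l2_norm_sq (\<lambda>p. B n p - w p) + 2 * l2_norm_sq (\<lambda>p. z *s (\<psi> n p - u p))"
        by (rule l2_norm_sq_add_le) measurable
      also have "l2_norm_sq (\<lambda>p. z *s (\<psi> n p - u p)) = ennreal ((norm z)\<^sup>2) * l2_norm_sq (\<lambda>p. \<psi> n p - u p)"
        by (rule l2_norm_sq_cmult) (measurable, simp only: norm_vector_smult)
      finally show "l2_norm_sq (\<lambda>p. Dop (\<psi> n) p - v p) \<le>
          ennreal 2 * l2_norm_sq (\<lambda>p. B n p - w p) + ennreal (2 * (norm z)\<^sup>2) * l2_norm_sq (\<lambda>p. \<psi> n p - u p)"
        by (simp add: ennreal_mult mult.assoc)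
    qed
    then have "(u, v) \<in> ?T" using u v p(1) tu by blast
    moreover have "ae_eq (\<lambda>p. v p - z *s u p) w" by (simp add: v_def ae_eq_def)
    ultimately show ?thesis by blast
  qed
  have "ae_eq u (\<lambda>p. 0)" if "(u, v) \<in> ?T" "ae_eq (\<lambda>p. v p - z *s u p) (\<lambda>p. 0)" for u v
  proof (rule l2_zero_imp_ae)
    have u: "u \<in> SL2" using that(1) by blast
    then show "u \<in> borel_measurable borel" by (rule SL2_borel)
    show "norm (u (\<gamma> \<odot> p)) = norm (u p)" if "\<gamma> \<in> lattice" for \<gamma> p
      using SL2_equivariant[OF u] that by (simp only: spinor_equivariant_def norm_vector_smult norm_sgc mult_1)
    have "l2_norm_sq (\<lambda>p. v p - z *s u p) = l2_norm_sq (\<lambda>p. 0 :: complex^2)"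
      unfolding l2_norm_sq_def
      by (rule nn_integral_cong_AE, rule eventually_mono[OF that(2)[unfolded ae_eq_def]]) simp
    also have "\<dots> = 0" by (simp add: l2_norm_sq_def)
    finally show "l2_norm_sq u = 0" using bound'[OF that(1)] by simp
  qed
  with bound' surj show ?thesis unfolding resolvent_set_def by blast
qed

end

section \<open>The sub-Dirac operator in the left-invariant frame\<close>

definition frame_dir :: "3 \<Rightarrow> (real^4) \<times> real" where
  "frame_dir i = (if i = 1 then (axis 3 1, 0) else if i = 2 then (axis 4 1, 0) else (0, 1))"

text \<open>Left translation is affine in the coordinates of \<open>grp\<close>, so its differential
  does not depend on the point \<open>p\<close>.\<close>

lemma left_translate_diff_shear:
  "left_translate_diff (shear r1 r2) a p v = (shear r1 r2 (snd a) *v fst v, snd v)"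
proof -
  have "(gmul r1 r2 a has_derivative (\<lambda>v. (shear r1 r2 (snd a) *v fst v, snd v))) (at p)"
    unfolding gmul_def
    by (rule has_derivative_eq_rhs, (rule derivative_intros bounded_linear.has_derivative[OF matrix_vector_mul_bounded_linear])+)
       (simp add: fun_eq_iff)
  then have "frechet_derivative (gmul r1 r2 a) (at p) = (\<lambda>v. (shear r1 r2 (snd a) *v fst v, snd v))"
    by (rule frechet_derivative_at[symmetric])
  then show ?thesis by (simp add: left_translate_diff_def semidirect_mult)
qed

lemma frame_shear: "frame (shear r1 r2) i p = (shear r1 r2 (snd p) *v fst (frame_dir i), snd (frame_dir i))"
  unfolding frame_def frame_dir_def left_invariant_field_def left_translate_diff_shear by simp

lemma three_neq: "(2::3) \<noteq> 1" "(3::3) \<noteq> 1" "(3::3) \<noteq> 2" "(1::3) \<noteq> 2" "(1::3) \<noteq> 3" "(2::3) \<noteq> 3"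
  by simp_all

lemma frame_values:
  "frame (shear r1 r2) 1 p = (axis 3 1 + (of_int r1 * snd p) *\<^sub>R axis 1 1, 0)"
  "frame (shear r1 r2) 2 p = (axis 4 1 + (of_int r2 * snd p) *\<^sub>R axis 2 1, 0)"
  "frame (shear r1 r2) 3 p = (0, 1)"
  by (simp_all add: frame_shear frame_dir_def shear_basis)

subsection \<open>Smoothness\<close>

lemma Ck_const: "Ck n (\<lambda>p. c)"
  by (induction n arbitrary: c) (auto simp: differentiable_on_def)

lemma Ck_add:
  "Ck n f \<Longrightarrow> Ck n h \<Longrightarrow> Ck n (\<lambda>p. f p + h p)"
proof (induction n arbitrary: f h)
  case (Suc n)
  have d: "f differentiable at p" "h differentiable at p" for p
    using Suc.prems by (auto simp: differentiable_on_def)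
  have "frechet_derivative (\<lambda>p. f p + h p) (at p) v = frechet_derivative f (at p) v + frechet_derivative h (at p) v" for p v
    using d[of p] by (metis (no_types, lifting) ext frechet_derivative_at frechet_derivative_works has_derivative_add)
  then show ?case
    using Suc d by (auto simp: differentiable_on_def intro!: differentiable_add)
qed (auto intro: continuous_intros)

lemma Ck_bounded_linear:
  assumes L: "bounded_linear L"
  shows "Ck n f \<Longrightarrow> Ck n (\<lambda>p. L (f p))"
proof (induction n arbitrary: f)
  case 0
  then show ?case using bounded_linear.continuous_on[OF L] by auto
next
  case (Suc n)
  have d: "f differentiable at p" for p
    using Suc.prems by (auto simp: differentiable_on_def)
  have D: "((\<lambda>p. L (f p)) has_derivative (\<lambda>v. L (frechet_derivative f (at p) v))) (at p)" for p
    using bounded_linear.has_derivative[OF L] d[of p] frechet_derivative_works by blast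
  have "frechet_derivative (\<lambda>p. L (f p)) (at p) v = L (frechet_derivative f (at p) v)" for p v
    using frechet_derivative_at[OF D, of p] by (rule fun_cong[symmetric])
  then show ?case
    using Suc D by (auto simp: differentiable_on_def differentiable_def intro!: exI)
qed

lemma smooth_const: "smooth (\<lambda>p. c)" by (simp add: smooth_def Ck_const)
lemma smooth_add: "smooth f \<Longrightarrow> smooth h \<Longrightarrow> smooth (\<lambda>p. f p + h p)" by (simp add: smooth_def Ck_add)
lemma smooth_bounded_linear: "bounded_linear L \<Longrightarrow> smooth f \<Longrightarrow> smooth (\<lambda>p. L (f p))"
  by (simp add: smooth_def Ck_bounded_linear)

lemma smooth_id: "smooth (\<lambda>p. p)"
proof -
  have "Ck n (\<lambda>p::'a. p)" for n
    by (cases n) (auto simp: differentiable_on_def frechet_derivative_ident[unfolded id_def] Ck_const intro: continuous_intros)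
  then show ?thesis by (simp add: smooth_def)
qed

lemma smooth_linear: "bounded_linear L \<Longrightarrow> smooth L"
  using smooth_bounded_linear[of L, OF _ smooth_id] by simp

lemma smooth_continuous: "smooth f \<Longrightarrow> continuous_on UNIV f"
  unfolding smooth_def by (metis Ck.simps(1))

lemma smooth_differentiable: "smooth f \<Longrightarrow> f differentiable at p"
  unfolding smooth_def using Ck.simps(2)[of 0 f] by (auto simp: differentiable_on_def)

lemma smooth_has_derivative: "smooth f \<Longrightarrow> (f has_derivative frechet_derivative f (at p)) (at p)"
  using smooth_differentiable frechet_derivative_works by blast

lemma smooth_frechet: "smooth f \<Longrightarrow> smooth (\<lambda>p. frechet_derivative f (at p) v)"
  unfolding smooth_def using Ck.simps(2) by blast

lemma continuous_frechet_direction: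
  assumes f: "smooth f"
  shows "continuous_on UNIV (\<lambda>p::'a::euclidean_space. frechet_derivative f (at p) v)"
  using smooth_continuous[OF smooth_frechet[OF f]] .

text \<open>Smoothness controls derivatives in fixed directions; the dependence of the frame on the
  point is therefore moved into the scalar coefficient \<open>snd p\<close>.\<close>

lemma deriv_along_frame:
  assumes f: "smooth f"
  shows "deriv_along (frame (shear r1 r2) 1) f p = frechet_derivative f (at p) (axis 3 1, 0)
      + (of_int r1 * snd p) *\<^sub>R frechet_derivative f (at p) (axis 1 1, 0)"
    "deriv_along (frame (shear r1 r2) 2) f p = frechet_derivative f (at p) (axis 4 1, 0)
      + (of_int r2 * snd p) *\<^sub>R frechet_derivative f (at p) (axis 2 1, 0)"
    "deriv_along (frame (shear r1 r2) 3) f p = frechet_derivative f (at p) (0, 1)"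
proof -
  interpret bounded_linear "frechet_derivative f (at p)"
    using smooth_has_derivative[OF f] has_derivative_bounded_linear by blast
  have "(axis 3 1 + a *\<^sub>R axis 1 1 :: real^4, 0) = (axis 3 1, 0) + a *\<^sub>R (axis 1 1, 0::real)"
    "(axis 4 1 + a *\<^sub>R axis 2 1 :: real^4, 0) = (axis 4 1, 0) + a *\<^sub>R (axis 2 1, 0::real)" for a by auto
  then show "deriv_along (frame (shear r1 r2) 1) f p = frechet_derivative f (at p) (axis 3 1, 0)
      + (of_int r1 * snd p) *\<^sub>R frechet_derivative f (at p) (axis 1 1, 0)"
    "deriv_along (frame (shear r1 r2) 2) f p = frechet_derivative f (at p) (axis 4 1, 0)
      + (of_int r2 * snd p) *\<^sub>R frechet_derivative f (at p) (axis 2 1, 0)"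
    by (simp_all only: deriv_along_def frame_values add scaleR)
qed (simp add: deriv_along_def frame_values)

lemma continuous_deriv_along_frame:
  assumes f: "smooth f"
  shows "continuous_on UNIV (deriv_along (frame (shear r1 r2) i) f)"
proof -
  have "continuous_on UNIV (\<lambda>p. deriv_along (frame (shear r1 r2) i) f p)"
    using exhaust_3[of i]
    by (elim disjE) (simp_all only: deriv_along_frame[OF f], (intro continuous_intros continuous_frechet_direction f)+)
  then show ?thesis by simp
qed

subsection \<open>The Christoffel symbols\<close>

lemma frame_section: "frame (shear r1 r2) i \<in> sections (shear r1 r2)"
proof -
  have "smooth (\<lambda>p::grp. (x, c) + (\<lambda>p. (snd p *\<^sub>R y, 0)) p)" for x y :: "real^4" and c :: real
    by (intro smooth_add smooth_const smooth_linear) (intro bounded_linear_intros bounded_linear_Pair)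
  then have s: "smooth (\<lambda>p::grp. (x + snd p *\<^sub>R y, c))" for x y :: "real^4" and c :: real by simp
  have "frame (shear r1 r2) i = (\<lambda>p. frame (shear r1 r2) i p)" by simp
  moreover have "smooth \<dots>"
    using exhaust_3[of i] s[of "axis 3 1" "of_int r1 *\<^sub>R axis 1 1" 0] s[of "axis 4 1" "of_int r2 *\<^sub>R axis 2 1" 0]
    by (elim disjE) (simp_all only: frame_values smooth_const, simp_all add: mult.commute)
  ultimately show ?thesis
    by (auto simp: sections_def distribution_def intro: span_base)
qed

locale subriemannian =
  fixes r1 r2 :: int and g :: "grp \<Rightarrow> grp \<Rightarrow> grp \<Rightarrow> real" and nab :: conn
  assumes g: "riemannian_metric (shear r1 r2) g"
    and on: "orthonormal_frame (shear r1 r2) g"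
    and met: "metric_connection (shear r1 r2) g nab"
    and inv: "left_invariant_connection (shear r1 r2) nab"
    and tr: "\<And>j p. (\<Sum>i\<in>UNIV. g p (nab (frame (shear r1 r2) i) (frame (shear r1 r2) j) p) (frame (shear r1 r2) i p)) = 0"
begin

abbreviation "E \<equiv> frame (shear r1 r2)"
abbreviation "H \<equiv> distribution (shear r1 r2)"
definition "\<Gamma> i j k = christoffel (shear r1 r2) g nab i j k 0"

lemma inner_product: "inner_product_on (H p) (g p)"
  using g unfolding riemannian_metric_def by blast

lemma E_in_H: "E i p \<in> H p" by (simp add: distribution_def span_base)

lemma nab_in_H: "nab (E i) (E j) p \<in> H p"
proof -
  have "connection (shear r1 r2) nab" using met unfolding metric_connection_def by (rule conjunct1)
  then have "\<forall>X\<in>sections (shear r1 r2). \<forall>Y\<in>sections (shear r1 r2). nab X Y \<in> sections (shear r1 r2)"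
    unfolding connection_def by (rule conjunct1)
  then have "nab (E i) (E j) \<in> sections (shear r1 r2)" using frame_section by blast
  then show ?thesis unfolding sections_def by blast
qed

lemma H_scale: "u \<in> H p \<Longrightarrow> c *\<^sub>R u \<in> H p"
  unfolding distribution_def by (rule span_scale)

lemma H_add: "u \<in> H p \<Longrightarrow> v \<in> H p \<Longrightarrow> u + v \<in> H p"
  unfolding distribution_def by (rule span_add)

lemma g_add: "u \<in> H p \<Longrightarrow> v \<in> H p \<Longrightarrow> g p (u + v) (E k p) = g p u (E k p) + g p v (E k p)"
  using inner_product[of p] E_in_H[of k p] unfolding inner_product_on_def by blast

lemma g_scale: "g p (c *\<^sub>R E l p) (E k p) = (if k = l then c else 0)"
proof -
  have "g p (c *\<^sub>R E l p) (E k p) = c * g p (E l p) (E k p)"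
    using inner_product[of p] E_in_H[of k p] E_in_H[of l p] unfolding inner_product_on_def by blast
  moreover have "g p (E l p) (E k p) = (if l = k then 1 else 0)"
    using on unfolding orthonormal_frame_def by blast
  ultimately show ?thesis by auto
qed

text \<open>Expansion in an orthonormal frame, by induction over the span. Membership in
  \<open>H p\<close> is carried along because \<open>g p\<close> is bilinear only on the
  distribution.\<close>

lemma H_combination:
  assumes "u \<in> H p"
  shows "u = (\<Sum>k\<in>UNIV. g p u (E k p) *\<^sub>R E k p)"
proof -
  have "u \<in> H p \<and> u = (\<Sum>k\<in>UNIV. g p u (E k p) *\<^sub>R E k p)"
    using assms unfolding distribution_def
  proof (induction rule: span_induct_alt)
    case base
    have "g p 0 (E k p) = 0" for k
      using g_scale[of p 0 1 k] by (simp split: if_splits)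
    then show ?case by (simp add: span_zero)
  next
    case (step c x y)
    then obtain i where x: "x = E i p" by blast
    have y: "y \<in> H p" using step unfolding distribution_def by simp
    have cx: "c *\<^sub>R x \<in> H p" using x E_in_H H_scale by blast
    have *: "g p (c *\<^sub>R x + y) (E k p) = (if k = i then c else 0) + g p y (E k p)" for k
      using g_add[OF cx y] g_scale by (simp add: x)
    have "(\<Sum>k\<in>UNIV. (if k = i then c else 0) *\<^sub>R E k p) = c *\<^sub>R x"
      by (subst sum.mono_neutral_right[of UNIV "{i}"]) (auto simp: x)
    then show ?case using step H_add[OF cx y] unfolding distribution_def
      by (simp add: * scaleR_add_left sum.distrib)
  qed
  then show ?thesis by simp
qed

lemma push_forward_frame: "push_forward (shear r1 r2) a (E i) = E i"
  by (rule ext)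
     (simp add: push_forward_def left_translate_diff_shear frame_shear semidirect_mult semidirect_inv
       shear_add gmul_def ginv_def)

text \<open>Left invariance carries the vector \<open>nab (E i) (E j)\<close> from the identity to
  \<open>p\<close>; its coefficients in the frame are unchanged because the frame is carried along
  too.\<close>

lemma christoffel_const: "christoffel (shear r1 r2) g nab i j k p = \<Gamma> i j k"
proof -
  have p0: "ginv r1 r2 p \<otimes>\<^bsub>semidirect (shear r1 r2)\<^esub> p = 0" by (simp add: semidirect_mult ginv_gmul)
  have "nab (E i) (E j) p = push_forward (shear r1 r2) p (nab (E i) (E j)) p"
    using inv frame_section[of r1 r2] unfolding left_invariant_connection_def by (metis push_forward_frame)
  also have "\<dots> = left_translate_diff (shear r1 r2) p 0 (nab (E i) (E j) 0)"
    by (simp only: push_forward_def Let_def semidirect_inv p0)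
  also have "nab (E i) (E j) 0 = (\<Sum>k\<in>UNIV. \<Gamma> i j k *\<^sub>R E k 0)"
    using H_combination[OF nab_in_H[of i j 0]] by (simp add: \<Gamma>_def christoffel_def)
  also have "left_translate_diff (shear r1 r2) p 0 \<dots> = (\<Sum>k\<in>UNIV. \<Gamma> i j k *\<^sub>R E k p)"
    by (simp add: left_translate_diff_shear frame_shear shear_0 sum_3 matrix_vector_right_distrib scaleR_matrix_vector_assoc
        matrix_vector_mult_scaleR)
  finally have eq: "nab (E i) (E j) p = (\<Sum>k\<in>UNIV. \<Gamma> i j k *\<^sub>R E k p)" .
  have "g p (\<Sum>k\<in>UNIV. \<Gamma> i j k *\<^sub>R E k p) (E k p) = \<Gamma> i j k"
    using exhaust_3[of k] by (auto simp: sum_3 g_add H_add H_scale E_in_H g_scale three_neq)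
  then show ?thesis by (simp add: christoffel_def eq)
qed

text \<open>Metric compatibility applied to the constant function
  \<open>g (E j) (E k)\<close>.\<close>

lemma Gamma_antisym: "\<Gamma> i j k = - \<Gamma> i k j"
proof -
  have "deriv_along (E i) (\<lambda>q. g q (E j q) (E k q)) 0 = g 0 (nab (E i) (E j) 0) (E k 0) + g 0 (E j 0) (nab (E i) (E k) 0)"
    using met frame_section[of r1 r2] unfolding metric_connection_def by blast
  moreover have "deriv_along (E i) (\<lambda>q. g q (E j q) (E k q)) 0 = 0"
  proof -
    have "(\<lambda>q. g q (E j q) (E k q)) = (\<lambda>q. if j = k then 1 else 0)"
      using on unfolding orthonormal_frame_def by blast
    then show ?thesis by (simp add: deriv_along_def)
  qed
  moreover have "g 0 (E j 0) (nab (E i) (E k) 0) = g 0 (nab (E i) (E k) 0) (E j 0)"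
    using inner_product[of 0] E_in_H[of j 0] nab_in_H[of i k 0] unfolding inner_product_on_def by blast
  ultimately show ?thesis by (simp add: \<Gamma>_def christoffel_def)
qed

lemma Gamma_trace: "\<Gamma> 1 j 1 + \<Gamma> 2 j 2 + \<Gamma> 3 j 3 = 0"
  using tr[of 0 j] by (simp add: \<Gamma>_def christoffel_def sum_3)

definition "al = alpha (shear r1 r2) g nab"

lemma al_eq: "al = - (1 / 2) * (\<Gamma> 1 2 3 + \<Gamma> 2 3 1 + \<Gamma> 3 1 2)"
  by (simp add: al_def alpha_def \<Gamma>_def zero_prod_def)

lemma clifford_values:
  "clifford 1 *v v = vector [\<i> * v $ 2, \<i> * v $ 1]"
  "clifford 2 *v v = vector [- v $ 2, v $ 1]"
  "clifford 3 *v v = vector [\<i> * v $ 1, - \<i> * v $ 2]"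
  by (simp_all add: clifford_def vec_eq_iff forall_2 matrix_vector_mult_def sum_2 three_neq)

text \<open>The product of the three Clifford matrices is minus the identity, so index triples
  without repetition contribute -2 times the cyclic sum of the \<Gamma>, a quarter of which is
  \<open>al\<close>. By antisymmetry the triples with a repetition collect into the traces, which
  vanish by hypothesis.\<close>

lemma dirac_eq:
  "dirac (shear r1 r2) g nab \<psi> p =
     (\<Sum>i\<in>UNIV. clifford i *v deriv_along (E i) \<psi> p) + of_real al *s \<psi> p"
proof -
  have diag: "\<Gamma> i j j = 0" for i j using Gamma_antisym[of i j j] by simp
  have flip: "\<Gamma> i 2 1 = - \<Gamma> i 1 2" "\<Gamma> i 3 1 = - \<Gamma> i 1 3" "\<Gamma> i 3 2 = - \<Gamma> i 2 3" for i
    by (rule Gamma_antisym)+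
  have t: "\<Gamma> 3 1 3 = - \<Gamma> 2 1 2" "\<Gamma> 3 2 3 = \<Gamma> 1 1 2" "\<Gamma> 2 2 3 = - \<Gamma> 1 1 3"
    using Gamma_trace[of 1] Gamma_trace[of 2] Gamma_trace[of 3] by (simp_all add: diag flip)
  have "(1 / 4) *s (\<Sum>i\<in>UNIV. \<Sum>j\<in>UNIV. \<Sum>k\<in>UNIV. complex_of_real (\<Gamma> i j k) *s
          ((clifford i ** clifford j ** clifford k) *v v)) = of_real al *s v" for v :: "complex^2"
    unfolding al_eq
    by (simp add: sum_3 diag flip t matrix_vector_mul_assoc[symmetric] clifford_values vec_eq_iff forall_2 field_simps)
  then show ?thesis by (simp add: dirac_def christoffel_const)
qed

end

section \<open>Symmetry of the sub-Dirac operator\<close>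

lemma fundamental_cube_subset: "fundamental_cube \<subseteq> cbox 0 ((\<chi> i. 1, 1) :: grp)"
  by (auto simp: fundamental_cube_def cbox_def Basis_prod_def Basis_vec_def inner_axis less_imp_le)

text \<open>Compactness of the quotient: up to norm, every value is already taken on the closed
  cube.\<close>

lemma invariant_bounded:
  fixes f :: "grp \<Rightarrow> 'b::real_normed_vector"
  assumes c: "continuous_on UNIV f"
    and inv: "\<And>\<gamma> p. \<gamma> \<in> lattice \<Longrightarrow> norm (f (gmul r1 r2 \<gamma> p)) = norm (f p)"
  shows "\<exists>B\<ge>0. \<forall>p. norm (f p) \<le> B"
proof -
  have "compact (f ` cbox 0 ((\<chi> i. 1, 1) :: grp))"
    by (intro compact_continuous_image continuous_on_subset[OF c]) auto
  then obtain B where B: "\<And>p. p \<in> cbox 0 ((\<chi> i. 1, 1) :: grp) \<Longrightarrow> norm (f p) \<le> B"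
    using compact_imp_bounded bounded_iff by (metis imageI)
  have "norm (f p) \<le> B" for p
  proof -
    from fundamental_unique[of r1 r2 p] obtain \<gamma> where *: "\<gamma> \<in> lattice \<and> gmul r1 r2 \<gamma> p \<in> fundamental_cube"
      by (rule ex1E)
    then have "norm (f (gmul r1 r2 \<gamma> p)) \<le> B" using B fundamental_cube_subset by blast
    with inv[of \<gamma> p] * show ?thesis by linarith
  qed
  moreover have "B \<ge> 0" using calculation[of 0] norm_ge_zero order_trans by blast
  ultimately show ?thesis by blast
qed

lemma cube_integrable:
  fixes f :: "grp \<Rightarrow> real"
  assumes c: "continuous_on UNIV f"
  shows "set_integrable lborel fundamental_cube f"
proof (rule set_integrable_subset)
  show "set_integrable lborel (cbox 0 ((\<chi> i. 1, 1) :: grp)) f"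
    unfolding set_integrable_def
    by (rule borel_integrable_compact) (auto intro: continuous_on_subset[OF c])
qed (use fundamental_cube_subset in auto)

lemma cube_integral_nonneg:
  fixes f :: "grp \<Rightarrow> real"
  assumes c: "continuous_on UNIV f" and nn: "\<And>p. f p \<ge> 0"
  shows "(\<integral>\<^sup>+p\<in>fundamental_cube. ennreal (f p) \<partial>lborel) = ennreal (LINT p:fundamental_cube|lborel. f p)"
proof -
  have "(\<integral>\<^sup>+p\<in>fundamental_cube. ennreal (f p) \<partial>lborel)
      = (\<integral>\<^sup>+p. ennreal (indicator fundamental_cube p *\<^sub>R f p) \<partial>lborel)"
    by (intro nn_integral_cong) (auto simp: indicator_def)
  also have "\<dots> = ennreal (LINT p:fundamental_cube|lborel. f p)"
    unfolding set_lebesgue_integral_def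
    by (rule nn_integral_eq_integral) (use cube_integrable[OF c] nn in \<open>auto simp: set_integrable_def\<close>)
  finally show ?thesis .
qed

lemma l2_norm_sq_integral:
  fixes u :: "grp \<Rightarrow> 'b::real_normed_vector"
  assumes "continuous_on UNIV u"
  shows "l2_norm_sq u = ennreal (LINT p:fundamental_cube|lborel. (norm (u p))\<^sup>2)"
  unfolding l2_norm_sq_def
  by (rule cube_integral_nonneg) (auto intro!: continuous_intros assms)

text \<open>Reduced to the nonnegative case by adding an upper bound \<open>B\<close> of the
  invariant function.\<close>

lemma cube_integral_translate:
  fixes h :: "grp \<Rightarrow> real"
  assumes c: "continuous_on UNIV h" and inv: "\<And>\<gamma> p. \<gamma> \<in> lattice \<Longrightarrow> h (gmul r1 r2 \<gamma> p) = h p"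
  shows "(LINT p:fundamental_cube|lborel. h (gmul r1 r2 p g)) = (LINT p:fundamental_cube|lborel. h p)"
proof -
  obtain B where B: "\<And>p. norm (h p) \<le> B" using invariant_bounded[of h r1 r2, OF c] inv by metis
  have nn: "0 \<le> h p + B" for p using B[of p] by (simp add: abs_le_iff)
  have c': "continuous_on UNIV (\<lambda>p. h (gmul r1 r2 p g))"
    by (rule continuous_on_compose2[OF c]) (auto intro!: continuous_intros)
  have m: "(\<lambda>p. ennreal (h p + B)) \<in> borel_measurable borel"
    using borel_measurable_continuous_onI[OF c] by measurable
  have "(\<integral>\<^sup>+p\<in>fundamental_cube. ennreal (h (gmul r1 r2 p g) + B) \<partial>lborel)
      = (\<integral>\<^sup>+p\<in>fundamental_cube. ennreal (h p + B) \<partial>lborel)"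
    by (rule nn_integral_cube_translate[OF m, of r1 r2 g]) (simp only: inv)
  then have "ennreal (LINT p:fundamental_cube|lborel. h (gmul r1 r2 p g) + B)
      = ennreal (LINT p:fundamental_cube|lborel. h p + B)"
    by (subst (asm) (1 2) cube_integral_nonneg) (auto intro!: continuous_intros c c' nn)
  then have "(LINT p:fundamental_cube|lborel. h (gmul r1 r2 p g) + B) = (LINT p:fundamental_cube|lborel. h p + B)"
    by (subst (asm) ennreal_inj) (auto simp: set_lebesgue_integral_def intro!: Bochner_Integration.integral_nonneg mult_nonneg_nonneg nn)
  moreover have "(LINT p:fundamental_cube|lborel. f p + B)
      = (LINT p:fundamental_cube|lborel. f p) + (LINT p:fundamental_cube|lborel. B)" if "continuous_on UNIV f" for f
    by (rule set_integral_add) (auto intro!: cube_integrable that continuous_intros)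
  ultimately show ?thesis using c c' by simp
qed

section \<open>Integration by parts along the left-invariant fields\<close>

lemma gmul_frame_dir: "gmul r1 r2 p (t *\<^sub>R frame_dir i) = p + t *\<^sub>R frame (shear r1 r2) i p"
  by (simp add: gmul_def frame_shear prod_eq_iff matrix_vector_mult_scaleR)

lemma frame_along: "frame (shear r1 r2) i (p + t *\<^sub>R frame (shear r1 r2) i p) = frame (shear r1 r2) i p"
  using exhaust_3[of i] by (elim disjE) (simp_all add: frame_values)

text \<open>The flow of a left-invariant field is right translation by a one-parameter group. In
  these coordinates its orbits are straight lines along which the field is constant, so
  differentiation along the field is an ordinary one-variable derivative at every time.\<close>

lemma line_derivative:
  assumes f: "smooth f"
  shows "((\<lambda>t. f (p + t *\<^sub>R frame (shear r1 r2) i p)) has_vector_derivative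
     deriv_along (frame (shear r1 r2) i) f (p + t *\<^sub>R frame (shear r1 r2) i p)) (at t)"
proof -
  let ?V = "frame (shear r1 r2) i p" and ?q = "p + t *\<^sub>R frame (shear r1 r2) i p"
  have "((\<lambda>t. p + t *\<^sub>R ?V) has_vector_derivative ?V) (at t)"
    by (auto intro!: derivative_eq_intros)
  from vector_derivative_diff_chain_within[OF this, of f "frechet_derivative f (at ?q)"]
    has_derivative_at_withinI[OF smooth_has_derivative[OF f, of ?q]]
  show ?thesis by (simp add: o_def deriv_along_def frame_along)
qed

text \<open>Left translation by \<gamma> maps flow lines to flow lines, since the flow acts from the
  right.\<close>

lemma deriv_along_equivariant:
  assumes f: "smooth f" and L: "bounded_linear L" and eq: "\<And>q. f (gmul r1 r2 \<gamma> q) = L (f q)"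
  shows "deriv_along (frame (shear r1 r2) i) f (gmul r1 r2 \<gamma> p) = L (deriv_along (frame (shear r1 r2) i) f p)"
proof (rule vector_derivative_unique_at)
  let ?E = "frame (shear r1 r2) i"
  have "f (gmul r1 r2 \<gamma> p + t *\<^sub>R ?E (gmul r1 r2 \<gamma> p)) = L (f (p + t *\<^sub>R ?E p))" for t
    unfolding gmul_frame_dir[symmetric] gmul_assoc eq ..
  then show "((\<lambda>t. L (f (p + t *\<^sub>R ?E p))) has_vector_derivative deriv_along ?E f (gmul r1 r2 \<gamma> p)) (at 0)"
    using line_derivative[OF f, of "gmul r1 r2 \<gamma> p" r1 r2 i 0] by simp
  show "((\<lambda>t. L (f (p + t *\<^sub>R ?E p))) has_vector_derivative L (deriv_along ?E f p)) (at 0)"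
    using bounded_linear.has_vector_derivative[OF L line_derivative[OF f, of p r1 r2 i 0]] by simp
qed

text \<open>The divergence theorem on the closed quotient: difference quotients along the flow
  integrate to zero by right invariance, and dominated convergence passes to the derivative
  \<open>k\<close>.\<close>

lemma cube_integral_derivative:
  fixes h k :: "grp \<Rightarrow> real"
  assumes c: "continuous_on UNIV h" "continuous_on UNIV k"
    and inv: "\<And>\<gamma> p. \<gamma> \<in> lattice \<Longrightarrow> h (gmul r1 r2 \<gamma> p) = h p" "\<And>\<gamma> p. \<gamma> \<in> lattice \<Longrightarrow> k (gmul r1 r2 \<gamma> p) = k p"
    and d: "\<And>p t. ((\<lambda>t. h (p + t *\<^sub>R frame (shear r1 r2) i p)) has_vector_derivative
        k (p + t *\<^sub>R frame (shear r1 r2) i p)) (at t)"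
  shows "(LINT p:fundamental_cube|lborel. k p) = 0"
proof -
  let ?E = "frame (shear r1 r2) i"
  obtain B where B: "B \<ge> 0" "\<And>p. norm (k p) \<le> B" using invariant_bounded[of k r1 r2, OF c(2)] inv(2) by metis
  define q where "q n p = real (Suc n) * (h (p + (1 / real (Suc n)) *\<^sub>R ?E p) - h p)" for n p
  \<comment> \<open>By the mean value theorem each difference quotient is a value of
    \<open>k\<close> at a nearby point, which yields both the pointwise limit and the uniform bound
    \<open>B\<close>.\<close>
  have "\<exists>\<xi>. 0 < \<xi> \<and> \<xi> < 1 / real (Suc n) \<and> q n p = k (p + \<xi> *\<^sub>R ?E p)" for n p
  proof -
    have "\<exists>z>0. z < 1 / real (Suc n) \<and> h (p + (1 / real (Suc n)) *\<^sub>R ?E p) - h (p + 0 *\<^sub>R ?E p)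
        = (1 / real (Suc n) - 0) * k (p + z *\<^sub>R ?E p)"
      by (rule MVT2) (use d[of p] in \<open>auto simp: has_real_derivative_iff_has_vector_derivative\<close>)
    then show ?thesis by (auto simp: q_def field_simps simp del: of_nat_Suc)
  qed
  then obtain \<xi> where x: "\<And>n p. 0 < \<xi> n p" "\<And>n p. \<xi> n p < 1 / real (Suc n)" "\<And>n p. q n p = k (p + \<xi> n p *\<^sub>R ?E p)"
    by metis
  have E: "continuous_on UNIV (\<lambda>p. gmul r1 r2 p (s *\<^sub>R frame_dir i))" for s by (intro continuous_intros)
  have qc: "continuous_on UNIV (q n)" for n
    unfolding q_def gmul_frame_dir[symmetric]
    by (intro continuous_intros c continuous_on_compose2[OF c(1) E]) auto
  have q0: "(LINT p:fundamental_cube|lborel. q n p) = 0" for n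
  proof -
    have "(LINT p:fundamental_cube|lborel. q n p) = real (Suc n) * (LINT p:fundamental_cube|lborel.
       h (gmul r1 r2 p ((1 / real (Suc n)) *\<^sub>R frame_dir i)) - h p)"
      unfolding q_def gmul_frame_dir[symmetric] by (rule set_integral_mult_right)
    also have "(LINT p:fundamental_cube|lborel. h (gmul r1 r2 p ((1 / real (Suc n)) *\<^sub>R frame_dir i)) - h p) =
      (LINT p:fundamental_cube|lborel. h (gmul r1 r2 p ((1 / real (Suc n)) *\<^sub>R frame_dir i))) - (LINT p:fundamental_cube|lborel. h p)"
      by (rule set_integral_diff) (auto intro!: cube_integrable c continuous_on_compose2[OF c(1) E])
    also have "\<dots> = 0" using cube_integral_translate[OF c(1) inv(1)] by simp
    finally show ?thesis by simp
  qed
  have "(\<lambda>n. \<integral>p. indicator fundamental_cube p *\<^sub>R q n p \<partial>lborel) \<longlonglongrightarrow> (\<integral>p. indicator fundamental_cube p *\<^sub>R k p \<partial>lborel)"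
  proof (rule integral_dominated_convergence[where w="\<lambda>p. indicator fundamental_cube p *\<^sub>R B"])
    have [measurable]: "k \<in> borel_measurable borel" "q n \<in> borel_measurable borel" for n
      using c qc by (auto intro: borel_measurable_continuous_onI)
    show "(\<lambda>p. indicator fundamental_cube p *\<^sub>R k p) \<in> borel_measurable lborel"
      "(\<lambda>p. indicator fundamental_cube p *\<^sub>R q n p) \<in> borel_measurable lborel" for n by measurable
    show "integrable lborel (\<lambda>p. indicator fundamental_cube p *\<^sub>R B)"
      using cube_integrable[of "\<lambda>p. B"] by (simp add: set_integrable_def)
    show "AE p in lborel. (\<lambda>n. indicator fundamental_cube p *\<^sub>R q n p) \<longlonglongrightarrow> indicator fundamental_cube p *\<^sub>R k p"
    proof (rule AE_I2)
      fix p :: grp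
      have "(\<lambda>n. \<xi> n p) \<longlonglongrightarrow> 0"
        by (rule tendsto_sandwich[OF _ _ tendsto_const LIMSEQ_Suc[OF lim_1_over_n]])
           (auto intro!: always_eventually less_imp_le x simp del: of_nat_Suc)
      then have "(\<lambda>n. p + \<xi> n p *\<^sub>R ?E p) \<longlonglongrightarrow> p + 0 *\<^sub>R ?E p" by (intro tendsto_intros)
      then have "(\<lambda>n. p + \<xi> n p *\<^sub>R ?E p) \<longlonglongrightarrow> p" by simp
      from continuous_on_tendsto_compose[OF c(2) this]
      have "(\<lambda>n. q n p) \<longlonglongrightarrow> k p" by (simp add: x(3))
      then show "(\<lambda>n. indicator fundamental_cube p *\<^sub>R q n p) \<longlonglongrightarrow> indicator fundamental_cube p *\<^sub>R k p"
        by (intro tendsto_intros)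
    qed
    show "AE p in lborel. norm (indicator fundamental_cube p *\<^sub>R q n p) \<le> indicator fundamental_cube p *\<^sub>R B" for n
      by (rule AE_I2) (use B in \<open>auto simp: indicator_def x(3)\<close>)
  qed
  then show ?thesis using q0 by (simp add: set_lebesgue_integral_def LIMSEQ_const_iff)
qed

section \<open>The operator on smooth equivariant spinors and its symmetry\<close>

locale sub_dirac = subriemannian r1 r2 g nab + sign_structure r1 r2 \<epsilon> for r1 r2 g nab \<epsilon>
begin

abbreviation "SS \<equiv> smooth_spinors (shear r1 r2) \<epsilon>"
abbreviation "Dop \<equiv> dirac (shear r1 r2) g nab"

lemma SS_smooth: "\<psi> \<in> SS \<Longrightarrow> smooth \<psi>" by (simp add: smooth_spinors_def)
lemma SS_equivariant: "\<psi> \<in> SS \<Longrightarrow> spinor_equivariant \<psi>" by (simp add: smooth_spinors_def spinor_equivariant_iff)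
lemma SS_I: "smooth \<psi> \<Longrightarrow> spinor_equivariant \<psi> \<Longrightarrow> \<psi> \<in> SS" by (simp add: smooth_spinors_def spinor_equivariant_iff)

lemma bounded_linear_matrix: "bounded_linear (\<lambda>v. (M :: complex^2^2) *v v)"
proof (rule linear_conv_bounded_linear[THEN iffD1], rule linearI)
  show "M *v (x + y) = M *v x + M *v y" for x y by (rule matrix_vector_right_distrib)
  show "M *v (c *\<^sub>R x) = c *\<^sub>R (M *v x)" for c x
    by (simp add: vec_eq_iff forall_2 matrix_vector_mult_def sum_2 scaleR_right_distrib)
qed

lemma bounded_linear_smult: "bounded_linear (\<lambda>v. z *s (v :: complex^2))"
  by (rule linear_conv_bounded_linear[THEN iffD1], rule linearI) (simp_all add: vec_eq_iff algebra_simps)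

lemma continuous_dirac: "\<psi> \<in> SS \<Longrightarrow> continuous_on UNIV (Dop \<psi>)"
proof -
  assume p: "\<psi> \<in> SS"
  note c = bounded_linear.continuous_on[OF bounded_linear_matrix continuous_deriv_along_frame[OF SS_smooth[OF p]]]
  have "continuous_on UNIV (\<lambda>p. (\<Sum>i\<in>UNIV. clifford i *v deriv_along (E i) \<psi> p) + of_real al *s \<psi> p)"
    by (intro continuous_intros c smooth_continuous SS_smooth p)
  then show ?thesis by (simp add: dirac_eq[abs_def])
qed

lemma deriv_along_bounded_linear:
  assumes "smooth f" "bounded_linear L"
  shows "deriv_along X (\<lambda>p. L (f p)) p = L (deriv_along X f p)"
  unfolding deriv_along_def
  by (rule fun_cong[OF frechet_derivative_at[OF bounded_linear.has_derivative[OF assms(2) smooth_has_derivative[OF assms(1), of p]], symmetric]])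

lemma deriv_along_add:
  assumes "smooth f" "smooth h"
  shows "deriv_along X (\<lambda>p. f p + h p) p = deriv_along X f p + deriv_along X h p"
  unfolding deriv_along_def
  by (rule fun_cong[OF frechet_derivative_at[OF has_derivative_add[OF smooth_has_derivative[OF assms(1), of p] smooth_has_derivative[OF assms(2), of p]], symmetric]])

lemma SS_add_cmult: "\<psi> \<in> SS \<Longrightarrow> \<phi> \<in> SS \<Longrightarrow> (\<lambda>p. \<psi> p + z *s \<phi> p) \<in> SS"
proof (rule SS_I)
  assume p: "\<psi> \<in> SS" "\<phi> \<in> SS"
  show "smooth (\<lambda>p. \<psi> p + z *s \<phi> p)"
    by (intro smooth_add smooth_bounded_linear[OF bounded_linear_smult] SS_smooth p)
  show "spinor_equivariant (\<lambda>p. \<psi> p + z *s \<phi> p)"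
    unfolding spinor_equivariant_def
  proof (intro ballI allI)
    fix \<gamma> y assume "\<gamma> \<in> lattice"
    then have "\<psi> (\<gamma> \<odot> y) = sgc \<gamma> *s \<psi> y" "\<phi> (\<gamma> \<odot> y) = sgc \<gamma> *s \<phi> y"
      using SS_equivariant p unfolding spinor_equivariant_def by blast+
    then show "\<psi> (\<gamma> \<odot> y) + z *s \<phi> (\<gamma> \<odot> y) = sgc \<gamma> *s (\<psi> y + z *s \<phi> y)"
      by (simp add: vec_eq_iff algebra_simps)
  qed
qed

lemma dirac_add_cmult:
  assumes p: "\<psi> \<in> SS" "\<phi> \<in> SS"
  shows "Dop (\<lambda>p. \<psi> p + z *s \<phi> p) p = Dop \<psi> p + z *s Dop \<phi> p"
proof -
  have d: "deriv_along (E i) (\<lambda>p. \<psi> p + z *s \<phi> p) p = deriv_along (E i) \<psi> p + z *s deriv_along (E i) \<phi> p" for i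
    by (simp add: deriv_along_add deriv_along_bounded_linear SS_smooth p smooth_bounded_linear bounded_linear_smult)
  have m: "M *v (x + z *s y) = M *v x + z *s (M *v y)" for M :: "complex^2^2" and x y
    by (simp add: vec_eq_iff forall_2 matrix_vector_mult_def sum_2 algebra_simps)
  show ?thesis
    unfolding dirac_eq d m by (simp add: sum.distrib sum_3 vec_eq_iff algebra_simps)
qed

text \<open>The real part of the Hermitian pairing of \<open>clifford i *v u\<close> with
  \<open>\<i> *s w\<close>. It is symmetric because \<open>clifford i\<close> is skew-Hermitian, so
  the derivative of \<open>bform i \<psi> \<psi>\<close> along \<open>E i\<close> is twice the
  \<open>i\<close>-th cross term in the estimate below.\<close>

definition bform :: "3 \<Rightarrow> complex^2 \<Rightarrow> complex^2 \<Rightarrow> real" where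
  "bform i u w = inner (clifford i *v u) (\<i> *s w)"

lemma bform_sym: "bform i u w = bform i w u"
  using exhaust_3[of i]
  by (elim disjE) (simp_all add: bform_def clifford_values inner_vec_def sum_2 inner_complex_def algebra_simps)

text \<open>Expand the square of \<open>(S - a \<psi>) - b \<i> \<psi>\<close>. The cross term is a
  sum of derivatives of invariant functions and integrates to zero, leaving at least
  \<open>b^2\<close> times the squared norm of \<psi>.\<close>

lemma dirac_symmetric_bound:
  assumes p: "\<psi> \<in> SS" and z: "Im z \<noteq> 0"
  shows "l2_norm_sq \<psi> \<le> ennreal (1 / (Im z)\<^sup>2) * l2_norm_sq (\<lambda>p. Dop \<psi> p - z *s \<psi> p)"
proof -
  note s = SS_smooth[OF p]
  define S where "S p = (\<Sum>i\<in>UNIV. clifford i *v deriv_along (E i) \<psi> p)" for p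
  define a b where "a = Re z - al" and "b = Im z"
  define h k where "h i p = bform i (\<psi> p) (\<psi> p)" and "k i p = 2 * bform i (deriv_along (E i) \<psi> p) (\<psi> p)" for i p
  note c = bounded_linear.continuous_on[OF bounded_linear_matrix continuous_deriv_along_frame[OF s]]
    bounded_linear.continuous_on[OF bounded_linear_matrix smooth_continuous[OF s]] smooth_continuous[OF s]
  have hc: "continuous_on UNIV (h i)" "continuous_on UNIV (k i)" for i
    unfolding h_def k_def bform_def by (intro continuous_intros c)+
  have Sc: "continuous_on UNIV S" unfolding S_def by (intro continuous_intros c)
  have k0: "(LINT p:fundamental_cube|lborel. k i p) = 0" for i
  proof (rule cube_integral_derivative[of "h i" "k i" r1 r2 i])
    fix \<gamma> q assume g: "\<gamma> \<in> lattice"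
    have e: "\<psi> (\<gamma> \<odot> q) = sgc \<gamma> *s \<psi> q" for q
      using SS_equivariant[OF p] g unfolding spinor_equivariant_def by blast
    have b: "bform i (sgc \<gamma> *s u) (sgc \<gamma> *s w) = bform i u w" for u w
      using exhaust_3[of i] sgc_eq[OF g]
      by (elim disjE) (simp_all add: bform_def clifford_values inner_vec_def sum_2 inner_complex_def)
    show "h i (\<gamma> \<odot> q) = h i q" by (simp only: h_def e b)
    show "k i (\<gamma> \<odot> q) = k i q"
      by (simp only: k_def e b deriv_along_equivariant[OF s bounded_linear_smult e])
  next
    fix p t
    let ?q = "p + t *\<^sub>R E i p"
    note d = line_derivative[OF s, of p r1 r2 i t]
    have "((\<lambda>t. inner (clifford i *v \<psi> (p + t *\<^sub>R E i p)) (\<i> *s \<psi> (p + t *\<^sub>R E i p))) has_vector_derivative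
        inner (clifford i *v \<psi> ?q) (\<i> *s deriv_along (E i) \<psi> ?q) + inner (clifford i *v deriv_along (E i) \<psi> ?q) (\<i> *s \<psi> ?q)) (at t)"
      by (rule bounded_bilinear.has_vector_derivative[OF bounded_bilinear_inner
          bounded_linear.has_vector_derivative[OF bounded_linear_matrix d]
          bounded_linear.has_vector_derivative[OF bounded_linear_smult d]])
    then show "((\<lambda>t. h i (p + t *\<^sub>R E i p)) has_vector_derivative k i ?q) (at t)"
      using bform_sym[of i "\<psi> ?q" "deriv_along (E i) \<psi> ?q"] by (simp add: h_def k_def bform_def)
  qed (rule hc)+
  \<comment> \<open>The shift by the real number \<open>a\<close> does not enter the cross term,
    since \<psi> is orthogonal to \<open>\<i> *s \<psi>\<close> for the real inner product.\<close>
  have pw: "(norm (Dop \<psi> p - z *s \<psi> p))\<^sup>2 = (norm (S p - a *\<^sub>R \<psi> p))\<^sup>2 + b\<^sup>2 * (norm (\<psi> p))\<^sup>2 - b * (\<Sum>i\<in>UNIV. k i p)" for p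
  proof -
    have eq: "Dop \<psi> p - z *s \<psi> p = (S p - a *\<^sub>R \<psi> p) - b *\<^sub>R (\<i> *s \<psi> p)"
      by (simp add: dirac_eq S_def a_def b_def vec_eq_iff complex_eq_iff algebra_simps)
    have "inner (\<psi> p) (\<i> *s \<psi> p) = 0" by (simp add: inner_vec_def inner_complex_def sum_2)
    moreover have "2 * inner (S p) (\<i> *s \<psi> p) = (\<Sum>i\<in>UNIV. k i p)"
      by (simp add: S_def k_def bform_def inner_sum_left sum_distrib_left)
    moreover have "(norm (\<i> *s \<psi> p))\<^sup>2 = (norm (\<psi> p))\<^sup>2" by simp
    moreover have "(norm (x - b *\<^sub>R y))\<^sup>2 = (norm x)\<^sup>2 + b\<^sup>2 * (norm y)\<^sup>2 - 2 * b * inner x y" for x y :: "complex^2"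
      by (simp only: power2_norm_eq_inner inner_diff_left inner_diff_right inner_scaleR_left inner_scaleR_right inner_commute[of y x])
         (simp add: algebra_simps power2_eq_square)
    ultimately show ?thesis unfolding eq
      by (simp add: inner_diff_left)
  qed
  have "(LINT p:fundamental_cube|lborel. (norm (Dop \<psi> p - z *s \<psi> p))\<^sup>2) =
     (LINT p:fundamental_cube|lborel. (norm (S p - a *\<^sub>R \<psi> p))\<^sup>2) + b\<^sup>2 * (LINT p:fundamental_cube|lborel. (norm (\<psi> p))\<^sup>2)
     - b * (\<Sum>i\<in>UNIV. (LINT p:fundamental_cube|lborel. k i p))"
    unfolding pw sum_3
    by (simp add: set_integral_add set_integral_diff cube_integrable continuous_intros Sc c hc)
  also have "\<dots> \<ge> b\<^sup>2 * (LINT p:fundamental_cube|lborel. (norm (\<psi> p))\<^sup>2)"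
    by (simp add: k0) (simp add: set_lebesgue_integral_def)
  finally have le: "(LINT p:fundamental_cube|lborel. (norm (\<psi> p))\<^sup>2) \<le>
      1 / b\<^sup>2 * (LINT p:fundamental_cube|lborel. (norm (Dop \<psi> p - z *s \<psi> p))\<^sup>2)"
    using z by (simp add: b_def field_simps)
  have "continuous_on UNIV (\<lambda>p. Dop \<psi> p - z *s \<psi> p)"
    by (intro continuous_intros c continuous_dirac p)
  then show ?thesis using le
    by (simp add: l2_norm_sq_integral c ennreal_mult'[symmetric] b_def ennreal_leI)
qed

end

section \<open>Periodisation along the one-parameter group of \<open>b\<close>\<close>

lemma summable_inverse_square_int: "(\<lambda>n::int. 1 / (1 + (real_of_int n)\<^sup>2)) summable_on UNIV"
proof -
  have "summable (\<lambda>n::nat. 2 * inverse (real n ^ 2))"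
    by (intro summable_mult inverse_power_summable) simp
  moreover have "norm (1 / (1 + (real n)\<^sup>2)) \<le> 2 * inverse (real n ^ 2)" if "n \<ge> 1" for n
  proof -
    have "1 / (1 + (real n)\<^sup>2) \<le> 1 / (real n)\<^sup>2" using that by (intro frac_le) auto
    also have "\<dots> \<le> 2 / (real n)\<^sup>2" by (intro divide_right_mono) auto
    finally show ?thesis by (simp add: inverse_eq_divide)
  qed
  ultimately have "summable (\<lambda>n::nat. 1 / (1 + (real n)\<^sup>2))"
    by (rule summable_comparison_test'[of _ 1])
  then have nat: "(\<lambda>n::nat. 1 / (1 + (real n)\<^sup>2)) summable_on UNIV"
    by (subst summable_on_UNIV_nonneg_real_iff) auto
  have "(\<lambda>n::int. 1 / (1 + (real_of_int n)\<^sup>2)) summable_on range int"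
    using nat by (subst summable_on_reindex) (auto simp: o_def)
  moreover have "(\<lambda>n::int. 1 / (1 + (real_of_int n)\<^sup>2)) summable_on range (\<lambda>n. - int n)"
    using nat by (subst summable_on_reindex) (auto simp: o_def inj_on_def)
  ultimately have "(\<lambda>n::int. 1 / (1 + (real_of_int n)\<^sup>2)) summable_on (range int \<union> range (\<lambda>n. - int n))"
    by (rule summable_on_union)
  moreover have "range int \<union> range (\<lambda>n. - int n) = UNIV"
    by (auto simp: image_iff) (metis nat_int_comparison(1) int_cases2)
  ultimately show ?thesis by simp
qed

definition weight_sum :: real where
  "weight_sum = (\<Sum>\<^sub>\<infinity>n::int. 1 / (1 + (real_of_int n)\<^sup>2))"

lemma weight_sum_nonneg: "weight_sum \<ge> 0"
  unfolding weight_sum_def by (intro infsum_nonneg) auto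

lemma weight_shift_le: "1 / (1 + (s - n)\<^sup>2) \<le> (2 + 2 * s\<^sup>2) / (1 + n\<^sup>2)" for s n :: real
proof -
  have "n\<^sup>2 \<le> 2 * (s - n)\<^sup>2 + 2 * s\<^sup>2" using zero_le_power2[of "n - 2 * s"] by (simp add: power2_eq_square algebra_simps)
  then have "1 + n\<^sup>2 \<le> (2 + 2 * s\<^sup>2) * (1 + (s - n)\<^sup>2)"
    by (simp add: algebra_simps) (smt (verit) mult_nonneg_nonneg zero_le_power2)
  then show ?thesis by (simp add: field_simps add_pos_nonneg)
qed

text \<open>Only the fractional part \<open>t\<close> of \<open>s\<close> matters, and
  \<open>t\<^sup>2 \<le> 1\<close> bounds the recentring factor by 4, uniformly in
  \<open>s\<close>.\<close>

lemma weight_has_sum_le: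
  fixes s :: real
  shows "(\<lambda>n::int. 1 / (1 + (s - of_int n)\<^sup>2)) summable_on UNIV"
    and "(\<Sum>\<^sub>\<infinity>n::int. 1 / (1 + (s - of_int n)\<^sup>2)) \<le> 4 * weight_sum"
proof -
  define t where "t = s - of_int \<lfloor>s\<rfloor>"
  have t: "0 \<le> t" "t < 1" unfolding t_def by linarith+
  have t2: "t\<^sup>2 \<le> 1" using t by (simp add: power_le_one)
  have sum4: "(\<lambda>n::int. 4 * (1 / (1 + (real_of_int n)\<^sup>2))) summable_on UNIV"
    by (intro summable_on_cmult_right summable_inverse_square_int)
  have le: "1 / (1 + (t - of_int n)\<^sup>2) \<le> 4 * (1 / (1 + (real_of_int n)\<^sup>2))" for n :: int
  proof -
    have "1 / (1 + (t - of_int n)\<^sup>2) \<le> (2 + 2 * t\<^sup>2) / (1 + (real_of_int n)\<^sup>2)" by (rule weight_shift_le)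
    also have "\<dots> \<le> 4 / (1 + (real_of_int n)\<^sup>2)" using t2 by (intro divide_right_mono) auto
    finally show ?thesis by simp
  qed
  have st: "(\<lambda>n::int. 1 / (1 + (t - of_int n)\<^sup>2)) summable_on UNIV"
    by (rule summable_on_comparison_test[OF sum4]) (use le in auto)
  have bij: "bij_betw (\<lambda>n. n + \<lfloor>s\<rfloor>) UNIV UNIV"
    by (rule bij_betwI[of _ _ _ "\<lambda>n. n - \<lfloor>s\<rfloor>"]) auto
  have eq: "(\<lambda>n::int. 1 / (1 + (t - of_int n)\<^sup>2)) = (\<lambda>n::int. (\<lambda>n. 1 / (1 + (s - of_int n)\<^sup>2)) (n + \<lfloor>s\<rfloor>))"
    by (simp add: t_def algebra_simps)
  show "(\<lambda>n::int. 1 / (1 + (s - of_int n)\<^sup>2)) summable_on UNIV"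
    using st unfolding eq by (subst (asm) summable_on_reindex_bij_betw[OF bij])
  have "(\<Sum>\<^sub>\<infinity>n::int. 1 / (1 + (s - of_int n)\<^sup>2)) = (\<Sum>\<^sub>\<infinity>n::int. 1 / (1 + (t - of_int n)\<^sup>2))"
    unfolding eq by (rule infsum_reindex_bij_betw[OF bij, symmetric])
  also have "\<dots> \<le> (\<Sum>\<^sub>\<infinity>n::int. 4 * (1 / (1 + (real_of_int n)\<^sup>2)))"
    by (rule infsum_mono[OF st sum4]) (use le in auto)
  also have "\<dots> = 4 * weight_sum" unfolding weight_sum_def by (rule infsum_cmult_right') 
  finally show "(\<Sum>\<^sub>\<infinity>n::int. 1 / (1 + (s - of_int n)\<^sup>2)) \<le> 4 * weight_sum" .
qed

text \<open>Decay is imposed in the direction of \<open>b\<close> only, the direction of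
  periodisation; functions of the abelian variables stay merely bounded.\<close>

definition weighted :: "real \<Rightarrow> (grp \<Rightarrow> complex) \<Rightarrow> bool" where
  "weighted M h \<longleftrightarrow> (\<forall>p. norm (h p) \<le> M / (1 + (snd p)\<^sup>2))"

lemma weighted_nonneg: "weighted M h \<Longrightarrow> M \<ge> 0"
  unfolding weighted_def using norm_ge_zero order_trans by (metis div_by_1 power_zero_numeral add_0_right snd_zero)

lemma weighted_add: "weighted M h \<Longrightarrow> weighted N k \<Longrightarrow> weighted (M + N) (\<lambda>p. h p + k p)"
  unfolding weighted_def add_divide_distrib by (meson add_mono norm_triangle_le)

lemma weighted_cmult: "weighted M h \<Longrightarrow> weighted (norm c * M) (\<lambda>p. c * h p)"
  unfolding weighted_def by (simp add: norm_mult mult_left_mono flip: times_divide_eq_right)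

section \<open>The sign character and Poincare series over the powers of \<open>b\<close>\<close>

context sign_structure
begin

definition chi :: "int \<Rightarrow> complex" where
  "chi n = cis (pi * of_int (\<epsilon> (0, 1)) * of_int n)"

lemma norm_chi [simp]: "norm (chi n) = 1" by (simp add: chi_def)
lemma chi_add: "chi (m + n) = chi m * chi n" by (simp add: chi_def cis_mult algebra_simps)

definition bpow :: "int \<Rightarrow> grp \<Rightarrow> grp" where
  "bpow n p = (shear r1 r2 (of_int n) *v fst p, snd p + of_int n)"

lemma bpow_gmul: "bpow n p = (0, of_int n) \<odot> p" by (simp add: bpow_def gmul_def)

lemma b_in_lattice: "(0, of_int n) \<in> lattice" by (simp add: lattice_def)

lemma sgc_b: "sgc (0, of_int n) = chi n"
proof -
  have step: "sgc (0, of_int (n + m)) = sgc (0, of_int n) * sgc (0, of_int m)" for n m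
    using sgc_mult[OF b_in_lattice[of n] b_in_lattice[of m]] by (simp add: gmul_def)
  have one: "sgc (0, of_int 1) = chi 1" by (simp add: sgc_def chi_def cis_conv_exp mult_ac)
  have zero: "sgc (0, of_int 0) = chi 0"
    using step[of 0 0] by (simp add: chi_def)
  show ?thesis
  proof (induction n rule: int_induct[of _ 0])
    case base
    show ?case by (rule zero)
  next
    case (step1 i)
    then show ?case using step[of i 1] one by (simp only: chi_add)
  next
    case (step2 i)
    have "sgc (0, of_int i) = sgc (0, of_int (i - 1)) * chi 1" using step[of "i - 1" 1] one by simp
    moreover have "chi i = chi (i - 1) * chi 1" using chi_add[of "i - 1" 1] by simp
    moreover have "chi 1 \<noteq> 0" using norm_chi[of 1] by fastforce
    ultimately show ?case using step2 by simp
  qed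
qed

text \<open>The frequencies whose character of the abelian part restricts to the sign character on
  the integral vectors: integers or half-integers according to the sign of each generator.\<close>

definition admissible :: "real^4 \<Rightarrow> bool" where
  "admissible \<xi> \<longleftrightarrow> (\<forall>i. \<exists>k::int. \<xi> $ i = of_int k + of_int (\<epsilon> (axis i 1, 0)) / 2)"

lemma translation_lattice: "(\<forall>i. m $ i \<in> \<int>) \<Longrightarrow> (m, 0) \<in> lattice" by (simp add: lattice_def)

lemma sgc_translation_add:
  "\<forall>i. m $ i \<in> \<int> \<Longrightarrow> \<forall>i. m' $ i \<in> \<int> \<Longrightarrow> sgc (m + m', 0) = sgc (m, 0) * sgc (m', 0)"
  using sgc_mult[OF translation_lattice translation_lattice, of m m'] by (simp add: gmul_def shear_0)

lemma sgc_translation: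
  assumes a: "admissible \<xi>" and m: "\<forall>i. m $ i \<in> \<int>"
  shows "sgc (m, 0) = cis (2 * pi * inner \<xi> m)"
proof -
  have ax: "\<forall>i. (of_int k *\<^sub>R axis j 1 :: real^4) $ i \<in> \<int>" for j :: 4 and k :: int
    by (simp add: axis_def)
  have gen: "sgc (axis j 1, 0) = cis (2 * pi * \<xi> $ j)" for j
  proof -
    obtain k :: int where k: "\<xi> $ j = of_int k + of_int (\<epsilon> (axis j 1, 0)) / 2" using a unfolding admissible_def by blast
    have "cis (2 * pi * \<xi> $ j) = cis (2 * pi * of_int k) * cis (pi * of_int (\<epsilon> (axis j 1, 0)))"
      by (simp add: k cis_mult algebra_simps)
    also have "cis (2 * pi * of_int k) = 1" by (simp add: cis_multiple_2pi)
    finally show ?thesis by (simp add: sgc_def cis_conv_exp mult_ac)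
  qed
  have axis: "sgc (of_int k *\<^sub>R axis j 1, 0) = cis (2 * pi * (\<xi> $ j * of_int k))" for j and k :: int
  proof (induction k rule: int_induct[of _ 0])
    case base
    show ?case using sgc_translation_add[of 0 0] by simp
  next
    case (step1 i)
    have "sgc (of_int (i + 1) *\<^sub>R axis j 1, 0) = sgc (of_int i *\<^sub>R axis j 1, 0) * sgc (axis j 1, 0)"
      using sgc_translation_add[OF ax[of i j] ax[of 1 j]] by (simp add: scaleR_left_distrib)
    then show ?case using step1 gen[of j] by (simp add: cis_mult algebra_simps)
  next
    case (step2 i)
    have "sgc (of_int i *\<^sub>R axis j 1, 0) = sgc (of_int (i - 1) *\<^sub>R axis j 1, 0) * sgc (axis j 1, 0)"
      using sgc_translation_add[OF ax[of "i - 1" j] ax[of 1 j]] by (simp add: scaleR_left_diff_distrib)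
    then have "sgc (of_int (i - 1) *\<^sub>R axis j 1, 0) * cis (2 * pi * \<xi> $ j)
       = cis (2 * pi * (\<xi> $ j * of_int (i - 1))) * cis (2 * pi * \<xi> $ j)"
      using step2 gen[of j] by (simp add: cis_mult algebra_simps)
    then show ?case by simp
  qed
  have "\<forall>i. \<exists>k::int. m $ i = of_int k" using m by (auto elim: Ints_cases)
  then obtain k :: "4 \<Rightarrow> int" where k: "\<And>i. m $ i = of_int (k i)" by metis
  have m_eq: "m = (of_int (k 1) *\<^sub>R axis 1 1 + of_int (k 2) *\<^sub>R axis 2 1) + (of_int (k 3) *\<^sub>R axis 3 1 + of_int (k 4) *\<^sub>R axis 4 1)"
    by (simp add: vec_eq_iff forall_4 axis_def k)
  have ax2: "\<forall>i. (of_int a *\<^sub>R axis j 1 + of_int b *\<^sub>R axis l 1 :: real^4) $ i \<in> \<int>" for j l :: 4 and a b :: int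
    by (simp add: axis_def)
  have "sgc (m, 0) = cis (2 * pi * (\<xi> $ 1 * of_int (k 1))) * cis (2 * pi * (\<xi> $ 2 * of_int (k 2))) *
     (cis (2 * pi * (\<xi> $ 3 * of_int (k 3))) * cis (2 * pi * (\<xi> $ 4 * of_int (k 4))))"
    by (subst m_eq) (simp only: sgc_translation_add[OF ax2 ax2] sgc_translation_add[OF ax ax] axis)
  also have "\<dots> = cis (2 * pi * inner \<xi> m)"
    by (simp add: cis_mult inner_vec_def sum_4 k algebra_simps)
  finally show ?thesis .
qed

lemma shear_integral: "\<forall>i. m $ i \<in> \<int> \<Longrightarrow> \<forall>i. (shear r1 r2 (of_int n) *v m) $ i \<in> \<int>"
  by (simp add: forall_4 shear_nth)

text \<open>Shearing by an integer is conjugation by a power of \<open>b\<close>, and a homomorphism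
  to an abelian group does not see conjugation.\<close>

lemma sgc_shear:
  assumes m: "\<forall>i. m $ i \<in> \<int>"
  shows "sgc (shear r1 r2 (of_int n) *v m, 0) = sgc (m, 0)"
proof -
  have "(0, of_int n) \<odot> (m, 0) = (shear r1 r2 (of_int n) *v m, 0) \<odot> (0, of_int n)"
    by (simp add: gmul_def)
  then have "sgc (0, of_int n) * sgc (m, 0) = sgc (shear r1 r2 (of_int n) *v m, 0) * sgc (0, of_int n)"
    using sgc_mult[OF b_in_lattice[of n] translation_lattice[OF m]]
      sgc_mult[OF translation_lattice[OF shear_integral[OF m]] b_in_lattice[of n]] by metis
  then show ?thesis by (simp add: mult.commute)
qed

text \<open>A Poincare series over the cyclic group generated by \<open>b\<close>, twisted by the
  sign character. It completes equivariance under the integral translations to equivariance under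
  the whole lattice.\<close>

definition periodise :: "(grp \<Rightarrow> complex) \<Rightarrow> grp \<Rightarrow> complex" where
  "periodise h p = (\<Sum>\<^sub>\<infinity>n. chi n * h (bpow (- n) p))"

text \<open>The bound on the periodisation is independent of \<open>p\<close>, which is what turns a
  weighted approximation of \<open>h\<close> into a uniform one.\<close>

lemma periodise_summable:
  assumes h: "weighted M h"
  shows "(\<lambda>n. norm (chi n * h (bpow (- n) p))) summable_on UNIV"
    and "norm (periodise h p) \<le> 4 * weight_sum * M"
proof -
  have le: "norm (chi n * h (bpow (- n) p)) \<le> M * (1 / (1 + (snd p - of_int n)\<^sup>2))" for n
    using h[unfolded weighted_def, rule_format, of "bpow (- n) p"] by (simp add: norm_mult bpow_def)
  have s: "(\<lambda>n. M * (1 / (1 + (snd p - of_int n)\<^sup>2))) summable_on UNIV"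
    by (intro summable_on_cmult_right weight_has_sum_le)
  show a: "(\<lambda>n. norm (chi n * h (bpow (- n) p))) summable_on UNIV"
    by (rule summable_on_comparison_test[OF s]) (use le in auto)
  have "norm (periodise h p) \<le> (\<Sum>\<^sub>\<infinity>n. norm (chi n * h (bpow (- n) p)))"
    unfolding periodise_def by (rule norm_infsum_bound[OF a])
  also have "\<dots> \<le> (\<Sum>\<^sub>\<infinity>n. M * (1 / (1 + (snd p - of_int n)\<^sup>2)))"
    by (rule infsum_mono[OF a s]) (use le in auto)
  also have "\<dots> = M * (\<Sum>\<^sub>\<infinity>n. 1 / (1 + (snd p - of_int n)\<^sup>2))" by (rule infsum_cmult_right')
  also have "\<dots> \<le> M * (4 * weight_sum)"
    by (intro mult_left_mono weight_has_sum_le weighted_nonneg[OF h])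
  finally show "norm (periodise h p) \<le> 4 * weight_sum * M" by (simp add: mult_ac)
qed

lemma periodise_add:
  assumes "weighted M h" "weighted N k"
  shows "periodise (\<lambda>p. h p + k p) p = periodise h p + periodise k p"
  unfolding periodise_def distrib_left
  by (rule infsum_add; rule Infinite_Sum.abs_summable_summable[OF periodise_summable(1)]; rule assms)

lemma periodise_cmult: "periodise (\<lambda>p. c * h p) p = c * periodise h p"
  unfolding periodise_def infsum_cmult_right'[symmetric] by (simp add: mult_ac)

lemma bpow_lmul: "bpow (- n) ((m, of_int k) \<odot> p) = (shear r1 r2 (of_int (- n)) *v m, 0) \<odot> bpow (- (n - k)) p"
  by (simp add: bpow_def gmul_def shear_0 matrix_vector_right_distrib shear_add)

text \<open>Left multiplication by \<open>(m, k)\<close> shifts the summation index by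
  \<open>k\<close> and leaves, in each term, an integral translation by a sheared \<open>m\<close>,
  whose sign is that of \<open>m\<close>.\<close>

lemma periodise_equivariant:
  assumes h: "\<And>m p. \<forall>i. m $ i \<in> \<int> \<Longrightarrow> h ((m, 0) \<odot> p) = sgc (m, 0) * h p"
  shows "equivariant (shear r1 r2) \<epsilon> (periodise h)"
  unfolding equivariant_iff
proof (intro ballI allI)
  fix \<gamma> p assume g: "\<gamma> \<in> lattice"
  obtain m t where mt: "\<gamma> = (m, t)" by (cases \<gamma>)
  then have m: "\<forall>i. m $ i \<in> \<int>" and "t \<in> \<int>" using g by (auto simp: lattice_def)
  then obtain k :: int where k: "t = of_int k" by (auto elim: Ints_cases)
  have sg: "sgc \<gamma> = sgc (m, 0) * chi k"
    using sgc_mult[OF translation_lattice[OF m] b_in_lattice[of k]] by (simp add: gmul_def shear_0 mt k sgc_b)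
  have bij: "bij_betw (\<lambda>n. n + k) UNIV UNIV"
    by (rule bij_betwI[of _ _ _ "\<lambda>n. n - k"]) auto
  have "periodise h (\<gamma> \<odot> p) = (\<Sum>\<^sub>\<infinity>n. chi n * (sgc (m, 0) * h (bpow (- (n - k)) p)))"
    unfolding periodise_def mt k bpow_lmul h[OF shear_integral[OF m]] sgc_shear[OF m] ..
  also have "\<dots> = (\<Sum>\<^sub>\<infinity>n. chi (n + k) * (sgc (m, 0) * h (bpow (- n) p)))"
    by (subst infsum_reindex_bij_betw[OF bij, symmetric]) simp
  also have "\<dots> = (\<Sum>\<^sub>\<infinity>n. sgc \<gamma> * (chi n * h (bpow (- n) p)))"
    by (simp add: chi_add sg mult_ac)
  also have "\<dots> = sgc \<gamma> * periodise h p" unfolding periodise_def by (rule infsum_cmult_right')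
  finally show "periodise h (\<gamma> \<odot> p) = sgc \<gamma> * periodise h p" .
qed

end

section \<open>Theta functions\<close>

subsection \<open>Gaussian weights\<close>

lemma power_le_fact_exp: "y \<ge> 0 \<Longrightarrow> y ^ k \<le> fact k * exp (y::real)"
proof -
  assume y: "y \<ge> 0"
  have "(\<Sum>n\<in>{k}. y ^ n /\<^sub>R fact n) \<le> (\<Sum>n. y ^ n /\<^sub>R fact n)"
    by (rule sum_le_suminf[OF summable_exp_generic]) (use y in auto)
  then show ?thesis by (simp add: exp_def field_simps)
qed

text \<open>With \<open>y\<close> the absolute value of \<open>s + c\<close>, the power costs a
  factor \<open>fact k * exp y\<close> and the weight \<open>1 + y\<^sup>2\<close> a factor
  \<open>2 * exp y\<close>. Hence \<open>B + 2\<close> in the exponent before the square is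
  completed; the last factor of the bound recentres the weight.\<close>

lemma gaussian_weight:
  fixes a B c :: real
  assumes a: "a > 0"
  shows "\<exists>M\<ge>0. \<forall>s. \<bar>s + c\<bar> ^ k * exp (B * \<bar>s + c\<bar>) * exp (- a * (s + c)\<^sup>2) \<le> M / (1 + s\<^sup>2)"
proof (intro exI conjI allI)
  let ?K = "2 * fact k * exp ((B + 2)\<^sup>2 / (4 * a))"
  show "0 \<le> ?K * (2 + 2 * c\<^sup>2)" by simp
  fix s
  define y where "y = \<bar>s + c\<bar>"
  have y: "y \<ge> 0" by (simp add: y_def)
  have "1 + y\<^sup>2 \<le> 2 * exp y" using exp_lower_Taylor_quadratic[OF y] y by simp
  then have "(y ^ k * exp (B * y) * exp (- a * y\<^sup>2)) * (1 + y\<^sup>2) \<le>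
      ((fact k * exp y) * exp (B * y) * exp (- a * y\<^sup>2)) * (2 * exp y)"
    using y by (intro mult_mono power_le_fact_exp mult_nonneg_nonneg) auto
  also have "\<dots> = 2 * fact k * exp ((B + 2) * y - a * y\<^sup>2)"
    by (simp add: exp_add[symmetric] algebra_simps)
  also have "(B + 2) * y - a * y\<^sup>2 \<le> (B + 2)\<^sup>2 / (4 * a)"
  proof -
    have "0 \<le> a * (y - (B + 2) / (2 * a))\<^sup>2" using a by simp
    also have "\<dots> = a * y\<^sup>2 - (B + 2) * y + (B + 2)\<^sup>2 / (4 * a)"
      using a by (simp add: power2_eq_square field_simps)
    finally show ?thesis by simp
  qed
  finally have "(y ^ k * exp (B * y) * exp (- a * y\<^sup>2)) * (1 + y\<^sup>2) \<le> ?K" by simp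
  then have "y ^ k * exp (B * y) * exp (- a * y\<^sup>2) \<le> ?K * (1 / (1 + y\<^sup>2))"
    by (simp add: field_simps add_pos_nonneg)
  also have "1 / (1 + y\<^sup>2) \<le> (2 + 2 * c\<^sup>2) / (1 + s\<^sup>2)"
    using weight_shift_le[of c "- s"] by (simp add: y_def add.commute)
  finally show "\<bar>s + c\<bar> ^ k * exp (B * \<bar>s + c\<bar>) * exp (- a * (s + c)\<^sup>2) \<le> ?K * (2 + 2 * c\<^sup>2) / (1 + s\<^sup>2)"
    by (simp add: y_def mult_left_mono)
qed

subsection \<open>Smoothness of products\<close>

lemma Ck_Suc_imp: "Ck (Suc n) f \<Longrightarrow> Ck n f"
proof (induction n arbitrary: f)
  case 0
  then show ?case by (auto intro: differentiable_imp_continuous_on)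
next
  case (Suc n)
  then show ?case by (metis Ck.simps(2))
qed

lemma Ck_mult:
  fixes f h :: "'a::real_normed_vector \<Rightarrow> complex"
  shows "Ck n f \<Longrightarrow> Ck n h \<Longrightarrow> Ck n (\<lambda>p. f p * h p)"
proof (induction n arbitrary: f h)
  case (Suc n)
  have d: "f differentiable at p" "h differentiable at p" for p
    using Suc.prems by (auto simp: differentiable_on_def)
  have D: "((\<lambda>p. f p * h p) has_derivative
      (\<lambda>v. f p * frechet_derivative h (at p) v + frechet_derivative f (at p) v * h p)) (at p)" for p
    using has_derivative_mult[OF frechet_derivative_works[THEN iffD1, OF d(1)] frechet_derivative_works[THEN iffD1, OF d(2)]] .
  have eq: "frechet_derivative (\<lambda>p. f p * h p) (at p) v
      = f p * frechet_derivative h (at p) v + frechet_derivative f (at p) v * h p" for p v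
    by (rule fun_cong[OF frechet_derivative_at[OF D, symmetric]])
  have "Ck n (\<lambda>p. f p * frechet_derivative h (at p) v + frechet_derivative f (at p) v * h p)" for v
    by (intro Ck_add Suc.IH Ck_Suc_imp[OF Suc.prems(1)] Ck_Suc_imp[OF Suc.prems(2)])
       (use Suc.prems in auto)
  then show ?case
    using D by (auto simp: eq differentiable_on_def differentiable_def intro!: exI)
qed (auto intro: continuous_intros)

subsection \<open>The functions and their derivatives\<close>

context sign_structure
begin

definition "R1 \<xi> = of_int r1 * \<xi> $ (1::4)" for \<xi> :: "real^4"
definition "R2 \<xi> = of_int r2 * \<xi> $ (2::4)" for \<xi> :: "real^4"
definition "rho \<xi> = sqrt ((R1 \<xi>)\<^sup>2 + (R2 \<xi>)\<^sup>2)"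
text \<open>On a profile of frequency \<xi> at \<open>s\<close> the first two fields act through the
  vector \<open>(\<xi>$3, \<xi>$4) + s (R1, R2)\<close>. This line in the plane comes closest to the
  origin at \<open>s = - cc\<close>, and \<open>bb\<close> is its signed distance from the origin
  along the unit normal \<open>(R2, - R1) / rho\<close>.\<close>

definition "cc \<xi> = (R1 \<xi> * \<xi> $ 3 + R2 \<xi> * \<xi> $ 4) / (rho \<xi>)\<^sup>2"
definition "bb \<xi> = (R2 \<xi> * \<xi> $ 3 - R1 \<xi> * \<xi> $ 4) / rho \<xi>"
definition "kap \<xi> v = R1 \<xi> * v $ (3::4) + R2 \<xi> * v $ (4::4)" for \<xi> :: "real^4" and v :: "real^4"

definition profile :: "real^4 \<Rightarrow> (real \<Rightarrow> complex) \<Rightarrow> grp \<Rightarrow> complex" where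
  "profile \<xi> f p = exp (\<i> * of_real (2 * pi * inner \<xi> (fst p))) * f (snd p)"

text \<open>Plain monomials about the centre \<open>- cc\<close> replace Hermite polynomials, so
  that differentiation only moves \<open>k\<close> by one. The width \<open>pi * rho\<close> is the
  one that makes the case \<open>k = 0\<close> an oscillator ground state.\<close>

definition gaussp :: "real^4 \<Rightarrow> nat \<Rightarrow> real \<Rightarrow> complex" where
  "gaussp \<xi> k s = of_real (s + cc \<xi>) ^ k * exp (of_real (- pi * rho \<xi> * (s + cc \<xi>)\<^sup>2))"

definition th :: "real^4 \<Rightarrow> nat \<Rightarrow> grp \<Rightarrow> complex" where
  "th \<xi> k = periodise (profile \<xi> (gaussp \<xi> k))"

lemma norm_profile: "norm (profile \<xi> f p) = norm (f (snd p))"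
proof -
  have "norm (exp (\<i> * complex_of_real (2 * pi * inner \<xi> (fst p)))) = 1" by (rule norm_exp_i_times)
  then show ?thesis unfolding profile_def norm_mult by simp
qed

lemma weighted_profile: "weighted M (profile \<xi> f) \<longleftrightarrow> (\<forall>s. norm (f s) \<le> M / (1 + s\<^sup>2))"
  unfolding weighted_def norm_profile by auto

lemma profile_translate:
  assumes "admissible \<xi>" and m: "\<forall>i. m $ i \<in> \<int>"
  shows "profile \<xi> f ((m, 0) \<odot> p) = sgc (m, 0) * profile \<xi> f p"
  unfolding sgc_translation[OF assms]
  by (simp add: profile_def gmul_def shear_0 inner_add_right cis_conv_exp exp_add[symmetric] algebra_simps)

lemma profile_equivariant: "admissible \<xi> \<Longrightarrow> equivariant (shear r1 r2) \<epsilon> (periodise (profile \<xi> f))"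
  by (rule periodise_equivariant) (rule profile_translate)

lemma inner_shear: "inner \<xi> (shear r1 r2 t *v v) = inner \<xi> v + t * kap \<xi> v"
  by (simp add: shear_vec inner_add_right inner_axis kap_def R1_def R2_def algebra_simps)

lemma gaussp_weighted:
  assumes "rho \<xi> > 0"
  shows "\<exists>M\<ge>0. weighted M (profile \<xi> (gaussp \<xi> k))"
proof -
  obtain M where "M \<ge> 0" "\<And>s. \<bar>s + cc \<xi>\<bar> ^ k * exp (0 * \<bar>s + cc \<xi>\<bar>) * exp (- (pi * rho \<xi>) * (s + cc \<xi>)\<^sup>2) \<le> M / (1 + s\<^sup>2)"
    using gaussian_weight[of "pi * rho \<xi>" "cc \<xi>" k 0] assms by auto
  moreover have "norm (gaussp \<xi> k s) = \<bar>s + cc \<xi>\<bar> ^ k * exp (0 * \<bar>s + cc \<xi>\<bar>) * exp (- (pi * rho \<xi>) * (s + cc \<xi>)\<^sup>2)" for s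
    unfolding gaussp_def norm_mult norm_power norm_of_real norm_exp_eq_Re Re_complex_of_real by simp
  ultimately show ?thesis unfolding weighted_profile by auto
qed

lemma rho_nz: "rho \<xi> > 0 \<Longrightarrow> (rho \<xi>)\<^sup>2 = (R1 \<xi>)\<^sup>2 + (R2 \<xi>)\<^sup>2"
  by (simp add: rho_def)

lemma th_equivariant: "admissible \<xi> \<Longrightarrow> equivariant (shear r1 r2) \<epsilon> (th \<xi> k)"
  unfolding th_def by (rule profile_equivariant)

text \<open>Enumerating the integers by \<open>int_decode\<close> yields an ordinary series, the
  form used for termwise differentiation. On a slab of half-width \<open>R\<close> the recentring of
  the weight costs at most the factor \<open>2 + 2 * R\<^sup>2\<close>, which gives uniform
  convergence there.\<close>

lemma th_series:
  assumes rho: "rho \<xi> > 0" and R: "R \<ge> 0"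
  shows "uniform_limit {p. \<bar>snd p\<bar> < R}
    (\<lambda>N p. \<Sum>i<N. chi (int_decode i) * profile \<xi> (gaussp \<xi> k) (bpow (- int_decode i) p)) (th \<xi> k) sequentially"
    and "(\<lambda>i. chi (int_decode i) * profile \<xi> (gaussp \<xi> k) (bpow (- int_decode i) p)) sums th \<xi> k p"
proof -
  obtain M where M: "M \<ge> 0" "weighted M (profile \<xi> (gaussp \<xi> k))" using gaussp_weighted[OF rho] by blast
  let ?T = "\<lambda>i p. chi (int_decode i) * profile \<xi> (gaussp \<xi> k) (bpow (- int_decode i) p)"
  have bij: "bij_betw int_decode UNIV UNIV" by (rule bij_int_decode)
  have sums: "(\<lambda>i. ?T i p) sums th \<xi> k p" for p
  proof -
    have "(\<lambda>i. norm (?T i p)) summable_on UNIV"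
      using periodise_summable(1)[OF M(2), of p] summable_on_reindex_bij_betw[OF bij] by fastforce
    then have ns: "summable (\<lambda>i. norm (?T i p))" by (subst (asm) summable_on_UNIV_nonneg_real_iff) auto
    have s: "summable (\<lambda>i. ?T i p)" by (rule summable_norm_cancel[OF ns])
    have "((\<lambda>i. ?T i p) has_sum (\<Sum>i. ?T i p)) UNIV"
      by (rule norm_summable_imp_has_sum[OF ns summable_sums[OF s]])
    then have "(\<Sum>\<^sub>\<infinity>i. ?T i p) = (\<Sum>i. ?T i p)" by (simp add: infsumI)
    moreover have "th \<xi> k p = (\<Sum>\<^sub>\<infinity>i. ?T i p)"
      unfolding th_def periodise_def by (rule infsum_reindex_bij_betw[OF bij, symmetric])
    ultimately show ?thesis using s by (simp add: summable_sums)
  qed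
  then show "(\<lambda>i. ?T i p) sums th \<xi> k p" .
  have "uniform_limit {p. \<bar>snd p\<bar> < R} (\<lambda>N p. \<Sum>i<N. ?T i p) (\<lambda>p. \<Sum>i. ?T i p) sequentially"
  proof (rule Weierstrass_m_test)
    fix n and p :: grp assume p: "p \<in> {p. \<bar>snd p\<bar> < R}"
    have "norm (?T n p) \<le> M * (1 / (1 + (snd p - of_int (int_decode n))\<^sup>2))"
      using M(2)[unfolded weighted_def, rule_format, of "bpow (- int_decode n) p"] by (simp add: norm_mult bpow_def)
    also have "\<dots> \<le> M * ((2 + 2 * (snd p)\<^sup>2) / (1 + (of_int (int_decode n))\<^sup>2))"
      by (intro mult_left_mono weight_shift_le M)
    also have "\<dots> \<le> M * ((2 + 2 * R\<^sup>2) / (1 + (of_int (int_decode n))\<^sup>2))"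
    proof -
      have "(snd p)\<^sup>2 \<le> R\<^sup>2" using p R by (simp add: abs_le_square_iff[symmetric])
      then show ?thesis by (intro mult_left_mono divide_right_mono M) auto
    qed
    finally show "norm (?T n p) \<le> (M * (2 + 2 * R\<^sup>2)) * (1 / (1 + (of_int (int_decode n))\<^sup>2))" by simp
  next
    have "(\<lambda>n. 1 / (1 + (real_of_int (int_decode n))\<^sup>2)) summable_on UNIV"
      using summable_inverse_square_int summable_on_reindex_bij_betw[OF bij] by fastforce
    then have "summable (\<lambda>n. 1 / (1 + (real_of_int (int_decode n))\<^sup>2))"
      by (subst (asm) summable_on_UNIV_nonneg_real_iff) auto
    then show "summable (\<lambda>n. (M * (2 + 2 * R\<^sup>2)) * (1 / (1 + (real_of_int (int_decode n))\<^sup>2)))"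
      by (rule summable_mult)
  qed
  moreover have "(\<lambda>p. \<Sum>i. ?T i p) = th \<xi> k" using sums by (auto simp: sums_iff)
  ultimately show "uniform_limit {p. \<bar>snd p\<bar> < R} (\<lambda>N p. \<Sum>i<N. ?T i p) (th \<xi> k) sequentially" by simp
qed

text \<open>The summation index enters the derivative through the sheared frequency; writing it as
  \<open>snd p + cc\<close> minus the Gaussian variable moves it into \<open>gaussp\<close> with
  index \<open>Suc k\<close>. The coefficients become independent of \<open>n\<close> and can leave
  the sum. For \<open>k = 0\<close> the truncated index \<open>k - 1\<close> carries the coefficient
  0.\<close>

lemma th_term_derivative:
  "((\<lambda>p. chi n * profile \<xi> (gaussp \<xi> k) (bpow (- n) p)) has_derivative
    (\<lambda>h. of_real (real k * snd h) * (chi n * profile \<xi> (gaussp \<xi> (k - 1)) (bpow (- n) p))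
      + (of_real (- 2 * pi * rho \<xi> * snd h) + 2 * pi * \<i> * of_real (kap \<xi> (fst h))) * (chi n * profile \<xi> (gaussp \<xi> (Suc k)) (bpow (- n) p))
      + 2 * pi * \<i> * of_real (inner \<xi> (fst h) - (snd p + cc \<xi>) * kap \<xi> (fst h)) * (chi n * profile \<xi> (gaussp \<xi> k) (bpow (- n) p)))) (at p)"
proof -
  define y where "y p = snd p - of_int n + cc \<xi>" for p :: grp
  define Q where "Q p = complex_of_real (- pi * rho \<xi> * (y p)\<^sup>2) + \<i> * of_real (2 * pi * (inner \<xi> (fst p) - of_int n * kap \<xi> (fst p)))" for p
  have T: "chi n * profile \<xi> (gaussp \<xi> j) (bpow (- n) q) = chi n * (of_real (y q) ^ j * exp (Q q))" for j q
    by (simp only: profile_def gaussp_def bpow_def fst_conv snd_conv inner_shear y_def Q_def exp_add) (simp add: mult_ac)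
  have yd: "(y has_derivative snd) (at p)" unfolding y_def by (auto intro!: derivative_eq_intros)
  have kd: "((\<lambda>p. kap \<xi> (fst p)) has_derivative (\<lambda>h. kap \<xi> (fst h))) (at p)" for p :: grp
  proof -
    have "bounded_linear (\<lambda>p::grp. kap \<xi> (fst p))"
      unfolding kap_def by (intro bounded_linear_intros bounded_linear_compose[OF bounded_linear_vec_nth])
    then show ?thesis by (rule bounded_linear_imp_has_derivative)
  qed
  have Qd: "(Q has_derivative (\<lambda>h. of_real (- 2 * pi * rho \<xi> * y p * snd h)
      + \<i> * of_real (2 * pi * (inner \<xi> (fst h) - of_int n * kap \<xi> (fst h))))) (at p)"
    unfolding Q_def
    by (rule has_derivative_eq_rhs, (rule derivative_intros yd kd)+) (simp add: fun_eq_iff algebra_simps)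
  have "((\<lambda>q. exp (Q q)) has_derivative (\<lambda>h. exp (Q p) * (of_real (- 2 * pi * rho \<xi> * y p * snd h)
      + \<i> * of_real (2 * pi * (inner \<xi> (fst h) - of_int n * kap \<xi> (fst h)))))) (at p)"
    using has_derivative_compose[OF Qd, of exp "(*) (exp (Q p))"]
    by (simp add: has_field_derivative_imp_has_derivative[OF DERIV_exp])
  note ed = this
  have pd: "((\<lambda>q. complex_of_real (y q) ^ k) has_derivative (\<lambda>h. of_nat k * of_real (snd h) * of_real (y p) ^ (k - 1))) (at p)"
    by (rule has_derivative_power[OF has_derivative_of_real[OF yd]])
  have D: "((\<lambda>q. chi n * (of_real (y q) ^ k * exp (Q q))) has_derivative
     (\<lambda>h. chi n * (of_real (y p) ^ k * (exp (Q p) * (of_real (- 2 * pi * rho \<xi> * y p * snd h)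
      + \<i> * of_real (2 * pi * (inner \<xi> (fst h) - of_int n * kap \<xi> (fst h)))))
      + of_nat k * of_real (snd h) * of_real (y p) ^ (k - 1) * exp (Q p)))) (at p)"
    by (intro has_derivative_mult_right has_derivative_mult pd ed)
  have n: "complex_of_int n = of_real (snd p + cc \<xi>) - of_real (y p)" by (simp add: y_def)
  show ?thesis
    unfolding T by (rule has_derivative_eq_rhs[OF D]) (simp add: fun_eq_iff n algebra_simps)
qed

text \<open>The coefficient \<open>a3\<close> grows with \<open>snd p\<close> but is bounded on a
  slab around \<open>p\<close>, so uniform convergence of the three theta series there gives that of
  the derivatives relative to the norm of \<open>h\<close>. The constant \<open>C\<close> adds up
  the three coefficient bounds.\<close>

lemma th_has_derivative:
  assumes rho: "rho \<xi> > 0"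
  shows "(th \<xi> k has_derivative
    (\<lambda>h. of_real (real k * snd h) * th \<xi> (k - 1) p
      + (of_real (- 2 * pi * rho \<xi> * snd h) + 2 * pi * \<i> * of_real (kap \<xi> (fst h))) * th \<xi> (Suc k) p
      + 2 * pi * \<i> * of_real (inner \<xi> (fst h) - (snd p + cc \<xi>) * kap \<xi> (fst h)) * th \<xi> k p)) (at p)"
proof -
  define R where "R = \<bar>snd p\<bar> + 1"
  let ?S = "{p::grp. \<bar>snd p\<bar> < R}"
  let ?T = "\<lambda>k i p. chi (int_decode i) * profile \<xi> (gaussp \<xi> k) (bpow (- int_decode i) p)"
  define a1 a2 where "a1 h = complex_of_real (real k * snd h)"
    and "a2 h = complex_of_real (- 2 * pi * rho \<xi> * snd h) + 2 * pi * \<i> * of_real (kap \<xi> (fst h))" for h :: grp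
  define a3 where "a3 p h = 2 * pi * \<i> * complex_of_real (inner \<xi> (fst h) - (snd p + cc \<xi>) * kap \<xi> (fst h))" for p h :: grp
  define A where "A = \<bar>R1 \<xi>\<bar> + \<bar>R2 \<xi>\<bar>"
  define C where "C = real k + (2 * pi * rho \<xi> + 2 * pi * A) + 2 * pi * (norm \<xi> + (R + \<bar>cc \<xi>\<bar>) * A)"
  have R: "R > 0" by (simp add: R_def add_nonneg_pos)
  have A: "A \<ge> 0" by (simp add: A_def)
  have h1: "\<bar>snd h\<bar> \<le> norm h" "norm (fst h) \<le> norm h" for h :: grp
    using norm_snd_le[of "snd h" "fst h"] norm_fst_le[of "fst h" "snd h"] by simp_all
  have kb: "\<bar>kap \<xi> (fst h)\<bar> \<le> A * norm h" for h :: grp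
  proof -
    have "\<bar>kap \<xi> (fst h)\<bar> \<le> \<bar>R1 \<xi>\<bar> * \<bar>fst h $ 3\<bar> + \<bar>R2 \<xi>\<bar> * \<bar>fst h $ 4\<bar>"
      unfolding kap_def by (simp add: abs_mult[symmetric] abs_triangle_ineq)
    also have "\<dots> \<le> \<bar>R1 \<xi>\<bar> * norm h + \<bar>R2 \<xi>\<bar> * norm h"
      by (intro add_mono mult_left_mono order_trans[OF component_le_norm_cart h1(2)]) auto
    finally show ?thesis by (simp add: A_def algebra_simps)
  qed
  have b1: "norm (a1 h) \<le> real k * norm h" for h
    unfolding a1_def norm_of_real abs_mult using h1(1)[of h] by (simp add: mult_left_mono)
  have b2: "norm (a2 h) \<le> (2 * pi * rho \<xi> + 2 * pi * A) * norm h" for h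
  proof -
    have "norm (a2 h) \<le> \<bar>- 2 * pi * rho \<xi> * snd h\<bar> + 2 * pi * \<bar>kap \<xi> (fst h)\<bar>"
      unfolding a2_def by (rule norm_triangle_le) (simp add: norm_mult)
    also have "\<bar>- 2 * pi * rho \<xi> * snd h\<bar> \<le> 2 * pi * rho \<xi> * norm h"
      using h1(1)[of h] rho by (simp add: abs_mult)
    also have "2 * pi * \<bar>kap \<xi> (fst h)\<bar> \<le> 2 * pi * (A * norm h)" using kb[of h] by simp
    finally show ?thesis by (simp add: algebra_simps)
  qed
  have b3: "norm (a3 q h) \<le> 2 * pi * (norm \<xi> + (R + \<bar>cc \<xi>\<bar>) * A) * norm h" if "q \<in> ?S" for q h
  proof -
    have "\<bar>inner \<xi> (fst h) - (snd q + cc \<xi>) * kap \<xi> (fst h)\<bar> \<le> \<bar>inner \<xi> (fst h)\<bar> + \<bar>snd q + cc \<xi>\<bar> * \<bar>kap \<xi> (fst h)\<bar>"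
      by (metis abs_mult abs_triangle_ineq4)
    also have "\<bar>inner \<xi> (fst h)\<bar> \<le> norm \<xi> * norm h"
      using Cauchy_Schwarz_ineq2[of \<xi> "fst h"] h1(2)[of h] by (meson mult_left_mono norm_ge_zero order_trans)
    also have "\<bar>snd q + cc \<xi>\<bar> * \<bar>kap \<xi> (fst h)\<bar> \<le> (R + \<bar>cc \<xi>\<bar>) * (A * norm h)"
      by (intro mult_mono kb) (use that R in auto)
    finally have "\<bar>inner \<xi> (fst h) - (snd q + cc \<xi>) * kap \<xi> (fst h)\<bar> \<le> (norm \<xi> + (R + \<bar>cc \<xi>\<bar>) * A) * norm h"
      by (simp add: algebra_simps)
    moreover have "norm (2 * pi * \<i> * complex_of_real X) = 2 * pi * \<bar>X\<bar>" for X by (simp add: norm_mult)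
    ultimately show ?thesis unfolding a3_def by (simp add: mult.assoc del: of_real_diff of_real_mult of_real_add)
  qed
  have "\<exists>g. \<forall>x\<in>?S. (\<lambda>i. ?T k i x) sums (g x) \<and>
      (g has_derivative (\<lambda>h. a1 h * th \<xi> (k - 1) x + a2 h * th \<xi> (Suc k) x + a3 x h * th \<xi> k x)) (at x within ?S)"
  proof (rule has_derivative_series)
    have "?S = snd -` {-R<..<R}" by auto
    also have "convex \<dots>" by (intro convex_linear_vimage) (auto simp: linear_conv_bounded_linear bounded_linear_snd)
    finally show "convex ?S" .
    show "(?T k n has_derivative (\<lambda>h. a1 h * ?T (k - 1) n x + a2 h * ?T (Suc k) n x + a3 x h * ?T k n x)) (at x within ?S)" for n x
      unfolding a1_def a2_def a3_def by (rule has_derivative_at_withinI[OF th_term_derivative])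
    show "p \<in> ?S" by (simp add: R_def)
    show "(\<lambda>i. ?T k i p) sums th \<xi> k p" by (rule th_series(2)[OF rho less_imp_le[OF R]])
    fix e :: real assume e: "e > 0"
    define d where "d = e / (C + 1)"
    have C: "C \<ge> 0" unfolding C_def using rho A R by (intro add_nonneg_nonneg mult_nonneg_nonneg) auto
    have d: "d > 0" using e C by (simp add: d_def)
    have ul: "\<forall>\<^sub>F n in sequentially. \<forall>x\<in>?S. norm ((\<Sum>i<n. ?T j i x) - th \<xi> j x) < d" for j
      using th_series(1)[OF rho less_imp_le[OF R], of j] d unfolding uniform_limit_iff dist_norm by blast
    show "\<forall>\<^sub>F n in sequentially. \<forall>x\<in>?S. \<forall>h. norm ((\<Sum>i<n. a1 h * ?T (k - 1) i x + a2 h * ?T (Suc k) i x + a3 x h * ?T k i x)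
        - (a1 h * th \<xi> (k - 1) x + a2 h * th \<xi> (Suc k) x + a3 x h * th \<xi> k x)) \<le> e * norm h"
      using ul[of "k - 1"] ul[of "Suc k"] ul[of k]
    proof eventually_elim
      case (elim n)
      show ?case
      proof (intro ballI allI)
        fix x h assume x: "x \<in> ?S"
        let ?D = "\<lambda>j. (\<Sum>i<n. ?T j i x) - th \<xi> j x"
        have eq: "(\<Sum>i<n. a1 h * ?T (k - 1) i x + a2 h * ?T (Suc k) i x + a3 x h * ?T k i x)
          - (a1 h * th \<xi> (k - 1) x + a2 h * th \<xi> (Suc k) x + a3 x h * th \<xi> k x)
          = a1 h * ?D (k - 1) + a2 h * ?D (Suc k) + a3 x h * ?D k"
          by (simp add: sum.distrib sum_distrib_left algebra_simps)
        have "norm (a1 h * ?D (k - 1) + a2 h * ?D (Suc k) + a3 x h * ?D k)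
            \<le> norm (a1 h) * norm (?D (k - 1)) + norm (a2 h) * norm (?D (Suc k)) + norm (a3 x h) * norm (?D k)"
          by (intro norm_triangle_le add_mono) (simp_all add: norm_mult)
        also have "\<dots> \<le> real k * norm h * d + (2 * pi * rho \<xi> + 2 * pi * A) * norm h * d
            + 2 * pi * (norm \<xi> + (R + \<bar>cc \<xi>\<bar>) * A) * norm h * d"
        proof -
          have D1: "norm (?D (k - 1)) \<le> d" by (rule less_imp_le[OF bspec[OF elim(1) x]])
          have D2: "norm (?D (Suc k)) \<le> d" by (rule less_imp_le[OF bspec[OF elim(2) x]])
          have D3: "norm (?D k) \<le> d" by (rule less_imp_le[OF bspec[OF elim(3) x]])
          have nn: "0 \<le> real k * norm h" "0 \<le> (2 * pi * rho \<xi> + 2 * pi * A) * norm h"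
            "0 \<le> 2 * pi * (norm \<xi> + (R + \<bar>cc \<xi>\<bar>) * A) * norm h"
            using rho A R by (auto intro!: mult_nonneg_nonneg add_nonneg_nonneg)
          show ?thesis
            by (rule add_mono[OF add_mono[OF mult_mono[OF b1 D1 nn(1) norm_ge_zero] mult_mono[OF b2 D2 nn(2) norm_ge_zero]]
                mult_mono[OF b3[OF x] D3 nn(3) norm_ge_zero]])
        qed
        also have "\<dots> = C * d * norm h" by (simp add: C_def algebra_simps)
        also have "\<dots> \<le> e * norm h"
          using C e by (intro mult_right_mono) (auto simp: d_def field_simps)
        finally show "norm ((\<Sum>i<n. a1 h * ?T (k - 1) i x + a2 h * ?T (Suc k) i x + a3 x h * ?T k i x)
          - (a1 h * th \<xi> (k - 1) x + a2 h * th \<xi> (Suc k) x + a3 x h * th \<xi> k x)) \<le> e * norm h" unfolding eq .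
      qed
    qed
  qed
  then obtain g where g: "\<And>x. x \<in> ?S \<Longrightarrow> (\<lambda>i. ?T k i x) sums (g x)"
    "\<And>x. x \<in> ?S \<Longrightarrow> (g has_derivative (\<lambda>h. a1 h * th \<xi> (k - 1) x + a2 h * th \<xi> (Suc k) x + a3 x h * th \<xi> k x)) (at x within ?S)"
    by blast
  have op: "open ?S"
  proof -
    have "?S = snd -` {-R<..<R}" by auto
    then show ?thesis by (simp add: open_vimage_snd)
  qed
  have p: "p \<in> ?S" by (simp add: R_def)
  have eq: "g x = th \<xi> k x" if "x \<in> ?S" for x
    using g(1)[OF that] th_series(2)[OF rho less_imp_le[OF R], of k x] sums_unique2 by blast
  have "(g has_derivative (\<lambda>h. a1 h * th \<xi> (k - 1) p + a2 h * th \<xi> (Suc k) p + a3 p h * th \<xi> k p)) (at p)"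
    using g(2)[OF p] at_within_open[OF p op] by simp
  then have "(th \<xi> k has_derivative (\<lambda>h. a1 h * th \<xi> (k - 1) p + a2 h * th \<xi> (Suc k) p + a3 p h * th \<xi> k p)) (at p)"
    by (rule has_derivative_transform_within_open[OF _ op p]) (rule eq)
  then show ?thesis unfolding a1_def a2_def a3_def .
qed

lemma th_frechet:
  assumes rho: "rho \<xi> > 0"
  shows "frechet_derivative (th \<xi> k) (at p) h = of_real (real k * snd h) * th \<xi> (k - 1) p
      + (of_real (- 2 * pi * rho \<xi> * snd h) + 2 * pi * \<i> * of_real (kap \<xi> (fst h))) * th \<xi> (Suc k) p
      + 2 * pi * \<i> * of_real (inner \<xi> (fst h) - (snd p + cc \<xi>) * kap \<xi> (fst h)) * th \<xi> k p"
  by (rule fun_cong[OF frechet_derivative_at[OF th_has_derivative[OF rho], symmetric]])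

text \<open>The directional derivatives are again combinations of theta functions, with coefficients
  affine in the point, so the family is closed under differentiation.\<close>

lemma smooth_th:
  assumes rho: "rho \<xi> > 0"
  shows "smooth (th \<xi> k)"
proof -
  have d: "th \<xi> k differentiable_on UNIV" for k
    using th_has_derivative[OF rho, of k] by (auto simp: differentiable_on_def differentiable_def)
  have coef: "Ck n (\<lambda>p::grp. 2 * pi * \<i> * complex_of_real (a - (snd p + b) * c))" for n and a b c :: real
  proof -
    have "smooth (\<lambda>p::grp. 2 * pi * \<i> * complex_of_real (a - b * c) + (\<lambda>p. 2 * pi * \<i> * complex_of_real (snd p * - c)) p)"
      by (intro smooth_add smooth_const smooth_linear bounded_linear_intros bounded_linear_compose[OF bounded_linear_of_real])
    then show ?thesis by (simp add: smooth_def algebra_simps)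
  qed
  have "Ck n (th \<xi> k)" for n
  proof (induction n arbitrary: k)
    case 0
    show ?case using differentiable_imp_continuous_on[OF d] by simp
  next
    case (Suc n)
    then have "Ck n (\<lambda>p. frechet_derivative (th \<xi> k) (at p) h)" for h
      unfolding th_frechet[OF rho] by (intro Ck_add Ck_mult Ck_const coef)
    then show ?case using d by simp
  qed
  then show ?thesis by (simp add: smooth_def)
qed

text \<open>The variable coefficient of the frame cancels the term \<open>snd p\<close> in the
  derivative. What remains is the component along \<open>(R1, R2)\<close>, which raises
  \<open>k\<close>, and the constant normal component of length \<open>bb\<close>.\<close>

lemma deriv_along_th:
  assumes rho: "rho \<xi> > 0"
  shows "deriv_along (frame (shear r1 r2) 1) (th \<xi> k) p =
      2 * pi * \<i> * (of_real (R2 \<xi> * bb \<xi> / rho \<xi>) * th \<xi> k p + of_real (R1 \<xi>) * th \<xi> (Suc k) p)"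
    "deriv_along (frame (shear r1 r2) 2) (th \<xi> k) p =
      2 * pi * \<i> * (of_real (- R1 \<xi> * bb \<xi> / rho \<xi>) * th \<xi> k p + of_real (R2 \<xi>) * th \<xi> (Suc k) p)"
    "deriv_along (frame (shear r1 r2) 3) (th \<xi> k) p = of_nat k * th \<xi> (k - 1) p - 2 * pi * rho \<xi> * th \<xi> (Suc k) p"
proof -
  have k: "kap \<xi> (axis 3 1 + a *\<^sub>R axis 1 1) = R1 \<xi>" "kap \<xi> (axis 4 1 + a *\<^sub>R axis 2 1) = R2 \<xi>" "kap \<xi> 0 = 0" for a
    by (simp_all add: kap_def axis_def)
  have rr: "rho \<xi> * (rho \<xi> * x) = R1 \<xi> * (R1 \<xi> * x) + R2 \<xi> * (R2 \<xi> * x)" for x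
    using rho_nz[OF rho] by (metis distrib_right mult.assoc power2_eq_square)
  have "\<xi> $ 3 - cc \<xi> * R1 \<xi> = (\<xi> $ 3 * (rho \<xi>)\<^sup>2 - (R1 \<xi> * \<xi> $ 3 + R2 \<xi> * \<xi> $ 4) * R1 \<xi>) / (rho \<xi>)\<^sup>2"
    using rho by (simp add: cc_def field_simps)
  also have "\<dots> = R2 \<xi> * bb \<xi> / rho \<xi>"
    unfolding bb_def using rho by (simp add: rho_nz[OF rho] power2_eq_square divide_simps) (simp add: algebra_simps rr)
  finally have 3: "\<xi> $ 3 - cc \<xi> * R1 \<xi> = R2 \<xi> * bb \<xi> / rho \<xi>" .
  have "\<xi> $ 4 - cc \<xi> * R2 \<xi> = (\<xi> $ 4 * (rho \<xi>)\<^sup>2 - (R1 \<xi> * \<xi> $ 3 + R2 \<xi> * \<xi> $ 4) * R2 \<xi>) / (rho \<xi>)\<^sup>2"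
    using rho by (simp add: cc_def field_simps)
  also have "\<dots> = - R1 \<xi> * bb \<xi> / rho \<xi>"
    unfolding bb_def using rho by (simp add: rho_nz[OF rho] power2_eq_square divide_simps) (simp add: algebra_simps rr)
  finally have 4: "\<xi> $ 4 - cc \<xi> * R2 \<xi> = - R1 \<xi> * bb \<xi> / rho \<xi>" .
  have i3: "inner \<xi> (axis 3 1 + (of_int r1 * snd p) *\<^sub>R axis 1 1) - (snd p + cc \<xi>) * R1 \<xi> = R2 \<xi> * bb \<xi> / rho \<xi>"
    unfolding 3[symmetric] by (simp add: inner_add_right inner_axis R1_def algebra_simps)
  have i4: "inner \<xi> (axis 4 1 + (of_int r2 * snd p) *\<^sub>R axis 2 1) - (snd p + cc \<xi>) * R2 \<xi> = - R1 \<xi> * bb \<xi> / rho \<xi>"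
    unfolding 4[symmetric] by (simp add: inner_add_right inner_axis R2_def algebra_simps)
  show "deriv_along (frame (shear r1 r2) 1) (th \<xi> k) p =
      2 * pi * \<i> * (of_real (R2 \<xi> * bb \<xi> / rho \<xi>) * th \<xi> k p + of_real (R1 \<xi>) * th \<xi> (Suc k) p)"
    by (simp only: deriv_along_def frame_values th_frechet[OF rho] fst_conv snd_conv k i3) (simp add: algebra_simps)
  show "deriv_along (frame (shear r1 r2) 2) (th \<xi> k) p =
      2 * pi * \<i> * (of_real (- R1 \<xi> * bb \<xi> / rho \<xi>) * th \<xi> k p + of_real (R2 \<xi>) * th \<xi> (Suc k) p)"
    by (simp only: deriv_along_def frame_values th_frechet[OF rho] fst_conv snd_conv k i4) (simp add: algebra_simps)
  show "deriv_along (frame (shear r1 r2) 3) (th \<xi> k) p = of_nat k * th \<xi> (k - 1) p - 2 * pi * rho \<xi> * th \<xi> (Suc k) p"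
    by (simp only: deriv_along_def frame_values th_frechet[OF rho] fst_conv snd_conv k) simp
qed

end

section \<open>Eigenfunctions and the range of \<open>D - z\<close>\<close>

lemma divide_add1_mult_le: "x \<ge> 0 \<Longrightarrow> d \<ge> 0 \<Longrightarrow> d / (x + 1) * x \<le> (d::real)"
  using mult_left_mono[of "x / (x + 1)" 1 d] by simp

context sub_dirac
begin

definition tensor :: "(grp \<Rightarrow> complex) \<Rightarrow> complex^2 \<Rightarrow> spinor" where
  "tensor \<phi> v p = \<phi> p *s v"

lemma bounded_linear_smult_left: "bounded_linear (\<lambda>z. z *s (v :: complex^2))"
  by (rule linear_conv_bounded_linear[THEN iffD1], rule linearI) (simp_all add: vec_eq_iff algebra_simps)

lemma tensor_SS:
  assumes "smooth \<phi>" "equivariant (shear r1 r2) \<epsilon> \<phi>"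
  shows "tensor \<phi> v \<in> SS"
proof (rule SS_I)
  show "smooth (tensor \<phi> v)"
    unfolding tensor_def[abs_def] by (rule smooth_bounded_linear[OF bounded_linear_smult_left assms(1)])
  show "spinor_equivariant (tensor \<phi> v)"
    using assms(2) unfolding spinor_equivariant_def equivariant_iff tensor_def by (simp add: vec_eq_iff)
qed

lemma dirac_tensor:
  assumes "smooth \<phi>"
  shows "Dop (tensor \<phi> v) p = (\<Sum>i\<in>UNIV. deriv_along (E i) \<phi> p *s (clifford i *v v)) + of_real al *s tensor \<phi> v p"
proof -
  have "deriv_along (E i) (tensor \<phi> v) p = deriv_along (E i) \<phi> p *s v" for i
    unfolding tensor_def[abs_def] by (rule deriv_along_bounded_linear[OF assms bounded_linear_smult_left])
  moreover have "M *v (z *s v) = z *s (M *v v)" for M :: "complex^2^2" and z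
    by (simp add: vec_eq_iff forall_2 matrix_vector_mult_def sum_2 algebra_simps)
  ultimately show ?thesis by (simp add: dirac_eq)
qed

lemma tensor_th_SS: "admissible \<xi> \<Longrightarrow> rho \<xi> > 0 \<Longrightarrow> tensor (th \<xi> k) v \<in> SS"
  by (intro tensor_SS smooth_th th_equivariant)

text \<open>A unit complex number encoding the direction of \<open>(R1, R2)\<close>. The vectors
  \<open>ev\<close> and \<open>fv\<close> below are the eigenvectors, for 1 and -1, of \<i> times
  Clifford multiplication by the unit normal \<open>(R2, - R1) / rho\<close>, and \<open>fv\<close>
  is \<open>clifford 3\<close> applied to \<open>ev\<close>.\<close>

definition uu :: "real^4 \<Rightarrow> complex" where "uu \<xi> = (of_real (- R2 \<xi>) + \<i> * of_real (R1 \<xi>)) / of_real (rho \<xi>)"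
definition ev :: "real^4 \<Rightarrow> complex^2" where "ev \<xi> = vector [uu \<xi>, 1]"
definition fv :: "real^4 \<Rightarrow> complex^2" where "fv \<xi> = vector [\<i> * uu \<xi>, - \<i>]"

lemma uu_cnj: "rho \<xi> > 0 \<Longrightarrow> uu \<xi> * cnj (uu \<xi>) = 1"
proof -
  assume r: "rho \<xi> > 0"
  have "uu \<xi> * cnj (uu \<xi>) = of_real (((R1 \<xi>)\<^sup>2 + (R2 \<xi>)\<^sup>2) / (rho \<xi>)\<^sup>2)"
    unfolding uu_def by (simp add: field_simps power2_eq_square)
  also have "\<dots> = 1" using r by (simp flip: rho_nz)
  finally show ?thesis .
qed

text \<open>The normal component contributes \<open>2 * pi * bb\<close> with opposite signs on
  \<open>ev\<close> and \<open>fv\<close>. On \<open>ev\<close> the derivative of the Gaussian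
  cancels the multiplication by the component along \<open>(R1, R2)\<close>; on \<open>fv\<close>
  the two add up to \<open>4 * pi * rho\<close>. Thus \<open>k = 0\<close> on \<open>ev\<close> is
  an eigenfunction.\<close>

lemma dirac_th:
  assumes r: "rho \<xi> > 0"
  shows "Dop (tensor (th \<xi> k) (ev \<xi>)) p =
      of_real (al + 2 * pi * bb \<xi>) *s tensor (th \<xi> k) (ev \<xi>) p + of_nat k *s tensor (th \<xi> (k - 1)) (fv \<xi>) p"
    and "Dop (tensor (th \<xi> k) (fv \<xi>)) p =
      of_real (al - 2 * pi * bb \<xi>) *s tensor (th \<xi> k) (fv \<xi>) p
      + of_real (4 * pi * rho \<xi>) *s tensor (th \<xi> (Suc k)) (ev \<xi>) p - of_nat k *s tensor (th \<xi> (k - 1)) (ev \<xi>) p"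
proof -
  let ?u = "uu \<xi>" and ?w = "cnj (uu \<xi>)"
  have R2: "complex_of_real (R2 \<xi>) = - of_real (rho \<xi>) * (?u + ?w) / 2"
    and R1: "complex_of_real (R1 \<xi>) = - \<i> * of_real (rho \<xi>) * (?u - ?w) / 2"
    using r by (simp_all add: uu_def field_simps)
  have "complex_of_real (R2 \<xi> * bb \<xi> / rho \<xi>) = of_real (R2 \<xi>) * of_real (bb \<xi>) / of_real (rho \<xi>)" by simp
  also have "\<dots> = - of_real (bb \<xi>) * (?u + ?w) / 2" unfolding R2 using r by simp
  finally have q2: "complex_of_real (R2 \<xi> * bb \<xi> / rho \<xi>) = - of_real (bb \<xi>) * (?u + ?w) / 2" .
  have "complex_of_real (- R1 \<xi> * bb \<xi> / rho \<xi>) = - of_real (R1 \<xi>) * of_real (bb \<xi>) / of_real (rho \<xi>)" by simp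
  also have "\<dots> = \<i> * of_real (bb \<xi>) * (?u - ?w) / 2" unfolding R1 using r by simp
  finally have q1: "complex_of_real (- R1 \<xi> * bb \<xi> / rho \<xi>) = \<i> * of_real (bb \<xi>) * (?u - ?w) / 2" .
  have uw: "?u * ?w = 1" "?w * ?u = 1" using uu_cnj[OF r] by (simp_all add: mult.commute)
  have uw': "?u * (?w * x) = x" "?w * (?u * x) = x" for x using uw by (simp_all flip: mult.assoc)
  show "Dop (tensor (th \<xi> k) (ev \<xi>)) p =
      of_real (al + 2 * pi * bb \<xi>) *s tensor (th \<xi> k) (ev \<xi>) p + of_nat k *s tensor (th \<xi> (k - 1)) (fv \<xi>) p"
    unfolding dirac_tensor[OF smooth_th[OF r]] sum_3 deriv_along_th[OF r] q1 q2 R1 R2 tensor_def ev_def fv_def clifford_values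
    by (simp add: vec_eq_iff forall_2 field_simps uw uw')
  show "Dop (tensor (th \<xi> k) (fv \<xi>)) p =
      of_real (al - 2 * pi * bb \<xi>) *s tensor (th \<xi> k) (fv \<xi>) p
      + of_real (4 * pi * rho \<xi>) *s tensor (th \<xi> (Suc k)) (ev \<xi>) p - of_nat k *s tensor (th \<xi> (k - 1)) (ev \<xi>) p"
    unfolding dirac_tensor[OF smooth_th[OF r]] sum_3 deriv_along_th[OF r] q1 q2 R1 R2 tensor_def ev_def fv_def clifford_values
    by (simp add: vec_eq_iff forall_2 field_simps uw uw')
qed

subsection \<open>The range of \<open>D - z\<close> and its uniform closure\<close>

definition Wop :: "complex \<Rightarrow> spinor \<Rightarrow> spinor" where "Wop z \<psi> p = Dop \<psi> p - z *s \<psi> p"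

lemma Wop_add_cmult: "\<psi> \<in> SS \<Longrightarrow> \<phi> \<in> SS \<Longrightarrow> Wop z (\<lambda>p. \<psi> p + c *s \<phi> p) p = Wop z \<psi> p + c *s Wop z \<phi> p"
  by (simp add: Wop_def dirac_add_cmult vec_eq_iff algebra_simps)

lemma zero_SS: "(\<lambda>p. 0) \<in> SS"
  by (rule SS_I) (simp_all add: smooth_const spinor_equivariant_def)

text \<open>The closure of the range of \<open>D - z\<close> in the sup norm, taken over all of the
  group: closeness in this sense implies \<open>L2\<close> closeness and needs no measurability
  bookkeeping.\<close>

definition approx_range :: "complex \<Rightarrow> spinor set" where
  "approx_range z = {w. \<forall>\<delta>>0. \<exists>\<psi>\<in>SS. \<forall>p. norm (Wop z \<psi> p - w p) \<le> \<delta>}"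

lemma approx_range_Wop: "\<psi> \<in> SS \<Longrightarrow> (\<And>p. w p = Wop z \<psi> p) \<Longrightarrow> w \<in> approx_range z"
  unfolding approx_range_def by (auto intro!: bexI[of _ \<psi>])

lemma approx_rangeE:
  assumes "w \<in> approx_range z" "\<delta> > 0"
  obtains \<psi> where "\<psi> \<in> SS" "\<And>p. norm (Wop z \<psi> p - w p) \<le> \<delta>"
  using assms unfolding approx_range_def by blast

lemma approx_range_add_cmult:
  assumes u: "u \<in> approx_range z" and w: "w \<in> approx_range z"
  shows "(\<lambda>p. u p + c *s w p) \<in> approx_range z"
  unfolding approx_range_def
proof (intro CollectI allI impI)
  fix \<delta> :: real assume d: "\<delta> > 0"
  obtain \<psi> where 1: "\<psi> \<in> SS" "\<And>p. norm (Wop z \<psi> p - u p) \<le> \<delta> / 2"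
    using approx_rangeE[OF u, of "\<delta> / 2"] d by auto
  have "\<delta> / (2 * (norm c + 1)) > 0" using d by (intro divide_pos_pos) (auto intro: add_nonneg_pos)
  then obtain \<phi> where 2: "\<phi> \<in> SS" "\<And>p. norm (Wop z \<phi> p - w p) \<le> \<delta> / (2 * (norm c + 1))"
    using approx_rangeE[OF w] by blast
  have "norm (Wop z (\<lambda>p. \<psi> p + c *s \<phi> p) p - (u p + c *s w p)) \<le> \<delta>" for p
  proof -
    have eq: "Wop z (\<lambda>p. \<psi> p + c *s \<phi> p) p - (u p + c *s w p) = (Wop z \<psi> p - u p) + c *s (Wop z \<phi> p - w p)"
      unfolding Wop_add_cmult[OF 1(1) 2(1)] by (simp add: vec_eq_iff algebra_simps)
    have "norm (Wop z (\<lambda>p. \<psi> p + c *s \<phi> p) p - (u p + c *s w p)) \<le> norm (Wop z \<psi> p - u p) + norm c * norm (Wop z \<phi> p - w p)"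
      unfolding eq norm_vector_smult[symmetric] by (rule norm_triangle_ineq)
    also have "\<dots> \<le> \<delta> / 2 + norm c * (\<delta> / (2 * (norm c + 1)))"
      by (intro add_mono mult_left_mono 1 2) simp
    also have "norm c * (\<delta> / (2 * (norm c + 1))) \<le> \<delta> / 2"
      using divide_add1_mult_le[of "norm c" "\<delta> / 2"] d by (simp add: mult.commute)
    finally show ?thesis by simp
  qed
  then show "\<exists>\<psi>\<in>SS. \<forall>p. norm (Wop z \<psi> p - (u p + c *s w p)) \<le> \<delta>"
    using SS_add_cmult[OF 1(1) 2(1)] by blast
qed

lemma approx_range_closed:
  assumes "\<And>\<delta>. \<delta> > 0 \<Longrightarrow> \<exists>u\<in>approx_range z. \<forall>p. norm (u p - w p) \<le> \<delta>"
  shows "w \<in> approx_range z"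
  unfolding approx_range_def
proof (intro CollectI allI impI)
  fix \<delta> :: real assume d: "\<delta> > 0"
  obtain u where u: "u \<in> approx_range z" "\<And>p. norm (u p - w p) \<le> \<delta> / 2" using assms[OF half_gt_zero[OF d]] by blast
  then obtain \<psi> where p: "\<psi> \<in> SS" "\<And>p. norm (Wop z \<psi> p - u p) \<le> \<delta> / 2"
    using approx_rangeE[of u z "\<delta> / 2"] d by auto
  have "norm (Wop z \<psi> p - w p) \<le> \<delta>" for p
    using norm_triangle_ineq[of "Wop z \<psi> p - u p" "u p - w p"] u(2)[of p] p(2)[of p] by simp
  then show "\<exists>\<psi>\<in>SS. \<forall>p. norm (Wop z \<psi> p - w p) \<le> \<delta>" using p(1) by blast
qed

lemma zero_approx_range: "(\<lambda>p. 0) \<in> approx_range z"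
proof -
  have "Dop (\<lambda>p. 0) p = 0" for p
    using dirac_add_cmult[OF zero_SS zero_SS, of 1 p] by simp
  then show ?thesis by (intro approx_range_Wop[OF zero_SS]) (simp add: Wop_def)
qed

text \<open>Quantifying over the constant spinor \<open>v\<close> reduces density of the range to a
  question about scalar functions.\<close>

definition good :: "complex \<Rightarrow> (grp \<Rightarrow> complex) \<Rightarrow> bool" where
  "good z \<phi> \<longleftrightarrow> (\<forall>v. tensor \<phi> v \<in> approx_range z)"

lemma good_add_cmult: "good z \<phi> \<Longrightarrow> good z \<psi> \<Longrightarrow> good z (\<lambda>p. \<phi> p + c * \<psi> p)"
  unfolding good_def
proof (intro allI)
  fix v assume "\<forall>v. tensor \<phi> v \<in> approx_range z" "\<forall>v. tensor \<psi> v \<in> approx_range z"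
  then have "(\<lambda>p. tensor \<phi> v p + c *s tensor \<psi> v p) \<in> approx_range z"
    by (intro approx_range_add_cmult) auto
  moreover have "(\<lambda>p. tensor \<phi> v p + c *s tensor \<psi> v p) = tensor (\<lambda>p. \<phi> p + c * \<psi> p) v"
    by (simp add: tensor_def fun_eq_iff vec_eq_iff algebra_simps)
  ultimately show "tensor (\<lambda>p. \<phi> p + c * \<psi> p) v \<in> approx_range z" by simp
qed

lemma good_zero: "good z (\<lambda>p. 0)"
  using zero_approx_range by (simp add: good_def tensor_def[abs_def])

lemma good_cmult: "good z \<psi> \<Longrightarrow> good z (\<lambda>p. c * \<psi> p)"
  using good_add_cmult[OF good_zero, of z \<psi> c] by simp

lemma good_sum: "finite I \<Longrightarrow> (\<And>i. i \<in> I \<Longrightarrow> good z (\<phi> i)) \<Longrightarrow> good z (\<lambda>p. \<Sum>i\<in>I. c i * \<phi> i p)"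
proof (induction I rule: finite_induct)
  case (insert i I)
  then have "good z (\<lambda>p. (\<Sum>i\<in>I. c i * \<phi> i p) + c i * \<phi> i p)" by (intro good_add_cmult) auto
  then show ?case using insert by (simp add: add.commute)
qed (simp add: good_zero)

lemma good_closed:
  assumes "\<And>\<delta>. \<delta> > 0 \<Longrightarrow> \<exists>\<psi>. good z \<psi> \<and> (\<forall>p. norm (\<psi> p - \<phi> p) \<le> \<delta>)"
  shows "good z \<phi>"
  unfolding good_def
proof (intro allI approx_range_closed)
  fix v :: "complex^2" and \<delta> :: real assume d: "\<delta> > 0"
  then have "\<delta> / (norm v + 1) > 0" by (intro divide_pos_pos) (auto intro: add_nonneg_pos)
  then obtain \<psi> where p: "good z \<psi>" "\<And>p. norm (\<psi> p - \<phi> p) \<le> \<delta> / (norm v + 1)" using assms by blast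
  have "norm (tensor \<psi> v p - tensor \<phi> v p) \<le> \<delta>" for p
  proof -
    have "tensor \<psi> v p - tensor \<phi> v p = (\<psi> p - \<phi> p) *s v" by (simp add: tensor_def vec_eq_iff algebra_simps)
    then have "norm (tensor \<psi> v p - tensor \<phi> v p) \<le> \<delta> / (norm v + 1) * norm v"
      using p(2)[of p] by (simp only: norm_vector_smult) (rule mult_right_mono, simp_all)
    also have "\<dots> \<le> \<delta>" using d by (intro divide_add1_mult_le) auto
    finally show ?thesis .
  qed
  then show "\<exists>u\<in>approx_range z. \<forall>p. norm (u p - tensor \<phi> v p) \<le> \<delta>"
    using p(1) unfolding good_def by blast
qed

text \<open>A number whose square is real and nonnegative is itself real. The diagonal entries of
  the shifted square of \<open>D\<close> are of the form \<open>r - \<zeta>\<^sup>2\<close>, so they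
  can be divided by.\<close>

lemma real_minus_square_nonzero:
  assumes "Im \<zeta> \<noteq> 0" "r \<ge> 0"
  shows "of_real r - \<zeta>\<^sup>2 \<noteq> 0"
proof
  assume "of_real r - \<zeta>\<^sup>2 = 0"
  then have "\<zeta>\<^sup>2 = (of_real (sqrt r))\<^sup>2" using assms(2) by (simp flip: of_real_power)
  then have "\<zeta> = of_real (sqrt r) \<or> \<zeta> = - of_real (sqrt r)" by (simp add: power2_eq_iff)
  then show False using assms(1) by auto
qed

text \<open>On \<open>ev\<close> and \<open>fv\<close> the square of \<open>D - \<alpha>\<close> is triangular in \<open>k\<close> with non-negative diagonal
  entries, and \<open>(D - z) (D - \<alpha> + \<zeta>) = (D - \<alpha>)\<^sup>2 - \<zeta>\<^sup>2\<close> for \<open>\<zeta> = z - \<alpha>\<close>.\<close>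

lemma th_ev_range:
  assumes a: "admissible \<xi>" and r: "rho \<xi> > 0" and z: "Im z \<noteq> 0"
  shows "tensor (th \<xi> k) (ev \<xi>) \<in> approx_range z"
proof (induction k rule: less_induct)
  case (less k)
  define \<zeta> where "\<zeta> = z - of_real al"
  let ?B = "2 * pi * bb \<xi>" and ?e = "\<lambda>k. tensor (th \<xi> k) (ev \<xi>)" and ?f = "\<lambda>k. tensor (th \<xi> k) (fv \<xi>)"
  define c where "c = of_real (?B\<^sup>2 + 4 * pi * rho \<xi> * k) - \<zeta>\<^sup>2"
  have c: "c \<noteq> 0" unfolding c_def using z r by (intro real_minus_square_nonzero) (auto simp: \<zeta>_def)
  \<comment> \<open>This is \<open>D - \<alpha> + \<zeta>\<close> applied to \<open>?e k\<close>.
    The diagonal entry of the square of \<open>D - \<alpha>\<close> is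
    \<open>?B\<^sup>2 + 4 * pi * rho \<xi> * k\<close>; its one off-diagonal entry,
    \<open>- k (k - 1)\<close>, leads to \<open>k - 2\<close>, hence the strong induction.\<close>
  define \<psi> where "\<psi> p = (of_nat k *s ?f (k - 1) p) + (of_real ?B + \<zeta>) *s ?e k p" for p
  have S: "?e k \<in> SS" "?f k \<in> SS" for k by (intro tensor_th_SS a r)+
  have fS: "(\<lambda>p. of_nat k *s ?f (k - 1) p) \<in> SS" using SS_add_cmult[OF zero_SS S(2)[of "k - 1"], of "of_nat k"] by simp
  have pS: "\<psi> \<in> SS" unfolding \<psi>_def by (rule SS_add_cmult[OF fS S(1)])
  have kk: "of_nat k * of_nat (k - 1) = (of_nat k * (of_nat k - 1) :: complex)" by (cases k) auto
  have Wf: "Wop z (\<lambda>p. of_nat k *s ?f (k - 1) p) p = of_nat k *s Wop z (?f (k - 1)) p" for p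
    using Wop_add_cmult[OF zero_SS S(2)[of "k - 1"], of z "of_nat k" p] dirac_add_cmult[OF zero_SS zero_SS, of 1 p]
    by (simp add: Wop_def)
  have W: "Wop z \<psi> p = c *s ?e k p - (of_nat k * of_nat (k - 1)) *s ?e (k - 2) p" for p
  proof (cases k)
    case 0
    then show ?thesis
      unfolding \<psi>_def Wop_add_cmult[OF fS S(1)] Wf unfolding Wop_def dirac_th[OF r] c_def \<zeta>_def
      by (simp add: vec_eq_iff algebra_simps power2_eq_square)
  next
    case (Suc j)
    then show ?thesis
      unfolding \<psi>_def Wop_add_cmult[OF fS S(1)] Wf unfolding Wop_def dirac_th[OF r] c_def \<zeta>_def
      by (simp add: vec_eq_iff algebra_simps power2_eq_square)
  qed
  have eq: "?e k p = inverse c *s Wop z \<psi> p + (inverse c * (of_nat k * of_nat (k - 1))) *s ?e (k - 2) p" for p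
    unfolding W using c by (simp add: vec_eq_iff algebra_simps)
  have "Wop z \<psi> \<in> approx_range z" by (rule approx_range_Wop[OF pS refl])
  note 1 = approx_range_add_cmult[OF zero_approx_range this, of "inverse c"]
  show ?case
  proof (cases "k = 0 \<or> k = 1")
    case True
    then have "?e k = (\<lambda>p. 0 + inverse c *s Wop z \<psi> p)" using eq by (auto simp: fun_eq_iff)
    then show ?thesis using 1 by simp
  next
    case False
    then have "?e (k - 2) \<in> approx_range z" using less by simp
    from approx_range_add_cmult[OF 1 this, of "inverse c * (of_nat k * of_nat (k - 1))"]
    have "(\<lambda>p. 0 + inverse c *s Wop z \<psi> p + (inverse c * (of_nat k * of_nat (k - 1))) *s ?e (k - 2) p) \<in> approx_range z" .
    moreover have "?e k = (\<lambda>p. 0 + inverse c *s Wop z \<psi> p + (inverse c * (of_nat k * of_nat (k - 1))) *s ?e (k - 2) p)"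
      using eq by auto
    ultimately show ?thesis by simp
  qed
qed

text \<open>Applied to \<open>fv\<close>, the operator \<open>D - z\<close> gives a multiple of
  \<open>fv\<close> plus terms on \<open>ev\<close> already known to lie in the closed range; the
  multiple \<open>- (\<zeta> + ?B)\<close> is nonzero because it is not real.\<close>

lemma th_fv_range:
  assumes a: "admissible \<xi>" and r: "rho \<xi> > 0" and z: "Im z \<noteq> 0"
  shows "tensor (th \<xi> k) (fv \<xi>) \<in> approx_range z"
proof -
  define \<zeta> where "\<zeta> = z - of_real al"
  let ?B = "2 * pi * bb \<xi>" and ?e = "\<lambda>k. tensor (th \<xi> k) (ev \<xi>)" and ?f = "\<lambda>k. tensor (th \<xi> k) (fv \<xi>)"
  have nz: "\<zeta> + of_real ?B \<noteq> 0" using z by (auto simp: \<zeta>_def complex_eq_iff)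
  have S: "?f k \<in> SS" by (intro tensor_th_SS a r)
  have "Wop z (?f k) \<in> approx_range z" by (rule approx_range_Wop[OF S refl])
  from approx_range_add_cmult[OF approx_range_add_cmult[OF approx_range_add_cmult[OF zero_approx_range this]
     th_ev_range[OF assms, of "Suc k"]] th_ev_range[OF assms, of "k - 1"]]
  have mem: "(\<lambda>p. 0 + (- inverse (\<zeta> + of_real ?B)) *s Wop z (?f k) p
      + (of_real (4 * pi * rho \<xi>) * inverse (\<zeta> + of_real ?B)) *s ?e (Suc k) p
      + (- of_nat k * inverse (\<zeta> + of_real ?B)) *s ?e (k - 1) p) \<in> approx_range z" .
  have eq: "?f k = (\<lambda>p. 0 + (- inverse (\<zeta> + of_real ?B)) *s Wop z (?f k) p
      + (of_real (4 * pi * rho \<xi>) * inverse (\<zeta> + of_real ?B)) *s ?e (Suc k) p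
      + (- of_nat k * inverse (\<zeta> + of_real ?B)) *s ?e (k - 1) p)"
  proof (rule ext)
    fix p
    have W: "Wop z (?f k) p = - (\<zeta> + of_real ?B) *s ?f k p + of_real (4 * pi * rho \<xi>) *s ?e (Suc k) p - of_nat k *s ?e (k - 1) p"
      unfolding Wop_def dirac_th[OF r] \<zeta>_def by (simp add: vec_eq_iff algebra_simps)
    define i where "i = inverse (\<zeta> + complex_of_real ?B)"
    have i: "i * (\<zeta> + of_real ?B) = 1" using nz by (simp add: i_def)
    have "- i *s Wop z (?f k) p = (i * (\<zeta> + of_real ?B)) *s ?f k p - (i * of_real (4 * pi * rho \<xi>)) *s ?e (Suc k) p + (i * of_nat k) *s ?e (k - 1) p"
      unfolding W by (simp add: vec_eq_iff algebra_simps)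
    then show "?f k p = 0 + (- inverse (\<zeta> + of_real ?B)) *s Wop z (?f k) p
      + (of_real (4 * pi * rho \<xi>) * inverse (\<zeta> + of_real ?B)) *s ?e (Suc k) p
      + (- of_nat k * inverse (\<zeta> + of_real ?B)) *s ?e (k - 1) p"
      unfolding i i_def[symmetric] by (simp add: vec_eq_iff algebra_simps)
  qed
  show ?thesis by (rule iffD2[OF arg_cong[OF eq, of "\<lambda>w. w \<in> approx_range z"] mem])
qed

lemma good_th:
  assumes a: "admissible \<xi>" and r: "rho \<xi> > 0" and z: "Im z \<noteq> 0"
  shows "good z (th \<xi> k)"
  unfolding good_def
proof
  fix v :: "complex^2"
  have u: "uu \<xi> \<noteq> 0" using uu_cnj[OF r] by auto
  define s t where "s = (v $ 1 / uu \<xi> + v $ 2) / 2" and "t = (v $ 1 / uu \<xi> - v $ 2) / (2 * \<i>)"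
  have v: "v = s *s ev \<xi> + t *s fv \<xi>"
    using u by (simp add: vec_eq_iff forall_2 ev_def fv_def s_def t_def field_simps)
  have "(\<lambda>p. (0 + s *s tensor (th \<xi> k) (ev \<xi>) p) + t *s tensor (th \<xi> k) (fv \<xi>) p) \<in> approx_range z"
    by (intro approx_range_add_cmult zero_approx_range th_ev_range th_fv_range assms)
  moreover have "(\<lambda>p. (0 + s *s tensor (th \<xi> k) (ev \<xi>) p) + t *s tensor (th \<xi> k) (fv \<xi>) p) = tensor (th \<xi> k) v"
    by (subst v) (simp add: tensor_def fun_eq_iff vec_eq_iff algebra_simps)
  ultimately show "tensor (th \<xi> k) v \<in> approx_range z" by simp
qed

text \<open>On \<phi> times constant spinors \<open>D - \<alpha>\<close> is a matrix
  \<open>M\<close> whose square is a nonnegative scalar, by the Clifford relations. Hence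
  \<open>(M + \<zeta>) / c\<close> inverts \<open>M - \<zeta>\<close>. This handles the frequencies
  without Gaussians.\<close>

lemma good_joint_eigenfunction:
  fixes y :: "3 \<Rightarrow> real"
  assumes s: "smooth \<phi>" and e: "equivariant (shear r1 r2) \<epsilon> \<phi>" and z: "Im z \<noteq> 0"
    and d: "\<And>i p. deriv_along (E i) \<phi> p = 2 * pi * \<i> * of_real (y i) * \<phi> p"
  shows "good z \<phi>"
  unfolding good_def
proof
  fix v :: "complex^2"
  define \<zeta> where "\<zeta> = z - of_real al"
  define M where "M v = (\<Sum>i\<in>UNIV. of_real (2 * pi * y i) *s (\<i> *s (clifford i *v v)))" for v
  define c where "c = of_real ((2 * pi * y 1)\<^sup>2 + (2 * pi * y 2)\<^sup>2 + (2 * pi * y 3)\<^sup>2) - \<zeta>\<^sup>2"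
  have c: "c \<noteq> 0" unfolding c_def using z by (intro real_minus_square_nonzero) (auto simp: \<zeta>_def)
  have MM: "M (M v) = (c + \<zeta>\<^sup>2) *s v" 
    unfolding M_def c_def sum_3 clifford_values
    by (simp add: vec_eq_iff forall_2 algebra_simps power2_eq_square)
  have Mlin: "M (a *s u + b *s w) = a *s M u + b *s M w" for a b u w
    unfolding M_def sum_3 clifford_values by (simp add: vec_eq_iff forall_2 algebra_simps)
  have D: "Wop z (tensor \<phi> u) p = \<phi> p *s (M u - \<zeta> *s u)" for u p
    unfolding Wop_def dirac_tensor[OF s] d M_def \<zeta>_def tensor_def sum_3
    by (simp add: vec_eq_iff algebra_simps)
  have "tensor \<phi> (inverse c *s M v + (inverse c * \<zeta>) *s v) \<in> SS" by (rule tensor_SS[OF s e])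
  then show "tensor \<phi> v \<in> approx_range z"
  proof (rule approx_range_Wop)
    fix p
    have "M (inverse c *s M v + (inverse c * \<zeta>) *s v) - \<zeta> *s (inverse c *s M v + (inverse c * \<zeta>) *s v) = (inverse c * c) *s v"
      unfolding Mlin MM by (simp add: vec_eq_iff algebra_simps power2_eq_square)
    then show "tensor \<phi> v p = Wop z (tensor \<phi> (inverse c *s M v + (inverse c * \<zeta>) *s v)) p"
      unfolding D using c by (simp add: tensor_def)
  qed
qed

end

section \<open>Approximation of profiles\<close>

text \<open>Doubling the argument buys a geometric factor: each tail term is at most
  \<open>(1/2) ^ K\<close> times the corresponding term of the series at \<open>2 * norm w\<close>.
  The remaining exponential growth is absorbed by a Gaussian.\<close>

lemma exp_tail_bound:
  fixes w :: complex
  shows "norm (exp w - (\<Sum>k<K. w ^ k /\<^sub>R fact k)) \<le> (1/2) ^ K * exp (2 * norm w)"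
proof -
  let ?b = "\<lambda>k. (2 * norm w) ^ k /\<^sub>R fact k"
  have s: "summable (\<lambda>k. w ^ k /\<^sub>R fact k)" "summable ?b" by (rule summable_exp_generic)+
  note ss = summable_ignore_initial_segment[OF s(2), of K]
  note sb = summable_mult[OF ss, of "(1/2)^K"]
  have le: "norm (w ^ (k + K) /\<^sub>R fact (k + K)) \<le> (1/2)^K * ?b (k + K)" for k
  proof -
    have "norm (w ^ (k + K) /\<^sub>R fact (k + K)) = (1/2)^(k + K) * ?b (k + K)"
      by (simp add: norm_power norm_mult power_mult_distrib power_one_over)
    also have "\<dots> \<le> (1/2)^K * ?b (k + K)"
      by (intro mult_right_mono power_decreasing) auto
    finally show ?thesis .
  qed
  have "exp w - (\<Sum>k<K. w ^ k /\<^sub>R fact k) = (\<Sum>k. w ^ (k + K) /\<^sub>R fact (k + K))"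
    unfolding exp_def using suminf_minus_initial_segment[OF s(1), of K] by simp
  also have "norm \<dots> \<le> (\<Sum>k. (1/2)^K * ?b (k + K))"
    by (rule norm_suminf_le[OF le sb])
  also have "\<dots> = (1/2)^K * (\<Sum>k. ?b (k + K))"
    by (rule suminf_mult[OF ss])
  also have "(\<Sum>k. ?b (k + K)) = exp (2 * norm w) - (\<Sum>k<K. ?b k)"
    unfolding exp_def using suminf_minus_initial_segment[OF s(2), of K] by simp
  also have "(1/2)^K * (exp (2 * norm w) - (\<Sum>k<K. ?b k)) \<le> (1/2) ^ K * exp (2 * norm w)"
    by (intro mult_left_mono) (auto intro!: sum_nonneg)
  finally show ?thesis .
qed

lemma norm_exp_i: "norm (exp (\<i> * of_real x)) = 1" by (rule norm_exp_i_times)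

definition decaying :: "(real \<Rightarrow> complex) \<Rightarrow> bool" where
  "decaying f \<longleftrightarrow> (\<exists>M. \<forall>s. norm (f s) \<le> M / (1 + s\<^sup>2))"

lemma decaying_add_cmult: "decaying f \<Longrightarrow> decaying h \<Longrightarrow> decaying (\<lambda>s. f s + c * h s)"
proof -
  assume "decaying f" "decaying h"
  then obtain M N where M: "\<And>s. norm (f s) \<le> M / (1 + s\<^sup>2)" and N: "\<And>s. norm (h s) \<le> N / (1 + s\<^sup>2)"
    unfolding decaying_def by blast
  have "norm (f s + c * h s) \<le> (M + norm c * N) / (1 + s\<^sup>2)" for s
  proof -
    have "norm (f s + c * h s) \<le> norm (f s) + norm c * norm (h s)" by (metis norm_mult norm_triangle_ineq)
    also have "\<dots> \<le> M / (1 + s\<^sup>2) + norm c * (N / (1 + s\<^sup>2))" by (intro add_mono mult_left_mono M N) auto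
    finally show ?thesis by (simp add: add_divide_distrib)
  qed
  then show ?thesis unfolding decaying_def by blast
qed

lemma decaying_zero: "decaying (\<lambda>s. 0)" by (auto simp: decaying_def intro: exI[of _ 0])

lemma decaying_bound: "decaying f \<Longrightarrow> (\<And>s. norm (h s) \<le> B * norm (f s)) \<Longrightarrow> B \<ge> 0 \<Longrightarrow> decaying h"
proof -
  assume f: "decaying f" and h: "\<And>s. norm (h s) \<le> B * norm (f s)" and B: "B \<ge> 0"
  obtain M where M: "\<And>s. norm (f s) \<le> M / (1 + s\<^sup>2)" using f unfolding decaying_def by blast
  have "norm (h s) \<le> (B * M) / (1 + s\<^sup>2)" for s
    using order_trans[OF h mult_left_mono[OF M B]] by simp
  then show ?thesis unfolding decaying_def by blast
qed

section \<open>From Gaussians to compactly supported profiles\<close>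

context sub_dirac
begin

lemma periodise_profile_add_cmult:
  assumes "decaying f" "decaying h"
  shows "periodise (profile \<xi> (\<lambda>s. f s + c * h s)) p = periodise (profile \<xi> f) p + c * periodise (profile \<xi> h) p"
proof -
  obtain M N where "weighted M (profile \<xi> f)" and N: "weighted N (profile \<xi> h)"
    using assms unfolding decaying_def weighted_profile by blast
  note eq = periodise_add[OF this(1) weighted_cmult[OF N, of c], of p] periodise_cmult[of c "profile \<xi> h" p]
  have "profile \<xi> (\<lambda>s. f s + c * h s) = (\<lambda>p. profile \<xi> f p + c * profile \<xi> h p)"
    by (simp add: profile_def fun_eq_iff algebra_simps)
  then show ?thesis by (simp only: eq)
qed

definition good_profile :: "complex \<Rightarrow> real^4 \<Rightarrow> (real \<Rightarrow> complex) \<Rightarrow> bool" where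
  "good_profile z \<xi> f \<longleftrightarrow> decaying f \<and> good z (periodise (profile \<xi> f))"

lemma good_profile_zero: "good_profile z \<xi> (\<lambda>s. 0)"
  using good_zero by (simp add: good_profile_def decaying_zero profile_def[abs_def] periodise_def[abs_def])

lemma good_profile_add_cmult:
  "good_profile z \<xi> f \<Longrightarrow> good_profile z \<xi> h \<Longrightarrow> good_profile z \<xi> (\<lambda>s. f s + c * h s)"
proof -
  assume fh: "good_profile z \<xi> f" "good_profile z \<xi> h"
  then have "periodise (profile \<xi> (\<lambda>s. f s + c * h s)) = (\<lambda>p. periodise (profile \<xi> f) p + c * periodise (profile \<xi> h) p)"
    unfolding good_profile_def by (intro ext periodise_profile_add_cmult) auto
  note eq = this
  show ?thesis
    using fh good_add_cmult[of z "periodise (profile \<xi> f)" "periodise (profile \<xi> h)" c] decaying_add_cmult[of f h c]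
    unfolding good_profile_def eq by blast
qed

lemma good_profile_sum:
  "finite I \<Longrightarrow> (\<And>i. i \<in> I \<Longrightarrow> good_profile z \<xi> (f i)) \<Longrightarrow> good_profile z \<xi> (\<lambda>s. \<Sum>i\<in>I. c i * f i s)"
proof (induction I rule: finite_induct)
  case (insert i I)
  then have "good_profile z \<xi> (\<lambda>s. (\<Sum>i\<in>I. c i * f i s) + c i * f i s)" by (intro good_profile_add_cmult) auto
  then show ?case using insert by (simp add: add.commute)
qed (simp add: good_profile_zero)

text \<open>Closeness in the weight \<open>1 / (1 + s\<^sup>2)\<close> becomes uniform closeness
  after periodisation, with the factor \<open>4 * weight_sum\<close> that \<eta>
  compensates.\<close>

lemma good_profile_closed:
  assumes f: "decaying f"
    and ap: "\<And>\<delta>. \<delta> > 0 \<Longrightarrow> \<exists>h. good_profile z \<xi> h \<and> (\<forall>s. norm (h s - f s) \<le> \<delta> / (1 + s\<^sup>2))"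
  shows "good_profile z \<xi> f"
  unfolding good_profile_def
proof (intro conjI f good_closed)
  fix \<delta> :: real assume d: "\<delta> > 0"
  define \<eta> where "\<eta> = \<delta> / (4 * weight_sum + 1)"
  have e: "\<eta> > 0" unfolding \<eta>_def using d weight_sum_nonneg by (intro divide_pos_pos) auto
  obtain h where h: "good_profile z \<xi> h" "\<And>s. norm (h s - f s) \<le> \<eta> / (1 + s\<^sup>2)" using ap[OF e] by blast
  have "norm (periodise (profile \<xi> h) p - periodise (profile \<xi> f) p) \<le> \<delta>" for p
  proof -
    have "periodise (profile \<xi> h) p - periodise (profile \<xi> f) p = periodise (profile \<xi> (\<lambda>s. h s - f s)) p"
      using periodise_profile_add_cmult[of h f \<xi> "-1" p] h f by (simp add: good_profile_def)
    also have "norm \<dots> \<le> 4 * weight_sum * \<eta>"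
      by (rule periodise_summable(2)) (use h(2) in \<open>simp add: weighted_profile\<close>)
    also have "\<dots> \<le> \<delta>"
      unfolding \<eta>_def using divide_add1_mult_le[of "4 * weight_sum" \<delta>] d weight_sum_nonneg by (simp add: mult.commute)
    finally show ?thesis .
  qed
  then show "\<exists>\<psi>. good z \<psi> \<and> (\<forall>p. norm (\<psi> p - periodise (profile \<xi> f) p) \<le> \<delta>)"
    using h(1) unfolding good_profile_def by blast
qed

lemma decaying_gaussp: "rho \<xi> > 0 \<Longrightarrow> decaying (gaussp \<xi> k)"
  using gaussp_weighted[of \<xi> k] unfolding weighted_profile decaying_def by blast


lemma good_profile_exp_gauss:
  assumes a: "admissible \<xi>" and r: "rho \<xi> > 0" and z: "Im z \<noteq> 0"
  shows "good_profile z \<xi> (\<lambda>s. exp (\<i> * of_real (\<mu> * s)) * gaussp \<xi> 0 s)"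
proof (rule good_profile_closed)
  show "decaying (\<lambda>s. exp (\<i> * of_real (\<mu> * s)) * gaussp \<xi> 0 s)"
    by (rule decaying_bound[OF decaying_gaussp[OF r, of 0], where B=1]) (unfold norm_mult norm_exp_i, simp_all)
  fix \<delta> :: real assume d: "\<delta> > 0"
  \<comment> \<open>The exponential rate \<open>2 * \<bar>\<mu>\<bar>\<close> matches the factor
    \<open>exp (2 * norm w)\<close> of \<open>exp_tail_bound\<close> for
    \<open>w = \<i> \<mu> (s + cc)\<close>.\<close>
  obtain M where M: "M \<ge> 0" "\<And>s. \<bar>s + cc \<xi>\<bar> ^ 0 * exp (2 * \<bar>\<mu>\<bar> * \<bar>s + cc \<xi>\<bar>) * exp (- (pi * rho \<xi>) * (s + cc \<xi>)\<^sup>2) \<le> M / (1 + s\<^sup>2)"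
    using gaussian_weight[of "pi * rho \<xi>" "cc \<xi>" 0 "2 * \<bar>\<mu>\<bar>"] r by auto
  have "\<exists>K. (1/2) ^ K < \<delta> / (M + 1)"
    using d M by (intro real_arch_pow_inv) (auto intro!: divide_pos_pos add_nonneg_pos)
  then obtain K where K: "(1/2) ^ K < \<delta> / (M + 1)" by blast
  \<comment> \<open>The phase that recentres the exponential at \<open>- cc\<close>, so that its
    Taylor monomials are exactly those of \<open>gaussp\<close>.\<close>
  define e where "e = exp (- \<i> * of_real (\<mu> * cc \<xi>))"
  have ne: "norm e = 1" using norm_exp_i[of "- (\<mu> * cc \<xi>)"] by (simp add: e_def)
  define h where "h s = (\<Sum>k<K. (e * (\<i> * of_real \<mu>) ^ k /\<^sub>R fact k) * gaussp \<xi> k s)" for s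
  have "good_profile z \<xi> h"
    unfolding h_def by (intro good_profile_sum) (auto simp: good_profile_def decaying_gaussp r good_th[OF a r z, unfolded th_def])
  moreover have "norm (h s - exp (\<i> * of_real (\<mu> * s)) * gaussp \<xi> 0 s) \<le> \<delta> / (1 + s\<^sup>2)" for s
  proof -
    define w where "w = \<i> * of_real (\<mu> * (s + cc \<xi>))"
    have nw: "norm w = \<bar>\<mu>\<bar> * \<bar>s + cc \<xi>\<bar>" unfolding w_def norm_mult norm_of_real by (simp add: abs_mult)
    have ew: "exp (\<i> * of_real (\<mu> * s)) = e * exp w"
      by (simp add: e_def w_def exp_add[symmetric] algebra_simps)
    have "h s = e * (\<Sum>k<K. w ^ k /\<^sub>R fact k) * gaussp \<xi> 0 s"
      unfolding h_def sum_distrib_left sum_distrib_right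
      by (rule sum.cong) (simp_all add: gaussp_def w_def power_mult_distrib scaleR_conv_of_real mult_ac)
    then have "h s - exp (\<i> * of_real (\<mu> * s)) * gaussp \<xi> 0 s = - (e * (exp w - (\<Sum>k<K. w ^ k /\<^sub>R fact k)) * gaussp \<xi> 0 s)"
      unfolding ew by (simp add: algebra_simps)
    then have "norm (h s - exp (\<i> * of_real (\<mu> * s)) * gaussp \<xi> 0 s) = norm (exp w - (\<Sum>k<K. w ^ k /\<^sub>R fact k)) * norm (gaussp \<xi> 0 s)"
      by (simp add: norm_mult ne)
    also have "\<dots> \<le> ((1/2) ^ K * exp (2 * norm w)) * norm (gaussp \<xi> 0 s)"
      by (intro mult_right_mono exp_tail_bound) auto
    also have "norm (gaussp \<xi> 0 s) = exp (- (pi * rho \<xi>) * (s + cc \<xi>)\<^sup>2)"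
      unfolding gaussp_def norm_mult norm_power norm_of_real norm_exp_eq_Re Re_complex_of_real by simp
    also have "(1/2) ^ K * exp (2 * norm w) * exp (- (pi * rho \<xi>) * (s + cc \<xi>)\<^sup>2) \<le> (1/2) ^ K * (M / (1 + s\<^sup>2))"
      using M(2)[of s] by (simp only: nw mult.assoc power_0 mult_1) (intro mult_left_mono, simp_all)
    also have "\<dots> \<le> \<delta> / (M + 1) * (M / (1 + s\<^sup>2))"
      using K M by (intro mult_right_mono divide_nonneg_nonneg) auto
    also have "\<dots> = (\<delta> / (M + 1) * M) / (1 + s\<^sup>2)" by simp
    also have "\<dots> \<le> \<delta> / (1 + s\<^sup>2)"
      using d M by (intro divide_right_mono divide_add1_mult_le) auto
    finally show ?thesis .
  qed
  ultimately show "\<exists>h. good_profile z \<xi> h \<and> (\<forall>s. norm (h s - exp (\<i> * of_real (\<mu> * s)) * gaussp \<xi> 0 s) \<le> \<delta> / (1 + s\<^sup>2))"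
    by blast
qed

text \<open>A sine is a difference of exponentials, so each factor moves the frequency by
  \<open>l\<close> in both directions; hence the induction over \<open>n\<close> with \<mu>
  arbitrary.\<close>

lemma good_profile_sin_gauss:
  assumes a: "admissible \<xi>" and r: "rho \<xi> > 0" and z: "Im z \<noteq> 0"
  shows "good_profile z \<xi> (\<lambda>s. of_real (sin (l * s)) ^ n * (exp (\<i> * of_real (\<mu> * s)) * gaussp \<xi> 0 s))"
proof (induction n arbitrary: \<mu>)
  case 0
  show ?case using good_profile_exp_gauss[OF assms] by simp
next
  case (Suc n)
  let ?F = "\<lambda>\<mu> s. of_real (sin (l * s)) ^ n * (exp (\<i> * of_real (\<mu> * s)) * gaussp \<xi> 0 s)"
  have "good_profile z \<xi> (\<lambda>s. (0 + (1 / (2 * \<i>)) * ?F (\<mu> + l) s) + (- 1 / (2 * \<i>)) * ?F (\<mu> - l) s)"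
    by (intro good_profile_add_cmult good_profile_zero Suc.IH)
  moreover have "(0 + (1 / (2 * \<i>)) * ?F (\<mu> + l) s) + (- 1 / (2 * \<i>)) * ?F (\<mu> - l) s
      = of_real (sin (l * s)) ^ Suc n * (exp (\<i> * of_real (\<mu> * s)) * gaussp \<xi> 0 s)" for s
  proof -
    have s: "complex_of_real (sin (l * s)) = (exp (\<i> * of_real (l * s)) - exp (- (\<i> * of_real (l * s)))) / (2 * \<i>)"
      using sin_exp_eq[of "complex_of_real (l * s)"] by (simp only: sin_of_real)
    have e: "exp (\<i> * of_real ((\<mu> + l) * s)) = exp (\<i> * of_real (\<mu> * s)) * exp (\<i> * of_real (l * s))"
      "exp (\<i> * of_real ((\<mu> - l) * s)) = exp (\<i> * of_real (\<mu> * s)) * exp (- (\<i> * of_real (l * s)))"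
      by (simp_all add: exp_add[symmetric] algebra_simps)
    define x ep em where "x = exp (\<i> * of_real (\<mu> * s))" and "ep = exp (\<i> * of_real (l * s))"
      and "em = exp (- (\<i> * complex_of_real (l * s)))"
    show ?thesis unfolding e power_Suc s unfolding x_def[symmetric] ep_def[symmetric] em_def[symmetric]
      by (simp add: field_simps)
  qed
  ultimately show ?case by simp
qed

text \<open>\<open>sin (l s)\<close> parametrises the interval \<open>[-N, N]\<close> for \<open>l = \<pi> / (2 N)\<close>, so Weierstrass'
  theorem approximates a function supported there by trigonometric polynomials; outside, the latter
  merely stay bounded and the Gaussian takes over.\<close>

lemma good_profile_compact:
  assumes a: "admissible \<xi>" and r: "rho \<xi> > 0" and z: "Im z \<noteq> 0"
    and f: "continuous_on UNIV f" and supp: "\<And>s. \<bar>s\<bar> > 1 \<Longrightarrow> f s = 0"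
  shows "good_profile z \<xi> f"
proof (rule good_profile_closed)
  have "compact (f ` {-1..1})" by (intro compact_continuous_image continuous_on_subset[OF f]) auto
  then obtain B where B: "\<And>s. s \<in> {-1..1} \<Longrightarrow> norm (f s) \<le> B"
    using compact_imp_bounded bounded_iff by (metis imageI)
  have "norm (f 0) \<le> B" by (rule B) simp
  then have B0: "B \<ge> 0" using norm_ge_zero[of "f 0"] by linarith
  have "norm (f s) \<le> (2 * B) / (1 + s\<^sup>2)" for s
  proof (cases "\<bar>s\<bar> \<le> 1")
    case True
    then have "s\<^sup>2 \<le> 1" by (simp add: abs_square_le_1)
    then have "B * (1 + s\<^sup>2) \<le> B * 2" using B0 by (intro mult_left_mono) auto
    then have "B \<le> (2 * B) / (1 + s\<^sup>2)" by (simp add: pos_le_divide_eq add_pos_nonneg mult.commute)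
    then show ?thesis using B[of s] True by (auto simp: abs_le_iff intro: order_trans)
  qed (use supp[of s] B0 in simp)
  then show "decaying f" unfolding decaying_def by blast
  fix \<delta> :: real assume d: "\<delta> > 0"
  define G where "G s = exp (- (pi * rho \<xi>) * (s + cc \<xi>)\<^sup>2)" for s
  have gG: "gaussp \<xi> 0 s = of_real (G s)" for s
    unfolding gaussp_def G_def by (simp only: power_0 mult_1 exp_of_real) simp
  have Gp: "G s > 0" for s by (simp add: G_def)
  \<comment> \<open>Half the exponent: \<open>G\<close> is the square of this Gaussian and decays
    like the square of the weight. The spare factor \<open>1 / (1 + s\<^sup>2)\<close> is what beats
    a merely bounded function outside \<open>[-N, N]\<close>.\<close>
  obtain M' where M': "M' \<ge> 0" "\<And>s. \<bar>s + cc \<xi>\<bar> ^ 0 * exp (0 * \<bar>s + cc \<xi>\<bar>) * exp (- (pi * rho \<xi> / 2) * (s + cc \<xi>)\<^sup>2) \<le> M' / (1 + s\<^sup>2)"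
    using gaussian_weight[of "pi * rho \<xi> / 2" "cc \<xi>" 0 0] r by auto
  define M where "M = M'\<^sup>2 + 1"
  have M1: "M \<ge> 1" by (simp add: M_def)
  have GM: "G s \<le> M / (1 + s\<^sup>2)\<^sup>2" for s
  proof -
    have "G s = (exp (- (pi * rho \<xi> / 2) * (s + cc \<xi>)\<^sup>2))\<^sup>2"
      by (simp add: G_def power2_eq_square exp_add[symmetric])
    also have "\<dots> \<le> (M' / (1 + s\<^sup>2))\<^sup>2" using M'(2)[of s] by (intro power_mono) auto
    also have "\<dots> = M'\<^sup>2 / (1 + s\<^sup>2)\<^sup>2" by (simp add: power_divide)
    also have "\<dots> \<le> M / (1 + s\<^sup>2)\<^sup>2" by (intro divide_right_mono) (auto simp: M_def)
    finally show ?thesis .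
  qed
  have one: "1 + s\<^sup>2 \<ge> 1" for s :: real by simp
  have GM1: "G s \<le> M / (1 + s\<^sup>2)" for s
  proof -
    have "1 + s\<^sup>2 \<le> (1 + s\<^sup>2)\<^sup>2" using self_le_power[OF one, of 2 s] by simp
    then have "M / (1 + s\<^sup>2)\<^sup>2 \<le> M / (1 + s\<^sup>2)" using M1
      by (intro divide_left_mono) (auto intro!: mult_pos_pos zero_less_power add_pos_nonneg)
    with GM[of s] show ?thesis by linarith
  qed
  define F0 where "F0 s = f s / of_real (G s)" for s
  have F0c: "continuous_on UNIV F0"
  proof -
    have "continuous_on UNIV G" unfolding G_def by (intro continuous_intros)
    then show ?thesis unfolding F0_def using Gp by (intro continuous_intros f) (auto simp: less_imp_neq[symmetric])
  qed
  have "compact (F0 ` {-1..1})" by (intro compact_continuous_image continuous_on_subset[OF F0c]) auto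
  then obtain C where C: "\<And>s. s \<in> {-1..1} \<Longrightarrow> norm (F0 s) \<le> C"
    using compact_imp_bounded bounded_iff by (metis imageI)
  have "norm (F0 0) \<le> C" by (rule C) simp
  then have C0: "C \<ge> 0" using norm_ge_zero[of "F0 0"] by linarith
  have C: "norm (F0 s) \<le> C" for s
    using C[of s] C0 supp[of s] by (cases "\<bar>s\<bar> \<le> 1") (auto simp: F0_def abs_le_iff)
  \<comment> \<open>The bound \<open>\<delta> / M\<close> serves inside the interval; the bound 1
    keeps the approximating polynomial below \<open>C + 1\<close> everywhere.\<close>
  define \<eta> where "\<eta> = min 1 (\<delta> / M)"
  have e: "\<eta> > 0" "\<eta> \<le> 1" "\<eta> * M \<le> \<delta>" using d M1 by (auto simp: \<eta>_def min_def field_simps)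
  \<comment> \<open>Large enough that beyond \<open>N\<close> the bound \<open>C + 1\<close> times
    the spare decay of \<open>G\<close> is at most \<delta>.\<close>
  define N where "N = max 1 ((C + 1) * M / \<delta>)"
  have N: "N \<ge> 1" "(C + 1) * M \<le> \<delta> * N" using d by (auto simp: N_def max_def field_simps)
  define l where "l = pi / (2 * N)"
  have l: "l > 0" using N by (simp add: l_def)
  define F where "F y = F0 (arcsin y / l)" for y
  have Fc: "continuous_on {-1..1} F"
    unfolding F_def using l
    by (intro continuous_on_compose2[OF F0c] continuous_intros) auto
  have "\<exists>g. real_polynomial_function g \<and> (\<forall>y\<in>{-1..1}. \<bar>Re (F y) - g y\<bar> < \<eta> / 2)"
    using Stone_Weierstrass_real_polynomial_function[of "{-1..1::real}" "\<lambda>y. Re (F y)" "\<eta> / 2"] e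
    by (metis Fc compact_Icc continuous_on_Re half_gt_zero)
  then obtain g1 where g1: "real_polynomial_function g1" "\<And>y. y \<in> {-1..1} \<Longrightarrow> \<bar>Re (F y) - g1 y\<bar> < \<eta> / 2" by blast
  have "\<exists>g. real_polynomial_function g \<and> (\<forall>y\<in>{-1..1}. \<bar>Im (F y) - g y\<bar> < \<eta> / 2)"
    using Stone_Weierstrass_real_polynomial_function[of "{-1..1::real}" "\<lambda>y. Im (F y)" "\<eta> / 2"] e
    by (metis Fc compact_Icc continuous_on_Im half_gt_zero)
  then obtain g2 where g2: "real_polynomial_function g2" "\<And>y. y \<in> {-1..1} \<Longrightarrow> \<bar>Im (F y) - g2 y\<bar> < \<eta> / 2" by blast
  define P where "P y = complex_of_real (g1 y) + \<i> * of_real (g2 y)" for y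
  have P: "norm (P y - F y) \<le> \<eta>" if "y \<in> {-1..1}" for y
  proof -
    have "norm (P y - F y) \<le> \<bar>Re (P y - F y)\<bar> + \<bar>Im (P y - F y)\<bar>" by (rule cmod_le)
    also have "\<dots> \<le> \<eta>" using g1(2)[OF that] g2(2)[OF that] by (simp add: P_def abs_minus_commute)
    finally show ?thesis .
  qed
  define h where "h s = P (sin (l * s)) * gaussp \<xi> 0 s" for s
  have poly: "good_profile z \<xi> (\<lambda>s. of_real (q (sin (l * s))) * gaussp \<xi> 0 s)" if qp: "real_polynomial_function q" for q :: "real \<Rightarrow> real"
  proof -
    obtain b n where q: "q = (\<lambda>x. \<Sum>i\<le>n. b i * x ^ i)" 
      using qp unfolding real_polynomial_function_iff_sum by blast
    have "good_profile z \<xi> (\<lambda>s. \<Sum>i\<le>n. of_real (b i) * (of_real (sin (l * s)) ^ i * (exp (\<i> * of_real (0 * s)) * gaussp \<xi> 0 s)))"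
      by (intro good_profile_sum good_profile_sin_gauss a r z) auto
    then show ?thesis by (simp add: q sum_distrib_right mult.assoc)
  qed
  have "good_profile z \<xi> (\<lambda>s. of_real (g1 (sin (l * s))) * gaussp \<xi> 0 s + \<i> * (of_real (g2 (sin (l * s))) * gaussp \<xi> 0 s))"
    by (intro good_profile_add_cmult poly g1 g2)
  then have gh: "good_profile z \<xi> h" by (simp add: h_def[abs_def] P_def algebra_simps)
  have "norm (h s - f s) \<le> \<delta> / (1 + s\<^sup>2)" for s
  proof -
    have y: "sin (l * s) \<in> {-1..1}" by simp
    have fs: "f s = F0 s * of_real (G s)" using Gp[of s] by (simp add: F0_def)
    have hs: "norm (h s - f s) = norm (P (sin (l * s)) - F0 s) * G s"
    proof -
      have "h s - f s = (P (sin (l * s)) - F0 s) * of_real (G s)" by (simp add: h_def gG fs algebra_simps)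
      then show ?thesis using Gp[of s] by (simp add: norm_mult)
    qed
    show ?thesis
    proof (cases "\<bar>s\<bar> \<le> N")
      case True
      then have "\<bar>l * s\<bar> \<le> pi / 2" using N by (simp add: l_def abs_mult field_simps)
      then have "arcsin (sin (l * s)) = l * s" by (intro arcsin_sin) (auto simp: abs_le_iff)
      then have "F (sin (l * s)) = F0 s" using l by (simp add: F_def)
      then have "norm (h s - f s) \<le> \<eta> * G s" using P[OF y] Gp[of s] unfolding hs by (intro mult_right_mono) auto
      also have "\<dots> \<le> \<eta> * (M / (1 + s\<^sup>2))" using GM1[of s] e by (intro mult_left_mono) auto
      also have "\<dots> = (\<eta> * M) / (1 + s\<^sup>2)" by simp
      also have "\<dots> \<le> \<delta> / (1 + s\<^sup>2)" using e by (intro divide_right_mono) auto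
      finally show ?thesis .
    next
      case False
      then have F0: "F0 s = 0" using supp[of s] N by (simp add: F0_def)
      have "norm (P (sin (l * s))) \<le> norm (P (sin (l * s)) - F (sin (l * s))) + norm (F (sin (l * s)))"
        using norm_triangle_ineq[of "P (sin (l * s)) - F (sin (l * s))" "F (sin (l * s))"] by simp
      also have "\<dots> \<le> \<eta> + C" using P[OF y] C by (intro add_mono) (auto simp: F_def)
      also have "\<dots> \<le> C + 1" using e by simp
      finally have "norm (h s - f s) \<le> (C + 1) * G s" using Gp[of s] unfolding hs F0 by (intro mult_right_mono) auto
      also have "\<dots> \<le> (C + 1) * (M / (1 + s\<^sup>2)\<^sup>2)" using GM[of s] C0 by (intro mult_left_mono) auto
      also have "\<dots> = ((C + 1) * M / (1 + s\<^sup>2)) / (1 + s\<^sup>2)" by (simp add: power2_eq_square)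
      also have "\<dots> \<le> \<delta> / (1 + s\<^sup>2)"
      proof (intro divide_right_mono)
        have "N \<le> N\<^sup>2" using N by (simp add: power2_eq_square)
        also have "N\<^sup>2 \<le> s\<^sup>2" using False N by (simp add: abs_le_square_iff[symmetric])
        finally have "N \<le> 1 + s\<^sup>2" by simp
        then have "\<delta> * N \<le> \<delta> * (1 + s\<^sup>2)" using d by (intro mult_left_mono) auto
        then have "(C + 1) * M \<le> \<delta> * (1 + s\<^sup>2)" using N by linarith
        then show "(C + 1) * M / (1 + s\<^sup>2) \<le> \<delta>" by (simp add: pos_divide_le_eq add_pos_nonneg)
      qed simp
      finally show ?thesis .
    qed
  qed
  then show "\<exists>h. good_profile z \<xi> h \<and> (\<forall>s. norm (h s - f s) \<le> \<delta> / (1 + s\<^sup>2))" using gh by blast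
qed

end

section \<open>Fejer-type approximation by Fourier modes\<close>

text \<open>A Fourier coefficient along the line through \<open>p\<close> in direction
  \<open>e\<close>, kept as a function of \<open>p\<close>. For quasi-periodic \<open>h\<close> it
  is the component on which translation by \<open>r\<close> in this direction acts as the phase of
  frequency \<nu>.\<close>

definition mode :: "real \<Rightarrow> 'a::real_normed_vector \<Rightarrow> ('a \<Rightarrow> complex) \<Rightarrow> 'a \<Rightarrow> complex" where
  "mode \<nu> e h p = integral {-1/2..1/2} (\<lambda>t. exp (\<i> * of_real (- 2 * pi * \<nu> * t)) * h (p + t *\<^sub>R e))"

text \<open>Uniform in the base point but restricted to one direction. This allows the Fourier
  argument for a periodised function whose modulus of continuity is estimated in the direction of
  \<open>b\<close> only.\<close>

definition equicontinuous_along :: "'a::real_normed_vector \<Rightarrow> ('a \<Rightarrow> complex) \<Rightarrow> bool" where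
  "equicontinuous_along e h \<longleftrightarrow> (\<forall>\<epsilon>>0. \<exists>\<delta>>0. \<forall>p t. \<bar>t\<bar> < \<delta> \<longrightarrow> norm (h (p + t *\<^sub>R e) - h p) \<le> \<epsilon>)"

lemma continuous_along:
  assumes "equicontinuous_along e h"
  shows "continuous_on S (\<lambda>t. h (p + t *\<^sub>R e))"
  unfolding continuous_on_iff dist_norm
proof (intro ballI allI impI)
  fix x \<epsilon> :: real assume "0 < \<epsilon>"
  then obtain \<delta> where d: "\<delta> > 0" "\<And>p t. \<bar>t\<bar> < \<delta> \<Longrightarrow> norm (h (p + t *\<^sub>R e) - h p) \<le> \<epsilon> / 2"
    using assms unfolding equicontinuous_along_def by (meson half_gt_zero)
  have "norm (h (p + y *\<^sub>R e) - h (p + x *\<^sub>R e)) < \<epsilon>" if "norm (y - x) < \<delta>" for y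
    using d(2)[of "y - x" "p + x *\<^sub>R e"] that \<open>0 < \<epsilon>\<close> by (simp add: algebra_simps)
  then show "\<exists>d>0. \<forall>x'\<in>S. norm (x' - x) < d \<longrightarrow> norm (h (p + x' *\<^sub>R e) - h (p + x *\<^sub>R e)) < \<epsilon>"
    using d(1) by blast
qed

lemma mode_integrand_continuous:
  assumes "equicontinuous_along e h"
  shows "continuous_on S (\<lambda>t. exp (\<i> * of_real (- 2 * pi * \<nu> * t)) * h (p + t *\<^sub>R e))"
  by (intro continuous_intros continuous_along[OF assms])

lemma mode_integrable:
  assumes "equicontinuous_along e h"
  shows "(\<lambda>t. exp (\<i> * of_real (- 2 * pi * \<nu> * t)) * h (p + t *\<^sub>R e)) integrable_on {a..b}"
  by (rule integrable_continuous_real[OF mode_integrand_continuous[OF assms]])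

lemma norm_integral_Icc_le:
  fixes f :: "real \<Rightarrow> complex"
  assumes "f integrable_on {-1/2..1/2}" "\<And>t. t \<in> {-1/2..1/2} \<Longrightarrow> norm (f t) \<le> B" "B \<ge> 0"
  shows "norm (integral {-1/2..1/2} f) \<le> B"
proof -
  have "(f has_integral integral {-1/2..1/2} f) (cbox (-1/2) (1/2))" using assms(1) by (simp add: integrable_integral)
  from has_integral_bound[OF assms(3) this] assms(2) show ?thesis by simp
qed

text \<open>The even power makes all frequencies \<open>N - j\<close> in the binomial expansion
  integers, so the kernel produces modes of integer-shifted frequency.\<close>

lemma cos_power_modes:
  "complex_of_real (cos (pi * t)) ^ (2 * N)
     = (\<Sum>j\<le>2 * N. of_real (real (2 * N choose j) / 4 ^ N) * exp (\<i> * of_real (- 2 * pi * (real N - real j) * t)))"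
proof -
  let ?a = "exp (\<i> * of_real (pi * t))" and ?b = "exp (- (\<i> * complex_of_real (pi * t)))"
  have c: "complex_of_real (cos (pi * t)) = (?a + ?b) / 2"
    using cos_exp_eq[of "complex_of_real (pi * t)"] by (simp only: cos_of_real)
  have "complex_of_real (cos (pi * t)) ^ (2 * N) = (?a + ?b) ^ (2 * N) / 4 ^ N"
    unfolding c power_divide by (simp add: power_mult)
  also have "(?a + ?b) ^ (2 * N) = (\<Sum>j\<le>2 * N. of_nat (2 * N choose j) * ?a ^ j * ?b ^ (2 * N - j))"
    by (rule binomial_ring)
  also have "\<dots> / 4 ^ N = (\<Sum>j\<le>2 * N. of_real (real (2 * N choose j) / 4 ^ N) * exp (\<i> * of_real (- 2 * pi * (real N - real j) * t)))"
    unfolding sum_divide_distrib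
  proof (rule sum.cong)
    fix j assume j: "j \<in> {..2 * N}"
    have "?a ^ j * ?b ^ (2 * N - j) = exp (of_nat j * (\<i> * of_real (pi * t)) + of_nat (2 * N - j) * (- (\<i> * of_real (pi * t))))"
      by (simp only: exp_add exp_of_nat_mult)
    also have "of_nat j * (\<i> * complex_of_real (pi * t)) + of_nat (2 * N - j) * (- (\<i> * of_real (pi * t)))
        = \<i> * of_real (- 2 * pi * (real N - real j) * t)"
      using j by (simp add: of_nat_diff algebra_simps)
    finally show "of_nat (2 * N choose j) * ?a ^ j * ?b ^ (2 * N - j) / 4 ^ N =
        of_real (real (2 * N choose j) / 4 ^ N) * exp (\<i> * of_real (- 2 * pi * (real N - real j) * t))"
      by (simp add: mult.assoc)
  qed simp
  finally show ?thesis .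
qed

lemma norm_exp_i_minus_one_le: "norm (exp (\<i> * of_real t) - 1) \<le> \<bar>t\<bar>"
  unfolding dist_exp_i_1 using abs_sin_x_le_abs_x[of "t / 2"] by simp

text \<open>Powers of the cosine form an approximate identity on \<open>[-1/2, 1/2]\<close>,
  normalised by their integral \<open>I\<close>, which is only estimated from below. The phase in
  \<beta> moves the frequencies to the coset prescribed by the sign character.\<close>

lemma mode_approximation:
  fixes h :: "'a::real_normed_vector \<Rightarrow> complex"
  assumes M: "\<And>p. norm (h p) \<le> M" and eq: "equicontinuous_along e h" and \<eta>: "\<eta> > 0"
  shows "\<exists>(n::nat) c (k :: nat \<Rightarrow> int). \<forall>p. norm (h p - (\<Sum>j\<le>n. c j * mode (\<beta> + of_int (k j)) e h p)) \<le> \<eta>"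
proof -
  have M0: "M \<ge> 0" using order_trans[OF norm_ge_zero M] .
  obtain \<delta>1 where d1: "\<delta>1 > 0" "\<And>p t. \<bar>t\<bar> < \<delta>1 \<Longrightarrow> norm (h (p + t *\<^sub>R e) - h p) \<le> \<eta> / 4"
    using eq \<eta> unfolding equicontinuous_along_def by (meson divide_pos_pos zero_less_numeral)
  define L where "L = 2 * pi * \<bar>\<beta>\<bar> * M"
  have L: "L \<ge> 0" using M0 by (simp add: L_def)
  \<comment> \<open>One bound controls the variation of \<open>h\<close>, one the phase of frequency
    \<beta> through \<open>L\<close>, and 1/4 keeps \<open>pi * \<delta>\<close> where the cosine is
    positive.\<close>
  define \<delta> where "\<delta> = min (\<delta>1 / 2) (min (1/4) (\<eta> / 4 / (L + 1)))"
  have d: "\<delta> > 0" "\<delta> < \<delta>1" "\<delta> \<le> 1/4" "\<delta> \<le> \<eta> / 4 / (L + 1)"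
  proof -
    have p: "\<eta> / 4 / (L + 1) > 0" using \<eta> L by (intro divide_pos_pos) auto
    show "\<delta> > 0" using d1(1) p by (simp only: \<delta>_def min_less_iff_conj) simp
    have "\<delta> \<le> \<delta>1 / 2" unfolding \<delta>_def by (rule min.cobounded1)
    then show "\<delta> < \<delta>1" using d1(1) by simp
    show "\<delta> \<le> 1/4" unfolding \<delta>_def by (rule min.coboundedI2, rule min.cobounded1)
    show "\<delta> \<le> \<eta> / 4 / (L + 1)" unfolding \<delta>_def by (rule min.coboundedI2, rule min.cobounded2)
  qed
  have dL: "\<delta> * L \<le> \<eta> / 4"
  proof -
    have "\<delta> * L \<le> \<eta> / 4 / (L + 1) * L" using d L by (intro mult_right_mono) auto
    also have "\<dots> \<le> \<eta> / 4" using L \<eta> by (intro divide_add1_mult_le) auto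
    finally show ?thesis .
  qed
  define u where "u p t = exp (\<i> * of_real (- 2 * pi * \<beta> * t)) * h (p + t *\<^sub>R e)" for p t
  have uc: "continuous_on S (u p)" for S p unfolding u_def by (rule mode_integrand_continuous[OF eq])
  have nu: "norm (u p t) \<le> M" for p t unfolding u_def norm_mult norm_exp_i using M by simp
  have near: "norm (h p - u p t) \<le> \<eta> / 2" if t: "\<bar>t\<bar> \<le> \<delta>" for p t
  proof -
    let ?x = "exp (\<i> * of_real (- 2 * pi * \<beta> * t))"
    have "h p - u p t = - (?x * (h (p + t *\<^sub>R e) - h p)) - (?x - 1) * h p" by (simp add: u_def algebra_simps)
    also have "norm \<dots> \<le> norm (?x * (h (p + t *\<^sub>R e) - h p)) + norm ((?x - 1) * h p)"
      by (rule order_trans[OF norm_triangle_ineq4]) simp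
    also have "norm (?x * (h (p + t *\<^sub>R e) - h p)) \<le> \<eta> / 4"
      unfolding norm_mult norm_exp_i using d1(2)[of t p] t d by simp
    also have "norm ((?x - 1) * h p) \<le> \<bar>- 2 * pi * \<beta> * t\<bar> * M"
      unfolding norm_mult by (intro mult_mono norm_exp_i_minus_one_le M) auto
    also have "\<dots> = \<bar>t\<bar> * L" by (simp add: L_def abs_mult)
    also have "\<dots> \<le> \<delta> * L" using t L by (intro mult_right_mono) auto
    finally show ?thesis using dL by simp
  qed
  \<comment> \<open>The kernel is at least \<open>b ^ (2 * N)\<close> on an interval of length
    \<delta> and at most \<open>a ^ (2 * N)\<close> beyond distance \<delta> from 0; the ratio of
    the two tends to zero geometrically.\<close>
  define a b where "a = cos (pi * \<delta>)" and "b = cos (pi * (\<delta> / 2))"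
  have ad: "pi * \<delta> \<le> pi / 4" using d(3) by simp
  have pd: "0 < pi * \<delta>" using d(1) by simp
  have a0: "a \<ge> 0" unfolding a_def by (rule cos_ge_zero) (use pd ad pi_gt_zero in linarith)+
  have ab: "a < b" unfolding a_def b_def by (rule cos_monotone_0_pi) (use pd ad pi_gt_zero in linarith)+
  define r where "r = (a / b)\<^sup>2"
  have r: "0 \<le> r" "r < 1"
  proof -
    have "0 \<le> a / b" "a / b < 1" using a0 ab by auto
    then show "0 \<le> r" "r < 1" by (auto simp: r_def power_less_one_iff abs_square_less_1)
  qed
  have "(\<lambda>N. r ^ N * (2 * M / \<delta>)) \<longlonglongrightarrow> 0 * (2 * M / \<delta>)"
    by (intro tendsto_mult tendsto_const LIMSEQ_realpow_zero r)
  then have "\<forall>\<^sub>F N in sequentially. r ^ N * (2 * M / \<delta>) < \<eta> / 2"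
    using \<eta> by (intro order_tendstoD(2)) auto
  then obtain N where N: "r ^ N * (2 * M / \<delta>) < \<eta> / 2" by (auto simp: eventually_sequentially)
  define K where "K t = cos (pi * t) ^ (2 * N)" for t
  have Kc: "continuous_on S K" for S unfolding K_def by (intro continuous_intros)
  have K0: "K t \<ge> 0" for t unfolding K_def by (simp add: power_mult)
  have Ki: "K integrable_on {x..y}" for x y by (rule integrable_continuous_real[OF Kc])
  define I where "I = integral {-1/2..1/2} K"
  have Ilow: "\<delta> * b ^ (2 * N) \<le> I"
  proof -
    have "\<delta> * b ^ (2 * N) = integral {-\<delta>/2..\<delta>/2} (\<lambda>t. b ^ (2 * N))" using d(1) by simp
    also have "\<dots> \<le> integral {-\<delta>/2..\<delta>/2} K"
    proof (rule integral_le)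
      fix t assume t: "t \<in> {-\<delta>/2..\<delta>/2}"
      have "b \<le> cos (pi * \<bar>t\<bar>)"
        unfolding b_def using t d ad by (intro cos_monotone_0_pi_le) (auto simp: abs_le_iff)
      also have "cos (pi * \<bar>t\<bar>) = cos (pi * t)" by (cases "t \<ge> 0") auto
      finally show "b ^ (2 * N) \<le> K t" unfolding K_def using a0 ab by (intro power_mono) auto
    qed (auto intro: Ki)
    also have "\<dots> \<le> I" unfolding I_def using d K0 by (intro integral_subset_le Ki) auto
    finally show ?thesis .
  qed
  have b0: "b > 0" using a0 ab by simp
  have I0: "I > 0" using Ilow d(1) b0 by (smt (verit) mult_pos_pos zero_less_power)
  have Ku: "(\<lambda>t. of_real (K t) * u p t) integrable_on {-1/2..1/2}" for p
    by (intro integrable_continuous_real continuous_intros Kc uc)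
  have main: "norm (of_real I * h p - integral {-1/2..1/2} (\<lambda>t. of_real (K t) * u p t)) \<le> \<eta> * I" for p
  proof -
    have Kh: "((\<lambda>t. of_real (K t) * h p) has_integral of_real I * h p) {-1/2..1/2}"
      unfolding I_def by (intro has_integral_mult_left has_integral_of_real integrable_integral Ki)
    have D: "((\<lambda>t. of_real (K t) * h p - of_real (K t) * u p t) has_integral
       (of_real I * h p - integral {-1/2..1/2} (\<lambda>t. of_real (K t) * u p t))) {-1/2..1/2}"
      by (intro has_integral_diff Kh integrable_integral Ku)
    have "norm (integral {-1/2..1/2} (\<lambda>t. of_real (K t) * h p - of_real (K t) * u p t))
        \<le> integral {-1/2..1/2} (\<lambda>t. \<eta> / 2 * K t + 2 * M * a ^ (2 * N))"
    proof (rule integral_norm_bound_integral)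
      show "(\<lambda>t. of_real (K t) * h p - of_real (K t) * u p t) integrable_on {-1/2..1/2}" using D by blast
      show "(\<lambda>t. \<eta> / 2 * K t + 2 * M * a ^ (2 * N)) integrable_on {-1/2..1/2}"
        by (intro integrable_continuous_real continuous_intros Kc)
      fix t :: real assume t: "t \<in> {-1/2..1/2}"
      have "of_real (K t) * h p - of_real (K t) * u p t = of_real (K t) * (h p - u p t)" by (simp add: algebra_simps)
      then have n: "norm (of_real (K t) * h p - of_real (K t) * u p t) = K t * norm (h p - u p t)"
        using K0[of t] by (simp add: norm_mult)
      show "norm (of_real (K t) * h p - of_real (K t) * u p t) \<le> \<eta> / 2 * K t + 2 * M * a ^ (2 * N)"
      proof (cases "\<bar>t\<bar> \<le> \<delta>")
        case True
        have "K t * norm (h p - u p t) \<le> K t * (\<eta> / 2)" using K0 near[OF True] by (intro mult_left_mono) auto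
        moreover have "0 \<le> 2 * M * a ^ (2 * N)" using M0 a0 by simp
        ultimately show ?thesis unfolding n by (simp add: mult.commute)
      next
        case False
        have tt: "\<bar>t\<bar> \<le> 1/2" using t by auto
        have c: "cos (pi * \<bar>t\<bar>) = cos (pi * t)" by (cases "t \<ge> 0") auto
        have pt: "0 \<le> pi * \<bar>t\<bar>" "pi * \<bar>t\<bar> \<le> pi * (1/2)" "pi * \<delta> \<le> pi * \<bar>t\<bar>"
          using tt False mult_left_mono[of "\<bar>t\<bar>" "1/2" pi] mult_left_mono[of \<delta> "\<bar>t\<bar>" pi] by auto
        have "0 \<le> cos (pi * \<bar>t\<bar>)" by (rule cos_ge_zero) (use pt pi_gt_zero in linarith)+
        moreover have "cos (pi * \<bar>t\<bar>) \<le> a"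
          unfolding a_def by (rule cos_monotone_0_pi_le) (use pt pd pi_gt_zero in linarith)+
        ultimately have "K t \<le> a ^ (2 * N)" unfolding K_def c by (intro power_mono) auto
        moreover have "norm (h p - u p t) \<le> 2 * M"
          using norm_triangle_ineq4[of "h p" "u p t"] M[of p] nu[of p t] by linarith
        ultimately have "K t * norm (h p - u p t) \<le> a ^ (2 * N) * (2 * M)"
          using K0 a0 by (intro mult_mono) auto
        moreover have "0 \<le> \<eta> / 2 * K t" using \<eta> K0[of t] by simp
        ultimately show ?thesis unfolding n by (simp add: mult.commute)
      qed
    qed
    also have "integral {-1/2..1/2} (\<lambda>t. \<eta> / 2 * K t + 2 * M * a ^ (2 * N)) = \<eta> / 2 * I + 2 * M * a ^ (2 * N)"
      unfolding I_def by (subst integral_add) (auto intro!: integrable_continuous_real continuous_intros Kc)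
    also have "2 * M * a ^ (2 * N) \<le> \<eta> / 2 * I"
    proof -
      have "a = a / b * b" using b0 by simp
      then have "a ^ (2 * N) = r ^ N * b ^ (2 * N)"
        unfolding r_def by (metis power_mult power_mult_distrib)
      then have "2 * M * a ^ (2 * N) = r ^ N * (2 * M / \<delta>) * (\<delta> * b ^ (2 * N))" using d(1) by simp
      also have "\<dots> \<le> r ^ N * (2 * M / \<delta>) * I" using r M0 d Ilow by (intro mult_left_mono) auto
      also have "\<dots> \<le> \<eta> / 2 * I" using N I0 by (intro mult_right_mono) auto
      finally show ?thesis .
    qed
    finally show ?thesis unfolding integral_unique[OF D] by (simp add: mult.commute)
  qed
  let ?c = "\<lambda>j. complex_of_real (real (2 * N choose j) / 4 ^ N) / of_real I"
  let ?k = "\<lambda>j. int N - int j"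
  have Kint: "integral {-1/2..1/2} (\<lambda>t. of_real (K t) * u p t)
      = of_real I * (\<Sum>j\<le>2 * N. ?c j * mode (\<beta> + of_int (?k j)) e h p)" for p
  proof -
    have "of_real (K t) * u p t = (\<Sum>j\<le>2 * N. of_real (real (2 * N choose j) / 4 ^ N) *
        (exp (\<i> * of_real (- 2 * pi * (\<beta> + of_int (?k j)) * t)) * h (p + t *\<^sub>R e)))" for t
      unfolding K_def of_real_power cos_power_modes sum_distrib_right u_def
    proof (rule sum.cong[OF refl])
      fix j
      have e: "exp (\<i> * of_real (- 2 * pi * (\<beta> + of_int (?k j)) * t))
          = exp (\<i> * of_real (- 2 * pi * (real N - real j) * t)) * exp (\<i> * complex_of_real (- 2 * pi * \<beta> * t))"
        by (simp add: exp_add[symmetric] algebra_simps)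
      show "of_real (real (2 * N choose j) / 4 ^ N) * exp (\<i> * of_real (- 2 * pi * (real N - real j) * t)) *
          (exp (\<i> * of_real (- 2 * pi * \<beta> * t)) * h (p + t *\<^sub>R e))
        = of_real (real (2 * N choose j) / 4 ^ N) *
          (exp (\<i> * of_real (- 2 * pi * (\<beta> + of_int (?k j)) * t)) * h (p + t *\<^sub>R e))"
        unfolding e by (simp only: mult.assoc)
    qed
    then have "integral {-1/2..1/2} (\<lambda>t. of_real (K t) * u p t) = (\<Sum>j\<le>2 * N. integral {-1/2..1/2}
       (\<lambda>t. of_real (real (2 * N choose j) / 4 ^ N) * (exp (\<i> * of_real (- 2 * pi * (\<beta> + of_int (?k j)) * t)) * h (p + t *\<^sub>R e))))"
      by (simp only:) (intro integral_sum integrable_on_mult_right mode_integrable[OF eq] finite_atMost)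
    also have "\<dots> = (\<Sum>j\<le>2 * N. of_real (real (2 * N choose j) / 4 ^ N) * mode (\<beta> + of_int (?k j)) e h p)"
      unfolding mode_def by (intro sum.cong integral_mult_right) auto
    also have "\<dots> = of_real I * (\<Sum>j\<le>2 * N. ?c j * mode (\<beta> + of_int (?k j)) e h p)"
      unfolding sum_distrib_left using I0 by (intro sum.cong) auto
    finally show ?thesis .
  qed
  have "norm (h p - (\<Sum>j\<le>2 * N. ?c j * mode (\<beta> + of_int (?k j)) e h p)) \<le> \<eta>" for p
  proof -
    have "norm (of_real I * (h p - (\<Sum>j\<le>2 * N. ?c j * mode (\<beta> + of_int (?k j)) e h p))) \<le> \<eta> * I"
      using main[of p] unfolding Kint right_diff_distrib .
    then have "I * norm (h p - (\<Sum>j\<le>2 * N. ?c j * mode (\<beta> + of_int (?k j)) e h p)) \<le> I * \<eta>"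
      using I0 by (simp only: norm_mult norm_of_real abs_of_pos mult.commute)
    then show ?thesis using I0 by (rule mult_left_le_imp_le)
  qed
  then show ?thesis by (intro exI[of _ "2 * N"] exI[of _ ?c] exI[of _ ?k]) blast
qed

text \<open>The integral over a moving window of length 1 has derivative zero in the position of the
  window by periodicity. The bound \<open>B\<close> keeps all windows inside the domain of the
  antiderivative.\<close>

lemma periodic_integral_shift:
  fixes F :: "real \<Rightarrow> complex"
  assumes c: "continuous_on UNIV F" and per: "\<And>t. F (t + 1) = F t"
  shows "integral {-1/2..1/2} (\<lambda>t. F (t + r)) = integral {-1/2..1/2} F"
proof -
  define B where "B = \<bar>r\<bar> + 2"
  define \<Phi> where "\<Phi> x = integral {-B..x} F" for x
  have Fi: "F integrable_on {x..y}" for x y by (rule integrable_continuous_real[OF continuous_on_subset[OF c]]) auto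
  have comb: "integral {x - 1/2..x + 1/2} F = \<Phi> (x + 1/2) - \<Phi> (x - 1/2)" if "\<bar>x\<bar> \<le> \<bar>r\<bar>" for x
    using Henstock_Kurzweil_Integration.integral_combine[of "-B" "x - 1/2" "x + 1/2" F] Fi that
    unfolding \<Phi>_def B_def by (simp add: abs_le_iff algebra_simps)
  have der: "(\<Phi> has_vector_derivative F x) (at x)" if "\<bar>x\<bar> < B" for x
  proof -
    have "(\<Phi> has_vector_derivative F x) (at x within {-B..B})"
      unfolding \<Phi>_def using that by (intro integral_has_vector_derivative continuous_on_subset[OF c]) auto
    then show ?thesis using that by (simp add: at_within_Icc_at abs_less_iff)
  qed
  have "\<Phi> (r + 1/2) - \<Phi> (r - 1/2) = \<Phi> (0 + 1/2) - \<Phi> (0 - 1/2)"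
  proof (rule has_derivative_zero_unique[of "{-\<bar>r\<bar>..\<bar>r\<bar>}" "\<lambda>x. \<Phi> (x + 1/2) - \<Phi> (x - 1/2)"])
    fix x assume x: "x \<in> {-\<bar>r\<bar>..\<bar>r\<bar>}"
    have sh: "((\<lambda>x. \<Phi> (x + s)) has_vector_derivative F (x + s)) (at x within {-\<bar>r\<bar>..\<bar>r\<bar>})" if "\<bar>s\<bar> \<le> 1/2" for s
    proof -
      have "((\<lambda>x. x + s) has_vector_derivative 1) (at x within {-\<bar>r\<bar>..\<bar>r\<bar>})"
        by (auto intro!: derivative_eq_intros)
      moreover have "(\<Phi> has_vector_derivative F (x + s)) (at (x + s))" using x that by (intro der) (auto simp: B_def)
      ultimately show ?thesis
        using vector_diff_chain_within[of "\<lambda>x. x + s" 1 x _ \<Phi> "F (x + s)"] has_vector_derivative_at_within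
        by (force simp: o_def)
    qed
    have "F (x - 1/2) = F (x + 1/2)" using per[of "x - 1/2"] by (simp add: algebra_simps)
    with has_vector_derivative_diff[OF sh[of "1/2"] sh[of "- 1/2"]]
    have "((\<lambda>x. \<Phi> (x + 1/2) - \<Phi> (x - 1/2)) has_vector_derivative 0) (at x within {-\<bar>r\<bar>..\<bar>r\<bar>})" by simp
    then show "((\<lambda>x. \<Phi> (x + 1/2) - \<Phi> (x - 1/2)) has_derivative (\<lambda>h. 0)) (at x within {-\<bar>r\<bar>..\<bar>r\<bar>})"
      by (simp add: has_vector_derivative_def)
  qed auto
  then have "integral {r - 1/2..r + 1/2} F = integral {-1/2..1/2} F" using comb[of r] comb[of 0] by simp
  moreover have "integral {-1/2..1/2} (F \<circ> (+) r) = integral {r - 1/2..r + 1/2} F"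
    unfolding integral_shift_Icc_real by (simp add: algebra_simps)
  ultimately show ?thesis by (simp add: o_def add.commute)
qed

text \<open>Quasi-periodicity of \<open>h\<close> makes the twisted integrand \<open>F\<close>
  periodic with period 1, so translating by \<open>r\<close> only shifts the window and releases a
  phase.\<close>

lemma mode_translate:
  assumes eq: "equicontinuous_along e h" and q: "\<And>p. h (p + e) = exp (\<i> * of_real (2 * pi * \<nu>)) * h p"
  shows "mode \<nu> e h (p + r *\<^sub>R e) = exp (\<i> * of_real (2 * pi * \<nu> * r)) * mode \<nu> e h p"
proof -
  define F where "F t = exp (\<i> * of_real (- 2 * pi * \<nu> * t)) * h (p + t *\<^sub>R e)" for t
  have Fc: "continuous_on UNIV F" unfolding F_def by (rule mode_integrand_continuous[OF eq])
  have Fp: "F (t + 1) = F t" for t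
  proof -
    have 1: "h (p + (t + 1) *\<^sub>R e) = exp (\<i> * of_real (2 * pi * \<nu>)) * h (p + t *\<^sub>R e)"
      using q[of "p + t *\<^sub>R e"] by (simp add: algebra_simps)
    have 2: "exp (\<i> * of_real (- 2 * pi * \<nu> * (t + 1))) * exp (\<i> * of_real (2 * pi * \<nu>)) = exp (\<i> * complex_of_real (- 2 * pi * \<nu> * t))"
      by (simp add: exp_add[symmetric] algebra_simps)
    show ?thesis unfolding F_def 1 mult.assoc[symmetric] 2 ..
  qed
  have "exp (\<i> * of_real (- 2 * pi * \<nu> * t)) * h (p + r *\<^sub>R e + t *\<^sub>R e) = exp (\<i> * of_real (2 * pi * \<nu> * r)) * F (t + r)" for t
  proof -
    have 1: "exp (\<i> * complex_of_real (2 * pi * \<nu> * r)) * exp (\<i> * of_real (- 2 * pi * \<nu> * (t + r))) = exp (\<i> * of_real (- 2 * pi * \<nu> * t))"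
      by (simp add: exp_add[symmetric] algebra_simps)
    have 2: "p + r *\<^sub>R e + t *\<^sub>R e = p + (t + r) *\<^sub>R e" by (simp add: algebra_simps)
    show ?thesis unfolding F_def 2 mult.assoc[symmetric] 1 ..
  qed
  then have "mode \<nu> e h (p + r *\<^sub>R e) = exp (\<i> * of_real (2 * pi * \<nu> * r)) * integral {-1/2..1/2} (\<lambda>t. F (t + r))"
    unfolding mode_def by (simp only: integral_mult_right)
  also have "integral {-1/2..1/2} (\<lambda>t. F (t + r)) = mode \<nu> e h p"
    unfolding periodic_integral_shift[OF Fc Fp] unfolding F_def[abs_def] mode_def by (rule refl)
  finally show ?thesis .
qed

text \<open>Translations commute, so taking the mode in one direction keeps the behaviour of
  \<open>h\<close> in the others. This is what lets the directions be treated one after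
  another.\<close>

lemma mode_homogeneous:
  assumes "\<And>p. h (p + v) = c * h p"
  shows "mode \<nu> e h (p + v) = c * mode \<nu> e h p"
proof -
  have "h (p + v + t *\<^sub>R e) = c * h (p + t *\<^sub>R e)" for t
    using assms[of "p + t *\<^sub>R e"] by (simp add: algebra_simps)
  then show ?thesis unfolding mode_def by (simp only: mult.left_commute[of _ c] integral_mult_right)
qed

lemma mode_bound:
  assumes "equicontinuous_along e h" and M: "\<And>p. norm (h p) \<le> M"
  shows "norm (mode \<nu> e h p) \<le> M"
  unfolding mode_def
proof (rule norm_integral_Icc_le[OF mode_integrable[OF assms(1)]])
  show "norm (exp (\<i> * complex_of_real (- 2 * pi * \<nu> * t)) * h (p + t *\<^sub>R e)) \<le> M" for t
    unfolding norm_mult norm_exp_i using M by simp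
  show "M \<ge> 0" using order_trans[OF norm_ge_zero M] .
qed

lemma uniformly_continuous_equicontinuous:
  fixes h :: "'a::real_normed_vector \<Rightarrow> complex"
  assumes u: "uniformly_continuous_on UNIV h"
  shows "equicontinuous_along e h"
  unfolding equicontinuous_along_def
proof (intro allI impI)
  fix \<epsilon> :: real assume "\<epsilon> > 0"
  then obtain d where d: "d > 0" "\<And>p q. dist q p < d \<Longrightarrow> dist (h q) (h p) < \<epsilon>"
    by (rule uniformly_continuous_onE[OF u]) simp
  have "norm (h (p + t *\<^sub>R e) - h p) \<le> \<epsilon>" if "\<bar>t\<bar> < d / (norm e + 1)" for p t
  proof -
    have "\<bar>t\<bar> * norm e \<le> d / (norm e + 1) * norm e" using that by (intro mult_right_mono) auto
    have "\<bar>t\<bar> * (norm e + 1) < d" using that by (simp add: pos_less_divide_eq add_nonneg_pos)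
    then have "\<bar>t\<bar> * norm e < d" by (simp add: algebra_simps)
    then have "dist (p + t *\<^sub>R e) p < d" by (simp add: dist_norm)
    then show ?thesis using d(2)[of "p + t *\<^sub>R e" p] by (simp add: dist_norm less_imp_le)
  qed
  then show "\<exists>\<delta>>0. \<forall>p t. \<bar>t\<bar> < \<delta> \<longrightarrow> norm (h (p + t *\<^sub>R e) - h p) \<le> \<epsilon>"
    using d(1) by (intro exI[of _ "d / (norm e + 1)"]) (auto intro!: divide_pos_pos add_nonneg_pos)
qed

lemma mode_uniformly_continuous:
  fixes h :: "'a::real_normed_vector \<Rightarrow> complex"
  assumes u: "uniformly_continuous_on UNIV h"
  shows "uniformly_continuous_on UNIV (mode \<nu> e h)"
  unfolding uniformly_continuous_on_def
proof (intro allI impI)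
  fix \<epsilon> :: real assume e: "\<epsilon> > 0"
  then obtain d where d: "d > 0" "\<And>p q. dist q p < d \<Longrightarrow> dist (h q) (h p) < \<epsilon> / 2"
    by (rule uniformly_continuous_onE[OF u half_gt_zero]) simp
  note eq = uniformly_continuous_equicontinuous[OF u, of e]
  have "dist (mode \<nu> e h q) (mode \<nu> e h p) < \<epsilon>" if "dist q p < d" for p q
  proof -
    have "mode \<nu> e h q - mode \<nu> e h p = integral {-1/2..1/2} (\<lambda>t. exp (\<i> * of_real (- 2 * pi * \<nu> * t)) * h (q + t *\<^sub>R e)
       - exp (\<i> * of_real (- 2 * pi * \<nu> * t)) * h (p + t *\<^sub>R e))"
      unfolding mode_def by (rule Henstock_Kurzweil_Integration.integral_diff[symmetric]) (rule mode_integrable[OF eq])+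
    also have "norm \<dots> \<le> \<epsilon> / 2"
    proof (rule norm_integral_Icc_le)
      show "(\<lambda>t. exp (\<i> * of_real (- 2 * pi * \<nu> * t)) * h (q + t *\<^sub>R e)
       - exp (\<i> * of_real (- 2 * pi * \<nu> * t)) * h (p + t *\<^sub>R e)) integrable_on {- 1 / 2..1 / 2}"
        by (intro integrable_diff mode_integrable[OF eq])
      fix t
      have "dist (h (q + t *\<^sub>R e)) (h (p + t *\<^sub>R e)) < \<epsilon> / 2" using that by (intro d(2)) (simp add: dist_norm)
      then show "norm (exp (\<i> * of_real (- 2 * pi * \<nu> * t)) * h (q + t *\<^sub>R e)
       - exp (\<i> * of_real (- 2 * pi * \<nu> * t)) * h (p + t *\<^sub>R e)) \<le> \<epsilon> / 2"
        unfolding right_diff_distrib[symmetric] norm_mult norm_exp_i by (simp add: dist_norm)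
    qed (use e in simp)
    finally show ?thesis using e by (simp add: dist_norm)
  qed
  then show "\<exists>d>0. \<forall>x\<in>UNIV. \<forall>x'\<in>UNIV. dist x' x < d \<longrightarrow> dist (mode \<nu> e h x') (mode \<nu> e h x) < \<epsilon>"
    using d(1) by blast
qed

section \<open>Density of the range\<close>

context sub_dirac
begin

subsection \<open>Joint eigenfunctions of the left-invariant frame\<close>

text \<open>When \<open>R1\<close> and \<open>R2\<close> vanish at \<xi>, the shear fixes the
  frequency and this is a unitary character of the whole group.\<close>

definition chr :: "real^4 \<Rightarrow> real \<Rightarrow> grp \<Rightarrow> complex" where
  "chr \<xi> \<nu> p = exp (\<i> * of_real (2 * pi * (inner \<xi> (fst p) + \<nu> * snd p)))"

lemma chr_frechet:
  "(chr \<xi> \<nu> has_derivative (\<lambda>h. 2 * pi * \<i> * of_real (inner \<xi> (fst h) + \<nu> * snd h) * chr \<xi> \<nu> p)) (at p)"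
  "frechet_derivative (chr \<xi> \<nu>) (at p) h = 2 * pi * \<i> * of_real (inner \<xi> (fst h) + \<nu> * snd h) * chr \<xi> \<nu> p"
proof -
  define Q where "Q p = \<i> * complex_of_real (2 * pi * (inner \<xi> (fst p) + \<nu> * snd p))" for p :: grp
  have "(Q has_derivative (\<lambda>h. \<i> * complex_of_real (2 * pi * (inner \<xi> (fst h) + \<nu> * snd h)))) (at p)"
    unfolding Q_def by (rule has_derivative_eq_rhs, (rule derivative_intros)+) (simp add: fun_eq_iff)
  from has_derivative_compose[OF this has_field_derivative_imp_has_derivative[OF DERIV_exp]]
  have "((\<lambda>q. exp (Q q)) has_derivative (\<lambda>h. exp (Q p) * (\<i> * complex_of_real (2 * pi * (inner \<xi> (fst h) + \<nu> * snd h))))) (at p)" .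
  then show D: "(chr \<xi> \<nu> has_derivative (\<lambda>h. 2 * pi * \<i> * of_real (inner \<xi> (fst h) + \<nu> * snd h) * chr \<xi> \<nu> p)) (at p)"
    unfolding chr_def[abs_def] Q_def by (rule has_derivative_eq_rhs) (simp add: fun_eq_iff algebra_simps)
  show "frechet_derivative (chr \<xi> \<nu>) (at p) h = 2 * pi * \<i> * of_real (inner \<xi> (fst h) + \<nu> * snd h) * chr \<xi> \<nu> p"
    by (rule fun_cong[OF frechet_derivative_at[OF D, symmetric]])
qed

lemma smooth_chr: "smooth (chr \<xi> \<nu>)"
proof -
  have d: "chr \<xi> \<nu> differentiable_on UNIV"
    unfolding differentiable_on_def differentiable_def
    using has_derivative_at_withinI[OF chr_frechet(1)] by blast
  have "Ck n (chr \<xi> \<nu>)" for n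
  proof (induction n)
    case 0
    show ?case using differentiable_imp_continuous_on[OF d] by simp
  next
    case (Suc n)
    then have "Ck n (\<lambda>p. frechet_derivative (chr \<xi> \<nu>) (at p) h)" for h
      unfolding chr_frechet(2) by (intro Ck_mult Ck_const)
    then show ?case using d by simp
  qed
  then show ?thesis by (simp add: smooth_def)
qed

lemma sgc_axis:
  assumes "\<nu> = of_int k + of_int (\<epsilon> (v, t)) / 2"
  shows "sgc (v, t) = exp (\<i> * of_real (2 * pi * \<nu>))"
proof -
  have "\<i> * complex_of_real (2 * pi * \<nu>) = of_int k * (of_real (2 * pi) * \<i>) + \<i> * of_real pi * of_int (\<epsilon> (v, t))"
    by (simp add: assms algebra_simps)
  then have "exp (\<i> * complex_of_real (2 * pi * \<nu>)) = exp (of_int k * (of_real (2 * pi) * \<i>)) * sgc (v, t)"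
    by (simp only: exp_add sgc_def)
  also have "exp (of_int k * (complex_of_real (2 * pi) * \<i>)) = 1"
    using exp_integer_2pi[of "of_int k"] by (simp add: mult_ac)
  finally show ?thesis by simp
qed

lemma chi_exp:
  assumes "\<nu> = of_int k + of_int (\<epsilon> (0, 1)) / 2"
  shows "chi m = exp (\<i> * of_real (2 * pi * \<nu> * of_int m))"
proof -
  have "2 * pi * \<nu> * of_int m = 2 * pi * of_int (k * m) + pi * of_int (\<epsilon> (0, 1)) * of_int m"
    by (simp add: assms algebra_simps)
  then have "cis (2 * pi * \<nu> * of_int m) = cis (2 * pi * of_int (k * m)) * chi m"
    by (simp only: cis_mult[symmetric] chi_def)
  also have "cis (2 * pi * of_int (k * m)) = 1" by (rule cis_multiple_2pi) simp
  finally show ?thesis by (simp add: cis_conv_exp)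
qed

text \<open>Left-invariant fields multiply a group character by constants, so the algebraic
  inversion of \<open>good_joint_eigenfunction\<close> applies; the conditions on \<xi> and \<nu>
  are equivariance under the two kinds of lattice generators.\<close>

lemma good_chr:
  assumes a: "admissible \<xi>" and r: "R1 \<xi> = 0" "R2 \<xi> = 0" and \<nu>: "\<nu> = of_int k + of_int (\<epsilon> (0, 1)) / 2"
    and z: "Im z \<noteq> 0"
  shows "good z (chr \<xi> \<nu>)"
proof (rule good_joint_eigenfunction[OF smooth_chr _ z])
  show "equivariant (shear r1 r2) \<epsilon> (chr \<xi> \<nu>)"
    unfolding equivariant_iff
  proof (intro ballI allI)
    fix \<gamma> p assume g: "\<gamma> \<in> lattice"
    obtain m t where mt: "\<gamma> = (m, t)" by (cases \<gamma>)
    then have m: "\<forall>i. m $ i \<in> \<int>" and "t \<in> \<int>" using g by (auto simp: lattice_def)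
    then obtain j :: int where j: "t = of_int j" by (auto elim: Ints_cases)
    have "sgc \<gamma> = sgc (m, 0) * chi j"
      using sgc_mult[OF translation_lattice[OF m] b_in_lattice[of j]] by (simp add: gmul_def shear_0 mt j sgc_b)
    also have "\<dots> = exp (\<i> * of_real (2 * pi * inner \<xi> m)) * exp (\<i> * of_real (2 * pi * \<nu> * t))"
      unfolding sgc_translation[OF a m] chi_exp[OF \<nu>] cis_conv_exp j ..
    finally have s: "sgc \<gamma> = exp (\<i> * of_real (2 * pi * inner \<xi> m)) * exp (\<i> * of_real (2 * pi * \<nu> * t))" .
    have "inner \<xi> (fst (\<gamma> \<odot> p)) = inner \<xi> m + inner \<xi> (fst p)"
      by (simp add: gmul_def mt inner_add_right inner_shear kap_def r)
    then show "chr \<xi> \<nu> (\<gamma> \<odot> p) = sgc \<gamma> * chr \<xi> \<nu> p"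
      unfolding s chr_def by (simp add: exp_add[symmetric] algebra_simps) (simp add: gmul_def mt algebra_simps)
  qed
  have i: "inner \<xi> (axis 3 1 + (of_int r1 * s) *\<^sub>R axis 1 1) = \<xi> $ 3" "inner \<xi> (axis 4 1 + (of_int r2 * s) *\<^sub>R axis 2 1) = \<xi> $ 4" for s
    using r by (simp_all add: inner_add_right inner_axis R1_def R2_def algebra_simps)
  show "deriv_along (E i) (chr \<xi> \<nu>) p = 2 * pi * \<i> * of_real (if i = 1 then \<xi> $ 3 else if i = 2 then \<xi> $ 4 else \<nu>) * chr \<xi> \<nu> p" for i p
    using exhaust_3[of i]
    by (elim disjE) (simp_all only: deriv_along_def chr_frechet(2) frame_values fst_conv snd_conv i three_neq if_True if_False simp_thms, simp_all)
qed

lemma bounded_support_weighted: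
  assumes "\<And>p. norm (h p) \<le> M" "\<And>p. \<bar>snd p\<bar> > B \<Longrightarrow> h p = 0"
  shows "weighted ((1 + B\<^sup>2) * M) h"
  unfolding weighted_def
proof
  fix p :: grp
  have M: "M \<ge> 0" using order_trans[OF norm_ge_zero assms(1)] .
  show "norm (h p) \<le> ((1 + B\<^sup>2) * M) / (1 + (snd p)\<^sup>2)"
  proof (cases "\<bar>snd p\<bar> \<le> B")
    case True
    then have "(snd p)\<^sup>2 \<le> B\<^sup>2" by (simp add: abs_le_square_iff[symmetric])
    then have "M * (1 + (snd p)\<^sup>2) \<le> (1 + B\<^sup>2) * M" using M by (simp add: mult.commute mult_left_mono)
    then have "M \<le> ((1 + B\<^sup>2) * M) / (1 + (snd p)\<^sup>2)" by (simp add: pos_le_divide_eq add_pos_nonneg)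
    then show ?thesis using assms(1)[of p] by linarith
  qed (use assms(2)[of p] M in simp)
qed

text \<open>The shear does not affect \<xi>, so the periodised function is a fixed character in the
  abelian variables and quasi-periodic in the direction of \<open>b\<close>. Its Fourier modes in
  that direction are multiples of group characters.\<close>

lemma good_profile_compact_degenerate:
  assumes a: "admissible \<xi>" and rho: "rho \<xi> = 0" and z: "Im z \<noteq> 0"
    and f: "uniformly_continuous_on UNIV f" and supp: "\<And>s. \<bar>s\<bar> > 1 \<Longrightarrow> f s = 0" and M: "\<And>s. norm (f s) \<le> M"
  shows "good z (periodise (profile \<xi> f))"
proof (rule good_closed)
  have R: "R1 \<xi> = 0" "R2 \<xi> = 0" using rho by (auto simp: rho_def sum_power2_eq_zero_iff)
  have k: "kap \<xi> v = 0" for v by (simp add: kap_def R)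
  define \<Phi> where "\<Phi> = periodise (profile \<xi> f)"
  have w: "weighted ((1 + 1\<^sup>2) * M) (profile \<xi> f)"
    by (rule bounded_support_weighted) (simp_all add: norm_profile M, simp add: profile_def supp)
  have hom: "\<Phi> (p + (x, 0)) = exp (\<i> * of_real (2 * pi * inner \<xi> x)) * \<Phi> p" for p x
  proof -
    have "profile \<xi> f (bpow (- n) (p + (x, 0))) = exp (\<i> * of_real (2 * pi * inner \<xi> x)) * profile \<xi> f (bpow (- n) p)" for n
      unfolding profile_def bpow_def fst_conv snd_conv inner_shear k
      by (simp add: inner_add_right exp_add[symmetric] algebra_simps)
    then show ?thesis unfolding \<Phi>_def periodise_def infsum_cmult_right'[symmetric] by (simp add: mult_ac)
  qed
  have eq: "equicontinuous_along (0, 1) \<Phi>"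
    unfolding equicontinuous_along_def
  proof (intro allI impI)
    fix \<eta> :: real assume e: "\<eta> > 0"
    \<comment> \<open>The 20 is 4 from the periodisation bound times \<open>1 + 2\<^sup>2\<close>: a
      shift by less than 1 enlarges the support from \<open>[-1, 1]\<close> to
      \<open>[-2, 2]\<close>.\<close>
    define \<eta>' where "\<eta>' = \<eta> / (20 * weight_sum + 1)"
    have e': "\<eta>' > 0" unfolding \<eta>'_def using e weight_sum_nonneg by (intro divide_pos_pos) auto
    obtain d where d: "d > 0" "\<And>s t. dist t s < d \<Longrightarrow> dist (f t) (f s) < \<eta>'"
      by (rule uniformly_continuous_onE[OF f e']) simp
    have "norm (\<Phi> (p + t *\<^sub>R (0, 1)) - \<Phi> p) \<le> \<eta>" if t: "\<bar>t\<bar> < min d 1" for p t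
    proof -
      let ?h = "\<lambda>q. profile \<xi> f (q + t *\<^sub>R (0, 1))"
      have b: "bpow (- n) (p + t *\<^sub>R (0, 1)) = bpow (- n) p + t *\<^sub>R (0, 1)" for n by (simp add: bpow_def prod_eq_iff)
      have ndiff: "norm (?h q - profile \<xi> f q) = norm (f (snd q + t) - f (snd q))" for q
      proof -
        have "?h q - profile \<xi> f q = profile \<xi> (\<lambda>s. f (s + t) - f s) q" by (simp add: profile_def algebra_simps)
        then show ?thesis by (simp add: norm_profile)
      qed
      have wd: "weighted ((1 + 2\<^sup>2) * \<eta>') (\<lambda>q. ?h q - profile \<xi> f q)"
      proof (rule bounded_support_weighted)
        fix q :: grp
        show "norm (?h q - profile \<xi> f q) \<le> \<eta>'"
          unfolding ndiff using d(2)[of "snd q + t" "snd q"] t by (simp add: dist_norm)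
        assume "\<bar>snd q\<bar> > 2"
        then have "\<bar>snd q + t\<bar> > 1" "\<bar>snd q\<bar> > 1" using t by linarith+
        then have "norm (?h q - profile \<xi> f q) = 0" unfolding ndiff by (simp add: supp)
        then show "?h q - profile \<xi> f q = 0" by simp
      qed
      have wh: "weighted ((1 + 2\<^sup>2) * M) ?h"
      proof (rule bounded_support_weighted)
        fix q :: grp
        show "norm (?h q) \<le> M" by (simp add: norm_profile M)
        assume "\<bar>snd q\<bar> > 2"
        then have "\<bar>snd q + t\<bar> > 1" using t by linarith
        then show "?h q = 0" by (simp add: profile_def supp)
      qed
      have "periodise (\<lambda>q. ?h q + (-1) * profile \<xi> f q) p = periodise ?h p + (-1) * periodise (profile \<xi> f) p"
        using periodise_add[OF wh weighted_cmult[OF w, of "-1"], of p] periodise_cmult[of "-1" "profile \<xi> f" p] by simp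
      moreover have "\<Phi> (p + t *\<^sub>R (0, 1)) = periodise ?h p" unfolding \<Phi>_def periodise_def b ..
      ultimately have "\<Phi> (p + t *\<^sub>R (0, 1)) - \<Phi> p = periodise (\<lambda>q. ?h q - profile \<xi> f q) p" by (simp add: \<Phi>_def)
      also have "norm \<dots> \<le> 4 * weight_sum * ((1 + 2\<^sup>2) * \<eta>')" by (rule periodise_summable(2)[OF wd])
      also have "\<dots> = \<eta>' * (20 * weight_sum)" by simp
      also have "\<dots> \<le> \<eta>" unfolding \<eta>'_def using e weight_sum_nonneg by (intro divide_add1_mult_le) auto
      finally show ?thesis .
    qed
    then show "\<exists>\<delta>>0. \<forall>p t. \<bar>t\<bar> < \<delta> \<longrightarrow> norm (\<Phi> (p + t *\<^sub>R (0, 1)) - \<Phi> p) \<le> \<eta>"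
      using d(1) by (intro exI[of _ "min d 1"]) auto
  qed
  have bd: "norm (\<Phi> p) \<le> 4 * weight_sum * ((1 + 1\<^sup>2) * M)" for p unfolding \<Phi>_def by (rule periodise_summable(2)[OF w])
  have per: "\<Phi> (p + (0, 1)) = chi 1 * \<Phi> p" for p
  proof -
    have e: "\<Phi> ((0, 1) \<odot> p) = sgc (0, 1) * \<Phi> p"
      using profile_equivariant[OF a, of f] b_in_lattice[of 1] unfolding equivariant_iff \<Phi>_def by (simp del: split_paired_All)
    have "(0, 1) \<odot> p = (p + (0, 1)) + (shear r1 r2 1 *v fst p - fst p, 0)" by (simp add: gmul_def prod_eq_iff)
    then have "\<Phi> ((0, 1) \<odot> p) = exp (\<i> * of_real (2 * pi * inner \<xi> (shear r1 r2 1 *v fst p - fst p))) * \<Phi> (p + (0, 1))"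
      by (simp only: hom)
    also have "inner \<xi> (shear r1 r2 1 *v fst p - fst p) = 0" by (simp add: inner_diff_right inner_shear k)
    finally show ?thesis using e sgc_b[of 1] by simp
  qed
  fix \<delta> :: real assume d: "\<delta> > 0"
  define \<beta> where "\<beta> = real_of_int (\<epsilon> (0, 1)) / 2"
  obtain n :: nat and c and kk :: "nat \<Rightarrow> int" where ap: "\<forall>p. norm (\<Phi> p - (\<Sum>j\<le>n. c j * mode (\<beta> + of_int (kk j)) (0, 1) \<Phi> p)) \<le> \<delta>"
    using mode_approximation[OF bd eq d, of \<beta>] by blast
  have "good z (mode (\<beta> + of_int (kk j)) (0, 1) \<Phi>)" for j
  proof -
    define \<nu> where "\<nu> = \<beta> + of_int (kk j)"
    have \<nu>: "\<nu> = of_int (kk j) + of_int (\<epsilon> (0, 1)) / 2" by (simp add: \<nu>_def \<beta>_def)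
    have c1: "\<Phi> (p + (0, 1)) = exp (\<i> * of_real (2 * pi * \<nu>)) * \<Phi> p" for p
      using per[of p] chi_exp[OF \<nu>, of 1] by simp
    have "mode \<nu> (0, 1) \<Phi> p = mode \<nu> (0, 1) \<Phi> 0 * chr \<xi> \<nu> p" for p
    proof -
      have p: "p = (0 + snd p *\<^sub>R (0, 1)) + (fst p, 0)" by (simp add: prod_eq_iff)
      have "mode \<nu> (0, 1) \<Phi> p = exp (\<i> * of_real (2 * pi * inner \<xi> (fst p))) * (exp (\<i> * of_real (2 * pi * \<nu> * snd p)) * mode \<nu> (0, 1) \<Phi> 0)"
        by (subst p) (simp only: mode_homogeneous[of \<Phi> "(fst p, 0)", OF hom] mode_translate[OF eq c1])
      then show ?thesis by (simp add: chr_def exp_add algebra_simps)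
    qed
    then have eqm: "mode \<nu> (0, 1) \<Phi> = (\<lambda>p. mode \<nu> (0, 1) \<Phi> 0 * chr \<xi> \<nu> p)" by (rule ext)
    have gm: "good z (\<lambda>p. mode \<nu> (0, 1) \<Phi> 0 * chr \<xi> \<nu> p)" by (intro good_cmult good_chr[OF a R \<nu> z])
    show ?thesis unfolding \<nu>_def[symmetric] by (rule iffD2[OF arg_cong[OF eqm, of "good z"] gm])
  qed
  then have "good z (\<lambda>p. \<Sum>j\<le>n. c j * mode (\<beta> + of_int (kk j)) (0, 1) \<Phi> p)" by (intro good_sum) auto
  then show "\<exists>\<psi>. good z \<psi> \<and> (\<forall>p. norm (\<psi> p - periodise (profile \<xi> f) p) \<le> \<delta>)"
    using ap unfolding \<Phi>_def[symmetric]
    by (intro exI[of _ "\<lambda>p. \<Sum>j\<le>n. c j * mode (\<beta> + of_int (kk j)) (0, 1) \<Phi> p"]) (simp only: norm_minus_commute[of _ "\<Phi> _"] simp_thms)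
qed

subsection \<open>Fourier decomposition in the abelian directions\<close>

text \<open>\<open>J\<close> collects the abelian directions in which \<open>h\<close> is already a
  pure exponential, with frequencies recorded in \<xi>; the other entries of \<xi> are arbitrary.
  The remaining clauses make \<open>h\<close> periodisable and are preserved by taking
  modes.\<close>

definition fourier_class :: "4 set \<Rightarrow> real^4 \<Rightarrow> (grp \<Rightarrow> complex) \<Rightarrow> bool" where
  "fourier_class J \<xi> h \<longleftrightarrow> uniformly_continuous_on UNIV h \<and> (\<exists>M. \<forall>p. norm (h p) \<le> M) \<and>
     (\<forall>p. \<bar>snd p\<bar> > 1 \<longrightarrow> h p = 0) \<and> (\<forall>i p. h (p + (axis i 1, 0)) = sgc (axis i 1, 0) * h p) \<and>
     (\<forall>i\<in>J. (\<exists>k::int. \<xi> $ i = of_int k + of_int (\<epsilon> (axis i 1, 0)) / 2) \<and>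
        (\<forall>p r. h (p + r *\<^sub>R (axis i 1, 0)) = exp (\<i> * of_real (2 * pi * \<xi> $ i * r)) * h p))"

text \<open>Once all four directions are resolved, \<open>h\<close> is a character times its
  restriction \<open>f\<close> to the \<open>b\<close>-axis, and the profile results apply, split
  according to whether \<open>rho\<close> vanishes.\<close>

lemma fourier_class_full:
  assumes Q: "fourier_class UNIV \<xi> h" and z: "Im z \<noteq> 0"
  shows "good z (periodise h)"
proof -
  define f where "f s = h (0, s)" for s
  have a: "admissible \<xi>" using Q by (simp add: fourier_class_def admissible_def)
  have t: "h (p + r *\<^sub>R (axis i 1, 0)) = exp (\<i> * of_real (2 * pi * \<xi> $ i * r)) * h p" for i p r
    using Q unfolding fourier_class_def by blast
  have "h p = profile \<xi> f p" for p
  proof -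
    let ?x = "fst p"
    have p: "p = ((((0, snd p) + ?x $ 1 *\<^sub>R (axis 1 1, 0)) + ?x $ 2 *\<^sub>R (axis 2 1, 0)) + ?x $ 3 *\<^sub>R (axis 3 1, 0)) + ?x $ 4 *\<^sub>R (axis 4 1, 0)"
      by (simp add: prod_eq_iff vec_eq_iff forall_4 axis_def)
    have "h p = exp (\<i> * of_real (2 * pi * \<xi> $ 4 * ?x $ 4)) * (exp (\<i> * of_real (2 * pi * \<xi> $ 3 * ?x $ 3)) *
      (exp (\<i> * of_real (2 * pi * \<xi> $ 2 * ?x $ 2)) * (exp (\<i> * of_real (2 * pi * \<xi> $ 1 * ?x $ 1)) * f (snd p))))"
      unfolding f_def by (subst p) (simp only: t)
    also have "\<dots> = profile \<xi> f p"
    proof -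
      have "\<i> * complex_of_real (2 * pi * inner \<xi> ?x) = \<i> * of_real (2 * pi * \<xi> $ 4 * ?x $ 4) + \<i> * of_real (2 * pi * \<xi> $ 3 * ?x $ 3)
         + \<i> * of_real (2 * pi * \<xi> $ 2 * ?x $ 2) + \<i> * of_real (2 * pi * \<xi> $ 1 * ?x $ 1)"
        by (simp add: inner_vec_def sum_4 algebra_simps)
      then show ?thesis unfolding profile_def by (simp only: exp_add mult.assoc)
    qed
    finally show ?thesis .
  qed
  then have hp: "h = profile \<xi> f" by (rule ext)
  have uh: "uniformly_continuous_on UNIV h" using Q unfolding fourier_class_def by (rule conjunct1)
  have uc: "uniformly_continuous_on UNIV f"
    unfolding uniformly_continuous_on_def
  proof (intro allI impI)
    fix e :: real assume "e > 0"
    then obtain d where d: "d > 0" "\<And>p q. dist q p < d \<Longrightarrow> dist (h q) (h p) < e"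
      by (rule uniformly_continuous_onE[OF uh]) simp
    have "dist (f t) (f s) < e" if "dist t s < d" for s t
      unfolding f_def using that by (intro d(2)) (simp add: dist_Pair_Pair)
    then show "\<exists>d>0. \<forall>x\<in>UNIV. \<forall>x'\<in>UNIV. dist x' x < d \<longrightarrow> dist (f x') (f x) < e" using d(1) by blast
  qed
  have supp: "\<And>s. \<bar>s\<bar> > 1 \<Longrightarrow> f s = 0" using Q by (simp add: fourier_class_def f_def)
  obtain M where M: "\<And>p. norm (h p) \<le> M" using Q unfolding fourier_class_def by blast
  show ?thesis
  proof (cases "rho \<xi> > 0")
    case True
    have "good_profile z \<xi> f"
      by (rule good_profile_compact[OF a True z uniformly_continuous_imp_continuous[OF uc] supp])
    then show ?thesis by (simp add: good_profile_def hp)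
  next
    case False
    moreover have "rho \<xi> \<ge> 0" unfolding rho_def by (intro real_sqrt_ge_zero) simp
    ultimately have r0: "rho \<xi> = 0" by linarith
    have fM: "norm (f s) \<le> M" for s by (simp add: f_def M)
    show ?thesis unfolding hp by (rule good_profile_compact_degenerate[OF a r0 z uc supp fM])
  qed
qed

text \<open>The weight is part of the claim because additivity of \<open>periodise\<close> in the
  induction step requires one for the partial sum.\<close>

lemma periodise_sum:
  assumes "finite I" "\<And>i. i \<in> I \<Longrightarrow> \<exists>M. weighted M (h i)"
  shows "(\<exists>M. weighted M (\<lambda>p. \<Sum>i\<in>I. c i * h i p)) \<and>
    periodise (\<lambda>p. \<Sum>i\<in>I. c i * h i p) = (\<lambda>p. \<Sum>i\<in>I. c i * periodise (h i) p)"
  using assms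
proof (induction I rule: finite_induct)
  case empty
  show ?case by (auto simp: weighted_def periodise_def[abs_def] intro!: exI[of _ 0])
next
  case (insert i I)
  then obtain M N where M: "weighted M (\<lambda>p. \<Sum>i\<in>I. c i * h i p)" and N: "weighted N (h i)" by blast
  have IH: "periodise (\<lambda>p. \<Sum>i\<in>I. c i * h i p) = (\<lambda>p. \<Sum>i\<in>I. c i * periodise (h i) p)" using insert by blast
  have "weighted (norm (c i) * N + M) (\<lambda>p. \<Sum>i\<in>insert i I. c i * h i p)"
    using weighted_add[OF weighted_cmult[OF N, of "c i"] M] insert.hyps by simp
  moreover have "periodise (\<lambda>p. \<Sum>i\<in>insert i I. c i * h i p) p = (\<Sum>i\<in>insert i I. c i * periodise (h i) p)" for p
    using periodise_add[OF weighted_cmult[OF N, of "c i"] M, of p] insert.hyps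
    by (simp add: IH periodise_cmult)
  ultimately show ?case by blast
qed

text \<open>Replace \<open>h\<close> uniformly by finitely many modes in direction \<open>i\<close>.
  They are supported in the same slab, so the error remains uniform after periodisation.\<close>

lemma fourier_class_step:
  assumes step: "\<And>\<xi> h. fourier_class (insert i J) \<xi> h \<Longrightarrow> good z (periodise h)" and i: "i \<notin> J"
    and Q: "fourier_class J \<xi> h"
  shows "good z (periodise h)"
proof (rule good_closed)
  let ?e = "(axis i 1, 0) :: grp"
  have uc: "uniformly_continuous_on UNIV h" and supp: "\<And>p. \<bar>snd p\<bar> > 1 \<Longrightarrow> h p = 0"
    and per: "\<And>i p. h (p + (axis i 1, 0)) = sgc (axis i 1, 0) * h p"
    using Q unfolding fourier_class_def by blast+
  obtain M where M: "\<And>p. norm (h p) \<le> M" using Q unfolding fourier_class_def by blast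
  note eq = uniformly_continuous_equicontinuous[OF uc, of ?e]
  fix \<delta> :: real assume d: "\<delta> > 0"
  \<comment> \<open>The 8 is 4 from the periodisation bound times \<open>1 + 1\<^sup>2\<close> from
    the support in \<open>[-1, 1]\<close>.\<close>
  define \<eta> where "\<eta> = \<delta> / (8 * weight_sum + 1)"
  have e: "\<eta> > 0" unfolding \<eta>_def using d weight_sum_nonneg by (intro divide_pos_pos) auto
  define \<beta> where "\<beta> = real_of_int (\<epsilon> ?e) / 2"
  obtain n :: nat and c and k :: "nat \<Rightarrow> int" where ap: "\<forall>p. norm (h p - (\<Sum>j\<le>n. c j * mode (\<beta> + of_int (k j)) ?e h p)) \<le> \<eta>"
    using mode_approximation[OF M eq e, of \<beta>] by blast
  define m where "m j = mode (\<beta> + of_int (k j)) ?e h" for j :: nat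
  have msupp: "m j p = 0" if "\<bar>snd p\<bar> > 1" for j p
  proof -
    have "h (p + t *\<^sub>R ?e) = 0" for t using that by (intro supp) simp
    then show ?thesis by (simp add: m_def mode_def)
  qed
  have mM: "norm (m j p) \<le> M" for j p unfolding m_def by (rule mode_bound[OF eq M])
  have Qm: "fourier_class (insert i J) (\<chi> l. if l = i then \<beta> + of_int (k j) else \<xi> $ l) (m j)" for j
    unfolding fourier_class_def
  proof (intro conjI allI ballI impI)
    show "uniformly_continuous_on UNIV (m j)" unfolding m_def by (rule mode_uniformly_continuous[OF uc])
    show "\<exists>M. \<forall>p. norm (m j p) \<le> M" using mM by blast
    show "m j p = 0" if "\<bar>snd p\<bar> > 1" for p using that by (rule msupp)
    show "m j (p + (axis l 1, 0)) = sgc (axis l 1, 0) * m j p" for l p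
      unfolding m_def by (rule mode_homogeneous[of h "(axis l 1, 0)" "sgc (axis l 1, 0)", OF per])
    fix l assume l: "l \<in> insert i J"
    show "\<exists>k'::int. (\<chi> l. if l = i then \<beta> + of_int (k j) else \<xi> $ l) $ l = of_int k' + of_int (\<epsilon> (axis l 1, 0)) / 2"
      using l Q by (cases "l = i") (auto simp: \<beta>_def fourier_class_def intro!: exI[of _ "k j"])
    fix p r
    show "m j (p + r *\<^sub>R (axis l 1, 0)) = exp (\<i> * of_real (2 * pi * (\<chi> l. if l = i then \<beta> + of_int (k j) else \<xi> $ l) $ l * r)) * m j p"
    proof (cases "l = i")
      case True
      have "sgc ?e = exp (\<i> * of_real (2 * pi * (\<beta> + of_int (k j))))" by (rule sgc_axis[of _ "k j"]) (simp add: \<beta>_def)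
      then have "h (p + ?e) = exp (\<i> * of_real (2 * pi * (\<beta> + of_int (k j)))) * h p" for p using per[of p i] by simp
      from mode_translate[OF eq this, of p r] show ?thesis using True by (simp add: m_def)
    next
      case False
      then have "h (p + r *\<^sub>R (axis l 1, 0)) = exp (\<i> * of_real (2 * pi * \<xi> $ l * r)) * h p" for p
        using l Q unfolding fourier_class_def by blast
      from mode_homogeneous[of h "r *\<^sub>R (axis l 1, 0)" "exp (\<i> * of_real (2 * pi * \<xi> $ l * r))", OF this, of _ ?e p] show ?thesis using False by (simp add: m_def)
    qed
  qed
  have gm: "good z (periodise (m j))" for j by (rule step[OF Qm])
  have w: "weighted ((1 + 1\<^sup>2) * M) (m j)" for j by (rule bounded_support_weighted[OF mM msupp])
  have wh: "weighted ((1 + 1\<^sup>2) * M) h" by (rule bounded_support_weighted[OF M supp])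
  have S: "(\<exists>M. weighted M (\<lambda>p. \<Sum>j\<le>n. c j * m j p)) \<and>
    periodise (\<lambda>p. \<Sum>j\<le>n. c j * m j p) = (\<lambda>p. \<Sum>j\<le>n. c j * periodise (m j) p)"
    by (rule periodise_sum) (use w in auto)
  then obtain N where N: "weighted N (\<lambda>p. \<Sum>j\<le>n. c j * m j p)" by blast
  have "norm ((\<Sum>j\<le>n. c j * periodise (m j) p) - periodise h p) \<le> \<delta>" for p
  proof -
    have "(\<Sum>j\<le>n. c j * periodise (m j) p) - periodise h p = periodise (\<lambda>p. (\<Sum>j\<le>n. c j * m j p) - h p) p"
      using periodise_add[OF N weighted_cmult[OF wh, of "-1"], of p] periodise_cmult[of "-1" h p] S by simp
    also have "norm \<dots> \<le> 4 * weight_sum * ((1 + 1\<^sup>2) * \<eta>)"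
      by (rule periodise_summable(2), rule bounded_support_weighted)
         (use ap in \<open>auto simp: m_def[symmetric] norm_minus_commute msupp supp\<close>)
    also have "\<dots> = \<eta> * (8 * weight_sum)" by simp
    also have "\<dots> \<le> \<delta>" unfolding \<eta>_def using d weight_sum_nonneg by (intro divide_add1_mult_le) auto
    finally show ?thesis .
  qed
  then show "\<exists>\<psi>. good z \<psi> \<and> (\<forall>p. norm (\<psi> p - periodise h p) \<le> \<delta>)"
    using good_sum[of "{..n}" z "\<lambda>j. periodise (m j)" c] gm by blast
qed

lemma fourier_class_good:
  assumes Q: "fourier_class {} \<xi> h" and z: "Im z \<noteq> 0"
  shows "good z (periodise h)"
proof -
  have U: "insert 1 {2, 3, 4} = (UNIV :: 4 set)" using UNIV_4 by auto
  have 1: "good z (periodise h)" if "fourier_class {2, 3, 4} \<xi> h" for \<xi> h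
    using fourier_class_step[of 1 "{2, 3, 4}", OF _ _ that] fourier_class_full[OF _ z] unfolding U by simp
  have 2: "good z (periodise h)" if "fourier_class {3, 4} \<xi> h" for \<xi> h
    using fourier_class_step[of 2 "{3, 4}", OF 1 _ that] by simp
  have 3: "good z (periodise h)" if "fourier_class {4} \<xi> h" for \<xi> h
    using fourier_class_step[of 3 "{4}", OF 2 _ that] by simp
  show ?thesis using fourier_class_step[of 4 "{}", OF 3 _ Q] by simp
qed

subsection \<open>Continuous equivariant functions\<close>

definition tent :: "real \<Rightarrow> real" where "tent s = max 0 (1 - \<bar>s\<bar>)"

lemma tent_sum: "(\<Sum>\<^sub>\<infinity>n::int. of_real (tent (s - of_int n))) = (1 :: complex)"
proof -
  let ?k = "\<lfloor>s\<rfloor>"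
  have 0: "tent (s - of_int n) = 0" if "n \<notin> {?k, ?k + 1}" for n
  proof -
    have "n \<le> ?k - 1 \<or> n \<ge> ?k + 2" using that by auto
    then have "\<bar>s - of_int n\<bar> \<ge> 1"
    proof
      assume "n \<le> ?k - 1"
      then have "real_of_int n \<le> of_int ?k - 1" by linarith
      then show ?thesis by linarith
    next
      assume "n \<ge> ?k + 2"
      then have "real_of_int n \<ge> of_int ?k + 2" by linarith
      then show ?thesis by linarith
    qed
    then show ?thesis by (simp add: tent_def)
  qed
  have "(\<Sum>\<^sub>\<infinity>n::int. complex_of_real (tent (s - of_int n))) = (\<Sum>\<^sub>\<infinity>n\<in>{?k, ?k + 1}. of_real (tent (s - of_int n)))"
    by (rule infsum_cong_neutral) (use 0 in auto)
  also have "\<dots> = of_real (tent (s - of_int ?k) + tent (s - of_int (?k + 1)))" by simp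
  also have "tent (s - of_int ?k) + tent (s - of_int (?k + 1)) = 1"
  proof -
    have "tent (s - of_int ?k) = 1 - (s - of_int ?k)" unfolding tent_def by linarith
    moreover have "tent (s - of_int (?k + 1)) = s - of_int ?k" unfolding tent_def of_int_add of_int_1 by linarith
    ultimately show ?thesis by simp
  qed
  finally show ?thesis by simp
qed

text \<open>The cut-off of \<phi> by \<open>tent\<close> is equivariant only under integral
  translations but compactly supported in the last variable. Periodising it returns \<phi>, because
  \<phi> is already equivariant under \<open>b\<close> and the translated tents add up to 1.\<close>

lemma good_continuous_equivariant:
  assumes c: "continuous_on UNIV \<phi>" and e: "equivariant (shear r1 r2) \<epsilon> \<phi>" and z: "Im z \<noteq> 0"
  shows "good z \<phi>"
proof -
  define h where "h p = of_real (tent (snd p)) * \<phi> p" for p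
  have eq: "\<phi> (\<gamma> \<odot> p) = sgc \<gamma> * \<phi> p" if "\<gamma> \<in> lattice" for \<gamma> p
    using e that unfolding equivariant_iff by blast
  have trans: "\<phi> (p + (m, 0)) = sgc (m, 0) * \<phi> p" if "\<forall>i. m $ i \<in> \<int>" for m p
  proof -
    have "(m, 0) \<odot> p = p + (m, 0)" by (simp add: gmul_def shear_0 prod_eq_iff)
    then show ?thesis using eq[OF translation_lattice[OF that], of p] by simp
  qed
  have htrans: "h (p + (m, 0)) = sgc (m, 0) * h p" if "\<forall>i. m $ i \<in> \<int>" for m p
    using trans[OF that, of p] by (simp add: h_def)
  have supp: "h p = 0" if "\<bar>snd p\<bar> > 1" for p using that by (simp add: h_def tent_def)
  have hc: "continuous_on UNIV h" unfolding h_def tent_def by (intro continuous_intros c)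
  \<comment> \<open>The box \<open>[0, 1]\<close> to the fourth power times \<open>[-2, 2]\<close>,
    enlarged by 1 on each side so that it also contains points at distance less than 1. Integral
    translations are plain additions, hence isometries, and bring every relevant point here.\<close>
  let ?K = "cbox ((\<chi> i. -1, -3) :: grp) (\<chi> i. 2, 3)"
  have K: "p \<in> ?K \<longleftrightarrow> (\<forall>i. -1 \<le> fst p $ i \<and> fst p $ i \<le> 2) \<and> -3 \<le> snd p \<and> snd p \<le> 3" for p
    by (cases p) (auto simp: cbox_Pair_eq mem_box_cart)
  have red: "\<exists>m. (\<forall>i. m $ i \<in> \<int>) \<and> (\<forall>i. 0 \<le> (fst p - m) $ i \<and> (fst p - m) $ i \<le> 1)" for p :: grp
    by (rule exI[of _ "\<chi> i. of_int \<lfloor>fst p $ i\<rfloor>"]) (auto, linarith)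
  have ucK: "uniformly_continuous_on ?K h"
    by (intro compact_uniformly_continuous continuous_on_subset[OF hc]) auto
  have hred: "h p = sgc (m, 0) * h (p - (m, 0))" if "\<forall>i. m $ i \<in> \<int>" for m p
    using htrans[OF that, of "p - (m, 0)"] by simp
  have uc: "uniformly_continuous_on UNIV h"
    unfolding uniformly_continuous_on_def
  proof (intro allI impI)
    fix \<eta> :: real assume eta: "\<eta> > 0"
    obtain d where d: "d > 0" "\<And>x x'. x \<in> ?K \<Longrightarrow> x' \<in> ?K \<Longrightarrow> dist x' x < d \<Longrightarrow> dist (h x') (h x) < \<eta>"
      by (rule uniformly_continuous_onE[OF ucK eta]) blast
    have "dist (h q) (h p) < \<eta>" if D: "dist q p < min d 1" for p q
    proof (cases "\<bar>snd p\<bar> > 2")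
      case True
      have "\<bar>snd q - snd p\<bar> < 1" using D dist_snd_le[of q p] by (simp add: dist_real_def)
      then have "h q = 0" "h p = 0" using True by (auto intro!: supp)
      then show ?thesis using eta by simp
    next
      case False
      obtain m where m: "\<forall>i. m $ i \<in> \<int>" "\<And>i. 0 \<le> (fst p - m) $ i" "\<And>i. (fst p - m) $ i \<le> 1" using red[of p] by blast
      have s: "\<bar>snd q - snd p\<bar> < 1" using D dist_snd_le[of q p] by (simp add: dist_real_def)
      have f: "\<bar>fst q $ i - fst p $ i\<bar> < 1" for i
      proof -
        have "\<bar>(fst q - fst p) $ i\<bar> \<le> dist (fst q) (fst p)" unfolding dist_norm by (rule component_le_norm_cart)
        also have "\<dots> < 1" using D dist_fst_le[of q p] by simp
        finally show ?thesis by simp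
      qed
      have pK: "p - (m, 0) \<in> ?K" unfolding K using m(2,3) False by (auto simp: abs_le_iff intro: order_trans) (smt (verit) vector_minus_component)+
      have qK: "q - (m, 0) \<in> ?K" unfolding K
      proof (intro conjI allI)
        fix i
        show "-1 \<le> fst (q - (m, 0)) $ i" "fst (q - (m, 0)) $ i \<le> 2" using f[of i] m(2)[of i] m(3)[of i] by (auto simp: abs_less_iff)
        show "-3 \<le> snd (q - (m, 0))" "snd (q - (m, 0)) \<le> 3" using s False by auto
      qed
      have "dist (h q) (h p) = dist (h (q - (m, 0))) (h (p - (m, 0)))"
        unfolding hred[OF m(1), of p] hred[OF m(1), of q] dist_norm right_diff_distrib[symmetric] norm_mult by simp
      also have "\<dots> < \<eta>" using D by (intro d(2) pK qK) (simp add: dist_norm)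
      finally show ?thesis .
    qed
    then show "\<exists>d>0. \<forall>x\<in>UNIV. \<forall>x'\<in>UNIV. dist x' x < d \<longrightarrow> dist (h x') (h x) < \<eta>"
      using d(1) by (intro exI[of _ "min d 1"]) auto
  qed
  have "compact (h ` ?K)" by (intro compact_continuous_image continuous_on_subset[OF hc]) auto
  then obtain M where M: "\<And>p. p \<in> ?K \<Longrightarrow> norm (h p) \<le> M"
    using compact_imp_bounded bounded_iff by (metis imageI)
  have M': "norm (h p) \<le> max M 0" for p
  proof (cases "\<bar>snd p\<bar> > 2")
    case False
    obtain m where m: "\<forall>i. m $ i \<in> \<int>" "\<And>i. 0 \<le> (fst p - m) $ i" "\<And>i. (fst p - m) $ i \<le> 1" using red[of p] by blast
    have pK: "p - (m, 0) \<in> ?K" unfolding K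
    proof (intro conjI allI)
      fix i
      show "-1 \<le> fst (p - (m, 0)) $ i" "fst (p - (m, 0)) $ i \<le> 2" using m(2)[of i] m(3)[of i] by auto
      show "-3 \<le> snd (p - (m, 0))" "snd (p - (m, 0)) \<le> 3" using False by auto
    qed
    show ?thesis unfolding hred[OF m(1), of p] norm_mult using M[OF pK] by simp
  qed (use supp[of p] in simp)
  have "fourier_class {} 0 h"
    unfolding fourier_class_def
  proof (intro conjI allI ballI impI)
    show "\<exists>M. \<forall>p. norm (h p) \<le> M" using M' by blast
    show "h (p + (axis i 1, 0)) = sgc (axis i 1, 0) * h p" for i p
      by (rule htrans) (simp add: axis_def)
  qed (use uc supp in blast)+
  then have "good z (periodise h)" by (rule fourier_class_good[OF _ z])
  moreover have "periodise h p = \<phi> p" for p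
  proof -
    have "chi n * h (bpow (- n) p) = of_real (tent (snd p - of_int n)) * \<phi> p" for n
    proof -
      have "\<phi> (bpow (- n) p) = chi (- n) * \<phi> p"
        unfolding bpow_gmul using eq[OF b_in_lattice[of "- n"]] sgc_b[of "- n"] by simp
      moreover have "chi n * chi (- n) = 1" using chi_add[of n "- n"] by (simp add: chi_def)
      ultimately show ?thesis by (simp add: h_def bpow_def)
    qed
    then have "periodise h p = (\<Sum>\<^sub>\<infinity>n::int. of_real (tent (snd p - of_int n)) * \<phi> p)" by (simp add: periodise_def)
    also have "\<dots> = (\<Sum>\<^sub>\<infinity>n::int. of_real (tent (snd p - of_int n))) * \<phi> p" by (rule infsum_cmult_left')
    finally show ?thesis by (simp add: tent_sum)
  qed
  ultimately show ?thesis by (simp add: good_def tensor_def[abs_def])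
qed

lemma nonreal_in_resolvent:
  assumes z: "Im z \<noteq> 0"
  shows "z \<in> resolvent_set SL2 (dirac_closure (shear r1 r2) g nab \<epsilon>)"
  unfolding dirac_closure_def
proof (rule resolvent_criterion[where C="1 / (Im z)\<^sup>2"])
  show "(\<lambda>p. \<psi> p - \<phi> p) \<in> SS" if "\<psi> \<in> SS" "\<phi> \<in> SS" for \<psi> \<phi>
    using SS_add_cmult[OF that, of "-1"] by simp
  show "Dop (\<lambda>p. \<psi> p - \<phi> p) p = Dop \<psi> p - Dop \<phi> p" if "\<psi> \<in> SS" "\<phi> \<in> SS" for \<psi> \<phi> p
    using dirac_add_cmult[OF that, of "-1"] by simp
  show "\<exists>\<psi>\<in>SS. \<forall>p. norm (Dop \<psi> p - z *s \<psi> p - w p) \<le> \<delta>"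
    if w: "continuous_on UNIV w" "spinor_equivariant w" and d: "\<delta> > 0" for w \<delta>
  proof -
    have "good z (\<lambda>p. w p $ a)" for a
      using w by (intro good_continuous_equivariant continuous_intros z) (auto simp: spinor_equivariant_iff)
    then have "tensor (\<lambda>p. w p $ a) (axis a 1) \<in> approx_range z" for a unfolding good_def by blast
    from approx_range_add_cmult[OF this[of 1] this[of 2], of 1]
    have "(\<lambda>p. tensor (\<lambda>p. w p $ 1) (axis 1 1) p + 1 *s tensor (\<lambda>p. w p $ 2) (axis 2 1) p) \<in> approx_range z" .
    moreover have "(\<lambda>p. tensor (\<lambda>p. w p $ 1) (axis 1 1) p + 1 *s tensor (\<lambda>p. w p $ 2) (axis 2 1) p) = w"
      by (simp add: tensor_def fun_eq_iff vec_eq_iff forall_2 axis_def)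
    ultimately have "w \<in> approx_range z" by simp
    from approx_rangeE[OF this d] show ?thesis unfolding Wop_def by metis
  qed
qed (use z in \<open>auto intro: smooth_continuous SS_smooth continuous_dirac SS_equivariant dirac_symmetric_bound\<close>)

end

section \<open>Eigenvalues\<close>

lemma ae_eq_zero_continuous:
  fixes u :: "grp \<Rightarrow> 'b::real_normed_vector"
  assumes c: "continuous_on UNIV u" and ae: "ae_eq u (\<lambda>p. 0)"
  shows "u p = 0"
proof (rule ccontr)
  assume nz: "u p \<noteq> 0"
  have op: "open {p. u p \<noteq> 0}"
    by (rule open_Collect_neq[OF c continuous_on_const])
  then obtain r where r: "r > 0" "ball p r \<subseteq> {p. u p \<noteq> 0}" using nz open_contains_ball by blast
  have "emeasure lborel {p. u p \<noteq> 0} = 0"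
    using ae op unfolding ae_eq_def by (subst (asm) AE_iff_measurable[of "{p. u p \<noteq> 0}"]) auto
  then have "emeasure lborel (ball p r) = 0"
    using emeasure_mono[OF r(2), of lborel] op by simp
  then show False using content_ball_pos[OF r(1), of p] by (simp add: measure_def)
qed

context sub_dirac
begin

abbreviation "Dbar \<equiv> dirac_closure (shear r1 r2) g nab \<epsilon>"

lemma SS_in_SL2: "\<psi> \<in> SS \<Longrightarrow> \<psi> \<in> SL2"
  by (intro continuous_in_SL2 smooth_continuous SS_smooth SS_equivariant)

lemma smooth_eigenvector:
  assumes p: "\<psi> \<in> SS" and D: "\<And>p. Dop \<psi> p = z *s \<psi> p"
  shows "\<psi> \<in> eigenspace Dbar z"
proof -
  have "(\<lambda>p. \<psi> p + (z - 1) *s \<psi> p) \<in> SL2" by (intro SS_in_SL2 SS_add_cmult p)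
  moreover have "(\<lambda>p. \<psi> p + (z - 1) *s \<psi> p) = (\<lambda>p. z *s \<psi> p)"
    by (simp add: fun_eq_iff vec_eq_iff algebra_simps)
  ultimately have z: "(\<lambda>p. z *s \<psi> p) \<in> SL2" by simp
  have "Dop \<psi> = (\<lambda>p. z *s \<psi> p)" using D by (rule ext)
  then show ?thesis
    using p z SS_in_SL2[OF p] l2_tendsto_const
    by (auto simp: eigenspace_def dirac_closure_def intro!: exI[of _ "\<lambda>n. \<psi>"])
qed

section \<open>Ground states: nonvanishing and linear independence\<close>

definition ground :: "real^4 \<Rightarrow> spinor" where "ground \<xi> = tensor (th \<xi> 0) (ev \<xi>)"

definition level :: "real^4 \<Rightarrow> real" where "level \<xi> = al + 2 * pi * bb \<xi>"

lemma ground_SS: "admissible \<xi> \<Longrightarrow> rho \<xi> > 0 \<Longrightarrow> ground \<xi> \<in> SS"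
  unfolding ground_def by (rule tensor_th_SS)

lemma ground_eigenvector:
  assumes "admissible \<xi>" "rho \<xi> > 0"
  shows "ground \<xi> \<in> eigenspace Dbar (of_real (level \<xi>))"
proof (rule smooth_eigenvector[OF ground_SS[OF assms]])
  show "Dop (ground \<xi>) p = of_real (level \<xi>) *s ground \<xi> p" for p
    using dirac_th(1)[OF assms(2), of 0 p] by (simp add: ground_def level_def)
qed

text \<open>The point \<open>x\<close> is chosen so that the phase acquired from the shear undoes
  \<open>chi n\<close>. All terms of the series then share the phase \<open>c\<close>, and the sum
  of the positive Gaussian values \<open>G n\<close> cannot vanish.\<close>

lemma th_nonzero:
  assumes r: "rho \<xi> > 0"
  shows "\<exists>p. th \<xi> 0 p \<noteq> 0"
proof -
  define q where "q = real_of_int (\<epsilon> (0, 1)) / 2 / (rho \<xi>)\<^sup>2"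
  define x where "x = (q * R1 \<xi>) *\<^sub>R axis 3 1 + (q * R2 \<xi>) *\<^sub>R (axis 4 1 :: real^4)"
  have "kap \<xi> x = q * ((R1 \<xi>)\<^sup>2 + (R2 \<xi>)\<^sup>2)" by (simp add: kap_def x_def axis_def power2_eq_square algebra_simps)
  also have "\<dots> = real_of_int (\<epsilon> (0, 1)) / 2" using r by (simp add: q_def flip: rho_nz)
  finally have k: "kap \<xi> x = real_of_int (\<epsilon> (0, 1)) / 2" .
  define G where "G n = exp (- pi * rho \<xi> * (cc \<xi> - of_int n)\<^sup>2)" for n :: int
  define c where "c = exp (\<i> * complex_of_real (2 * pi * inner \<xi> x))"
  have t: "chi n * profile \<xi> (gaussp \<xi> 0) (bpow (- n) (x, 0)) = c * of_real (G n)" for n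
  proof -
    have "chi n * exp (\<i> * complex_of_real (2 * pi * (inner \<xi> x + of_int (- n) * kap \<xi> x))) = c"
      unfolding chi_def c_def cis_conv_exp k by (simp add: exp_add[symmetric] algebra_simps)
    moreover have "gaussp \<xi> 0 (0 + of_int (- n)) = of_real (G n)"
      by (simp add: gaussp_def G_def exp_of_real[symmetric] power2_commute algebra_simps)
    ultimately show ?thesis unfolding profile_def bpow_def fst_conv snd_conv inner_shear by (simp add: mult.assoc[symmetric])
  qed
  obtain M where M: "weighted M (profile \<xi> (gaussp \<xi> 0))" using gaussp_weighted[OF r] by blast
  have "(\<lambda>n. norm (c * of_real (G n))) summable_on UNIV"
    using periodise_summable(1)[OF M, of "(x, 0)"] unfolding t .
  moreover have "norm (c * of_real (G n)) = G n" for n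
    unfolding norm_mult c_def norm_exp_i by (simp add: G_def)
  ultimately have sG: "G summable_on UNIV" by simp
  have "th \<xi> 0 (x, 0) = (\<Sum>\<^sub>\<infinity>n. c * of_real (G n))" unfolding th_def periodise_def t ..
  also have "\<dots> = c * (\<Sum>\<^sub>\<infinity>n. of_real (G n))" by (rule infsum_cmult_right')
  also have "(\<Sum>\<^sub>\<infinity>n. complex_of_real (G n)) = of_real (\<Sum>\<^sub>\<infinity>n. G n)" 
    by (rule infsumI[OF has_sum_bounded_linear[OF bounded_linear_of_real has_sum_infsum[OF sG]]])
  finally have eq: "th \<xi> 0 (x, 0) = c * of_real (\<Sum>\<^sub>\<infinity>n. G n)" .
  have "sum G {0} \<le> (\<Sum>\<^sub>\<infinity>n. G n)"
    by (rule finite_sum_le_infsum[OF sG]) (auto simp: G_def)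
  moreover have "G 0 > 0" by (simp add: G_def)
  ultimately have "(\<Sum>\<^sub>\<infinity>n. G n) \<noteq> 0" by simp
  then have "th \<xi> 0 (x, 0) \<noteq> 0" unfolding eq by (simp add: c_def)
  then show ?thesis by blast
qed

lemma ground_not_ae_zero:
  assumes a: "admissible \<xi>" and r: "rho \<xi> > 0"
  shows "\<not> ae_eq (ground \<xi>) (\<lambda>p. 0)"
proof
  assume "ae_eq (ground \<xi>) (\<lambda>p. 0)"
  then have "ground \<xi> p = 0" for p
    by (rule ae_eq_zero_continuous[rotated]) (intro smooth_continuous SS_smooth ground_SS a r)
  then have "ground \<xi> p $ 2 = 0" for p by simp
  then show False using th_nonzero[OF r] by (simp add: ground_def tensor_def ev_def del: split_paired_Ex split_paired_All)
qed

text \<open>The directions \<open>axis 1\<close> and \<open>axis 2\<close> are central, so the phase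
  is the same in every term of the series.\<close>

lemma th_translate:
  assumes i: "i = 1 \<or> i = 2"
  shows "th \<xi> k (p + r *\<^sub>R (axis i 1, 0)) = exp (\<i> * of_real (2 * pi * (\<xi> $ i * r))) * th \<xi> k p"
proof -
  have "profile \<xi> f (bpow (- n) (p + r *\<^sub>R (axis i 1, 0))) = exp (\<i> * of_real (2 * pi * (\<xi> $ i * r))) * profile \<xi> f (bpow (- n) p)" for n f
  proof -
    have "inner \<xi> (fst (bpow (- n) (p + r *\<^sub>R (axis i 1, 0)))) = \<xi> $ i * r + inner \<xi> (fst (bpow (- n) p))"
    proof -
      have "(axis i 1 :: real^4) $ 3 = 0" "(axis i 1 :: real^4) $ 4 = 0" using i by (auto simp: axis_def)
      then show ?thesis
        unfolding bpow_def fst_conv inner_shear by (simp add: inner_add_right inner_axis kap_def algebra_simps)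
    qed
    moreover have "snd (bpow (- n) (p + r *\<^sub>R (axis i 1, 0))) = snd (bpow (- n) p)" by (simp add: bpow_def)
    ultimately show ?thesis unfolding profile_def by (simp add: exp_add[symmetric] algebra_simps)
  qed
  then show ?thesis unfolding th_def periodise_def infsum_cmult_right'[symmetric] by (simp add: mult_ac)
qed

text \<open>Translation along the central direction \<open>e\<^sub>i\<close> separates ground states with different frequencies:
  a linear relation becomes a polynomial vanishing on the unit circle.\<close>

lemma ground_independent:
  fixes \<xi> :: "nat \<Rightarrow> real^4"
  assumes a: "\<And>j. admissible (\<xi> j)" and r: "\<And>j. rho (\<xi> j) > 0"
    and i: "i = 1 \<or> i = 2" and fr: "\<And>j. \<xi> j $ i = s * real j + b" and s: "s = 1 \<or> s = -1"
    and z: "ae_eq (\<lambda>p. \<Sum>j<n. c j *s ground (\<xi> j) p) (\<lambda>p. 0)" and j: "j < n"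
  shows "c j = 0"
proof -
  have cont: "continuous_on UNIV (\<lambda>p. \<Sum>j<n. c j *s ground (\<xi> j) p)"
    by (intro continuous_intros smooth_continuous SS_smooth ground_SS a r)
  have zero: "(\<Sum>j<n. c j * th (\<xi> j) 0 p) = 0" for p
  proof -
    have "(\<Sum>j<n. c j *s ground (\<xi> j) p) $ 2 = 0" using ae_eq_zero_continuous[OF cont z, of p] by simp
    then show ?thesis by (simp add: ground_def tensor_def ev_def)
  qed
  obtain p where p: "th (\<xi> j) 0 p \<noteq> 0" using th_nonzero[OF r] by blast
  \<comment> \<open>Evaluating at the chosen \<open>p\<close> makes the relation scalar with
    \<open>d j\<close> a nonzero multiple of \<open>c j\<close>; the value 0 at \<open>l = n\<close>
    pads the sum to the index range of a polynomial of degree \<open>n\<close>.\<close>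
  define d where "d l = (if l < n then c l * th (\<xi> l) 0 p else 0)" for l
  have root: "(\<Sum>l\<le>n. d l * w ^ l) = 0" if w: "norm w = 1" for w
  proof -
    have "w = exp (\<i> * of_real (Arg2pi w))" using w complex_norm_eq_1_exp[of w] by simp
    then obtain t where t: "w = exp (\<i> * of_real t)" by blast
    \<comment> \<open>Translation by \<open>q\<close> turns the frequency
      \<open>s * real l + b\<close> into the power \<open>w ^ l\<close> times a phase independent of
      \<open>l\<close>; the sign \<open>s\<close> cancels since \<open>s * s = 1\<close>.\<close>
    define q where "q = s * t / (2 * pi)"
    have th: "th (\<xi> l) 0 (p + q *\<^sub>R (axis i 1, 0)) = exp (\<i> * of_real (s * t * b)) * (w ^ l * th (\<xi> l) 0 p)" for l
    proof -
      have ss: "s * s = 1" using s by auto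
      have "2 * pi * (\<xi> l $ i * q) = s * t * b + real l * t"
        by (simp add: fr q_def field_simps) (simp add: ss)
      then have "exp (\<i> * of_real (2 * pi * (\<xi> l $ i * q))) = exp (\<i> * of_real (s * t * b)) * exp (of_nat l * (\<i> * of_real t))"
        by (simp add: exp_add[symmetric] algebra_simps)
      then show ?thesis unfolding th_translate[OF i] t exp_of_nat_mult by (simp add: mult.assoc)
    qed
    have "0 = exp (\<i> * of_real (s * t * b)) * (\<Sum>l<n. d l * w ^ l)"
      using zero[of "p + q *\<^sub>R (axis i 1, 0)"] unfolding th sum_distrib_left d_def by (simp add: mult_ac)
    then have "(\<Sum>l<n. d l * w ^ l) = 0" by simp
    moreover have "(\<Sum>l\<le>n. d l * w ^ l) = (\<Sum>l<n. d l * w ^ l)"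
      by (simp add: lessThan_Suc_atMost[symmetric] d_def)
    ultimately show ?thesis by simp
  qed
  have "infinite {w :: complex. norm w = 1}"
  proof
    assume "finite {w :: complex. norm w = 1}"
    then have "finite (sphere (0 :: complex) 1)" by (simp add: sphere_def)
    moreover have "connected (sphere (0 :: complex) 1)" by (rule connected_sphere) simp
    ultimately have "sphere (0 :: complex) 1 = {} \<or> (\<exists>a. sphere (0 :: complex) 1 = {a})"
      using connected_finite_iff_sing by blast
    moreover have "1 \<in> sphere (0 :: complex) 1" "-1 \<in> sphere (0 :: complex) 1" by simp_all
    ultimately have "(1 :: complex) = -1" by (metis empty_iff singletonD)
    then show False by simp
  qed
  then have "infinite {w. (\<Sum>l\<le>n. d l * w ^ l) = 0}"
    using root by (auto elim!: infinite_super[rotated])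
  then have "\<forall>l\<le>n. d l = 0" using polyfun_finite_roots[of d n] by blast
  then have "d j = 0" using j by simp
  then show ?thesis using p j by (simp add: d_def)
qed

text \<open>Ground states at one common level whose frequencies form an arithmetic progression in a
  central direction are independent, so every finite number of them fits into the
  eigenspace.\<close>

lemma infinite_multiplicity:
  fixes \<xi> :: "nat \<Rightarrow> real^4"
  assumes a: "\<And>j. admissible (\<xi> j)" and r: "\<And>j. rho (\<xi> j) > 0"
    and i: "i = 1 \<or> i = 2" and fr: "\<And>j. \<xi> j $ i = s * real j + b" and s: "s = 1 \<or> s = -1"
    and lev: "\<And>j. level (\<xi> j) = lv"
  shows "eigenvalue Dbar (of_real lv) \<and> eigen_multiplicity Dbar (of_real lv) = \<infinity>"
proof
  have es: "ground (\<xi> j) \<in> eigenspace Dbar (of_real lv)" for j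
    using ground_eigenvector[OF a r, of j] by (simp add: lev)
  show "eigenvalue Dbar (of_real lv)"
    unfolding eigenvalue_def using es[of 0] ground_not_ae_zero[OF a r, of 0] by blast
  have ge: "enat n \<le> eigen_multiplicity Dbar (of_real lv)" for n
  proof -
    let ?B = "(\<lambda>j. ground (\<xi> j)) ` {..<n}"
    have inj: "inj_on (\<lambda>j. ground (\<xi> j)) {..<n}"
    proof (rule inj_onI, rule ccontr)
      fix j l assume jl: "j \<in> {..<n}" "l \<in> {..<n}" "ground (\<xi> j) = ground (\<xi> l)" "j \<noteq> l"
      \<comment> \<open>Two equal ground states would satisfy the linear relation with coefficients
        1 and -1.\<close>
      define c :: "nat \<Rightarrow> complex" where "c m = (if m = j then 1 else if m = l then -1 else 0)" for m
      have "(\<Sum>m<n. c m *s ground (\<xi> m) p) = 0" for p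
      proof -
        have "(\<Sum>m<n. c m *s ground (\<xi> m) p) = (\<Sum>m\<in>{j, l}. c m *s ground (\<xi> m) p)"
          by (rule sum.mono_neutral_right) (use jl in \<open>auto simp: c_def\<close>)
        also have "\<dots> = 0" using jl by (simp add: c_def vec_eq_iff)
        finally show ?thesis .
      qed
      then have "ae_eq (\<lambda>p. \<Sum>m<n. c m *s ground (\<xi> m) p) (\<lambda>p. 0)" by (simp add: ae_eq_def)
      from ground_independent[OF a r i fr s this, of j] jl show False by (simp add: c_def)
    qed
    have "ae_independent ?B"
      unfolding ae_independent_def
    proof (intro allI impI ballI)
      fix c b assume z: "ae_eq (\<lambda>p. \<Sum>b\<in>?B. c b *s b p) (\<lambda>p. 0)" and b: "b \<in> ?B"
      have "ae_eq (\<lambda>p. \<Sum>j<n. c (ground (\<xi> j)) *s ground (\<xi> j) p) (\<lambda>p. 0)"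
        using z by (simp add: sum.reindex[OF inj] o_def)
      from ground_independent[OF a r i fr s this] b show "c b = 0" by auto
    qed
    then have "?B \<in> {B. finite B \<and> B \<subseteq> eigenspace Dbar (of_real lv) \<and> ae_independent B}" using es by auto
    then have "enat (card ?B) \<le> eigen_multiplicity Dbar (of_real lv)"
      unfolding eigen_multiplicity_def by (rule SUP_upper)
    then show ?thesis by (simp add: card_image[OF inj])
  qed
  show "eigen_multiplicity Dbar (of_real lv) = \<infinity>"
  proof (cases "eigen_multiplicity Dbar (of_real lv)")
    case (enat m)
    then show ?thesis using ge[of "Suc m"] by simp
  qed simp
qed

section \<open>Points of the spectrum\<close>

lemma eigenvalue_in_spectrum: "eigenvalue Dbar z \<Longrightarrow> z \<in> spectrum SL2 Dbar"
  unfolding eigenvalue_def eigenspace_def spectrum_def resolvent_set_def by (force simp: ae_eq_def)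

lemma eps_cases_axis: "\<epsilon> (axis i 1, 0) = 0 \<or> \<epsilon> (axis i 1, 0) = 1"
  by (rule eps_cases, rule translation_lattice) (simp add: axis_def)

lemma ground_norm:
  assumes a: "admissible \<xi>" and r: "rho \<xi> > 0"
  obtains N where "N > 0" "l2_norm_sq (ground \<xi>) = ennreal N"
proof -
  have c: "continuous_on UNIV (ground \<xi>)" by (intro smooth_continuous SS_smooth ground_SS a r)
  have inv: "norm (ground \<xi> (\<gamma> \<odot> p)) = norm (ground \<xi> p)" if "\<gamma> \<in> lattice" for \<gamma> p
    using SS_equivariant[OF ground_SS[OF a r]] that
    by (simp only: spinor_equivariant_def norm_vector_smult norm_sgc mult_1)
  have "l2_norm_sq (ground \<xi>) \<noteq> 0"
    using l2_zero_imp_ae[of "ground \<xi>", OF borel_measurable_continuous_onI[OF c] inv] ground_not_ae_zero[OF a r] by blast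
  then show thesis using that l2_norm_sq_integral[OF c] by (metis ennreal_0 ennreal_neg linorder_le_less_linear order_le_less)
qed

text \<open>The ground states are approximate eigenvectors: a bounded inverse at \<open>lv\<close>
  would keep the distance of the levels from \<open>lv\<close> away from zero.\<close>

lemma limit_of_levels_in_spectrum:
  assumes a: "\<And>n. admissible (\<xi> n)" and r: "\<And>n. rho (\<xi> n) > 0" and lim: "(\<lambda>n. level (\<xi> n)) \<longlonglongrightarrow> lv"
  shows "of_real lv \<in> spectrum SL2 Dbar"
proof (rule ccontr)
  assume "of_real lv \<notin> spectrum SL2 Dbar"
  then obtain C :: real where C: "\<And>u v. (u, v) \<in> Dbar \<Longrightarrow> l2_norm_sq u \<le> ennreal C * l2_norm_sq (\<lambda>p. v p - of_real lv *s u p)"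
    unfolding spectrum_def resolvent_set_def by blast
  have le: "1 \<le> \<bar>C\<bar> * (level (\<xi> n) - lv)\<^sup>2" for n
  proof -
    let ?u = "ground (\<xi> n)"
    obtain N where N: "N > 0" "l2_norm_sq ?u = ennreal N" by (rule ground_norm[OF a r])
    have "(?u, \<lambda>p. of_real (level (\<xi> n)) *s ?u p) \<in> Dbar"
      using ground_eigenvector[OF a r, of n] by (simp add: eigenspace_def)
    from C[OF this] have "l2_norm_sq ?u \<le> ennreal C * l2_norm_sq (\<lambda>p. of_real (level (\<xi> n)) *s ?u p - of_real lv *s ?u p)" .
    also have "l2_norm_sq (\<lambda>p. of_real (level (\<xi> n)) *s ?u p - of_real lv *s ?u p) = ennreal (\<bar>level (\<xi> n) - lv\<bar>\<^sup>2) * l2_norm_sq ?u"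
    proof (rule l2_norm_sq_cmult)
      show "?u \<in> borel_measurable borel"
        by (intro borel_measurable_continuous_onI smooth_continuous SS_smooth ground_SS a r)
      fix p
      have "of_real (level (\<xi> n)) *s ?u p - of_real lv *s ?u p = of_real (level (\<xi> n) - lv) *s ?u p"
        by (simp add: vec_eq_iff algebra_simps)
      then show "norm (of_real (level (\<xi> n)) *s ?u p - of_real lv *s ?u p) = \<bar>level (\<xi> n) - lv\<bar> * norm (?u p)"
        by (simp only: norm_vector_smult norm_of_real)
    qed
    also have "ennreal C * \<dots> \<le> ennreal \<bar>C\<bar> * \<dots>" by (intro mult_right_mono ennreal_leI) auto
    finally have "ennreal N \<le> ennreal (\<bar>C\<bar> * (level (\<xi> n) - lv)\<^sup>2 * N)"
      using N by (simp add: ennreal_mult mult.assoc)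
    then have "N \<le> \<bar>C\<bar> * (level (\<xi> n) - lv)\<^sup>2 * N" using N(1) by (subst (asm) ennreal_le_iff) auto
    then show ?thesis using N(1) by simp
  qed
  have "(\<lambda>n. \<bar>C\<bar> * (level (\<xi> n) - lv)\<^sup>2) \<longlonglongrightarrow> \<bar>C\<bar> * (lv - lv)\<^sup>2" by (intro tendsto_intros lim)
  then have "1 \<le> \<bar>C\<bar> * (lv - lv)\<^sup>2" by (rule LIMSEQ_le_const) (use le in auto)
  then show False by simp
qed

text \<open>As \<open>R2\<close> grows with \<open>R1\<close> fixed, the unit normal turns towards
  the third axis and \<open>bb\<close> tends to \<open>\<xi>$3\<close>, whose value here is half the
  sign of \<open>axis 3\<close>.\<close>

lemma accumulation:
  assumes r1: "r1 > 0" and r2: "r2 > 0"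
  defines "lv \<equiv> al + pi * of_int (\<epsilon> (axis 3 1, 0))"
  shows "of_real lv islimpt spectrum SL2 Dbar" "of_real lv \<in> spectrum SL2 Dbar"
proof -
  let ?h = "\<lambda>i. real_of_int (\<epsilon> (axis i 1, 0)) / 2"
  have h: "?h i \<ge> 0" for i using eps_cases_axis[of i] by auto
  \<comment> \<open>The first and fourth coordinates are kept positive so that
    \<open>A * (1 + ?h 4) > 0\<close>; this keeps every level strictly below \<open>lv\<close>, so
    that \<open>lv\<close> is a genuine limit point.\<close>
  define \<xi> :: "nat \<Rightarrow> real^4" where "\<xi> n = (\<chi> i. (if i = 3 then 0 else if i = 2 then real n + 1 else 1) + ?h i)" for n
  have x: "\<xi> n $ 1 = 1 + ?h 1" "\<xi> n $ 2 = real n + 1 + ?h 2" "\<xi> n $ 3 = ?h 3" "\<xi> n $ 4 = 1 + ?h 4" for n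
    by (simp_all add: \<xi>_def)
  have a: "admissible (\<xi> n)" for n
    unfolding admissible_def
  proof
    fix i
    show "\<exists>k::int. \<xi> n $ i = of_int k + of_int (\<epsilon> (axis i 1, 0)) / 2"
      by (rule exI[of _ "if i = 3 then 0 else if i = 2 then int n + 1 else 1"]) (simp add: \<xi>_def)
  qed
  define A where "A = real_of_int r1 * (1 + ?h 1)"
  have R1: "R1 (\<xi> n) = A" for n by (simp add: R1_def x A_def)
  have A: "A > 0" unfolding A_def using r1 h[of 1] by (intro mult_pos_pos) auto
  have R2: "R2 (\<xi> n) \<ge> real n + 1" for n
  proof -
    have "1 * (real n + 1) \<le> of_int r2 * (real n + 1 + ?h 2)" using r2 h[of 2] by (intro mult_mono) auto
    then show ?thesis by (simp add: R2_def x)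
  qed
  have R2p: "R2 (\<xi> n) > 0" for n using R2[of n] by linarith
  have rho2: "(rho (\<xi> n))\<^sup>2 = A\<^sup>2 + (R2 (\<xi> n))\<^sup>2" for n by (simp add: rho_def R1)
  have rge: "rho (\<xi> n) \<ge> R2 (\<xi> n)" for n
    unfolding rho_def by (rule real_le_rsqrt) simp
  have rp: "rho (\<xi> n) > 0" for n using rge[of n] R2p[of n] by linarith
  have rle: "rho (\<xi> n) \<le> A + R2 (\<xi> n)" for n
    unfolding rho_def R1 by (rule real_le_lsqrt) (use A R2p[of n] in \<open>auto simp: power2_sum\<close>)
  define e where "e n = ?h 3 - bb (\<xi> n)" for n
  have e: "e n = (?h 3 * (rho (\<xi> n) - R2 (\<xi> n)) + A * (1 + ?h 4)) / rho (\<xi> n)" for n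
    using rp[of n] by (simp add: e_def bb_def R1 x field_simps)
  have epos: "e n > 0" for n
  proof -
    have "0 \<le> ?h 3 * (rho (\<xi> n) - R2 (\<xi> n))" using h[of 3] rge[of n] by (intro mult_nonneg_nonneg) auto
    moreover have "0 < A * (1 + ?h 4)" using A h[of 4] by (intro mult_pos_pos) auto
    ultimately show ?thesis unfolding e using rp[of n] by (intro divide_pos_pos) auto
  qed
  define K where "K = ?h 3 * A + A * (1 + ?h 4)"
  have K: "K \<ge> 0" unfolding K_def using A h[of 3] h[of 4] by (intro add_nonneg_nonneg mult_nonneg_nonneg) auto
  have ele: "e n \<le> K * (1 / real (Suc n))" for n
  proof -
    have "?h 3 * (rho (\<xi> n) - R2 (\<xi> n)) \<le> ?h 3 * A" using h[of 3] rle[of n] by (intro mult_left_mono) auto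
    then have "e n \<le> K / rho (\<xi> n)" unfolding e K_def using rp[of n] by (intro divide_right_mono) auto
    also have "\<dots> \<le> K / real (Suc n)"
      using K rp[of n] rge[of n] R2[of n] by (intro divide_left_mono mult_pos_pos) auto
    finally show ?thesis by simp
  qed
  have "(\<lambda>n. K * (1 / real (Suc n))) \<longlonglongrightarrow> K * 0"
    by (intro tendsto_mult tendsto_const LIMSEQ_Suc[OF lim_1_over_n])
  then have e0: "e \<longlonglongrightarrow> 0"
    by (intro tendsto_sandwich[of "\<lambda>_. 0" e sequentially "\<lambda>n. K * (1 / real (Suc n))"])
       (use epos ele in \<open>auto intro!: always_eventually less_imp_le simp del: of_nat_Suc\<close>)
  have lev: "level (\<xi> n) = lv - 2 * pi * e n" for n by (simp add: level_def lv_def e_def algebra_simps)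
  have lim: "(\<lambda>n. level (\<xi> n)) \<longlonglongrightarrow> lv"
  proof -
    have "(\<lambda>n. lv - 2 * pi * e n) \<longlonglongrightarrow> lv - 2 * pi * 0" by (intro tendsto_intros e0)
    then show ?thesis by (simp add: lev)
  qed
  show "of_real lv \<in> spectrum SL2 Dbar" by (rule limit_of_levels_in_spectrum[OF a rp lim])
  show "of_real lv islimpt spectrum SL2 Dbar"
    unfolding islimpt_approachable
  proof (intro allI impI)
    fix d :: real assume "d > 0"
    then have "\<forall>\<^sub>F n in sequentially. dist (level (\<xi> n)) lv < d" using lim by (rule tendstoD[rotated])
    then obtain n where n: "dist (level (\<xi> n)) lv < d" by (auto simp: eventually_sequentially)
    have "eigenvalue Dbar (of_real (level (\<xi> n)))"
      unfolding eigenvalue_def using ground_eigenvector[OF a rp] ground_not_ae_zero[OF a rp] by blast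
    then have "of_real (level (\<xi> n)) \<in> spectrum SL2 Dbar" by (rule eigenvalue_in_spectrum)
    moreover have "complex_of_real (level (\<xi> n)) \<noteq> of_real lv" using epos[of n] by (simp add: lev)
    moreover have "dist (complex_of_real (level (\<xi> n))) (of_real lv) < d" using n by simp
    ultimately show "\<exists>x'\<in>spectrum SL2 Dbar. x' \<noteq> of_real lv \<and> dist x' (of_real lv) < d" by blast
  qed
qed

lemma eigenvalues_infinite_multiplicity:
  fixes k :: int
  assumes r1: "r1 > 0" and r2: "r2 > 0" and \<nu>: "\<nu> = 1 \<or> \<nu> = 2" and e0: "\<epsilon> (axis \<nu> 1, 0) = 0"
    and lv_def: "lv = al + of_int (2 * k + \<epsilon> (axis (2 + \<nu>) 1, 0)) * pi"
  shows "eigenvalue Dbar (of_real lv) \<and> eigen_multiplicity Dbar (of_real lv) = \<infinity>"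
proof -
  let ?h = "\<lambda>i. real_of_int (\<epsilon> (axis i 1, 0)) / 2"
  have h: "?h i \<ge> 0" "?h i < 1" for i using eps_cases_axis[of i] by auto
  have adm: "admissible (\<chi> i. of_int (m i) + ?h i)" for m :: "4 \<Rightarrow> int"
    unfolding admissible_def by auto
  from \<nu> show ?thesis
  proof
    assume \<nu>: "\<nu> = 1"
    \<comment> \<open>The frequency 0 in direction 1 is admissible because the sign there is
      trivial. It makes \<open>R1\<close> vanish, and \<open>R2 > 0\<close> gives
      \<open>bb = \<xi>$3\<close>, independent of the free second coordinate.\<close>
    define \<xi> :: "nat \<Rightarrow> real^4" where "\<xi> j = (\<chi> i. of_int (if i = 1 then 0 else if i = 2 then int j + 1 else k) + ?h i)" for j
    have x: "\<xi> j $ 1 = 0" "\<xi> j $ 2 = real j + 1 + ?h 2" "\<xi> j $ 3 = of_int k + ?h 3" for j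
      using e0 by (simp_all add: \<xi>_def \<nu>)
    have R2: "R2 (\<xi> j) > 0" for j unfolding R2_def x using r2 h(1)[of 2] by (intro mult_pos_pos) auto
    have R1: "R1 (\<xi> j) = 0" for j by (simp add: R1_def x)
    have rho: "rho (\<xi> j) = R2 (\<xi> j)" for j using R2[of j] by (simp add: rho_def R1)
    show ?thesis
    proof (rule infinite_multiplicity[where \<xi>=\<xi> and i=2 and s=1 and b="1 + ?h 2"])
      show "admissible (\<xi> j)" for j unfolding \<xi>_def by (rule adm)
      show "rho (\<xi> j) > 0" for j using R2 by (simp add: rho)
      have "bb (\<xi> j) = \<xi> j $ 3" for j using R2[of j] by (simp add: bb_def rho R1)
      then show "level (\<xi> j) = lv" for j by (simp add: level_def x lv_def \<nu> algebra_simps)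
    qed (auto simp: x)
  next
    assume \<nu>: "\<nu> = 2"
    \<comment> \<open>Here \<open>bb\<close> is \<open>\<xi>$4\<close> times
      \<open>- R1 / rho\<close>; negative first coordinates make this factor 1, which is why the
      progression descends.\<close>
    define \<xi> :: "nat \<Rightarrow> real^4" where "\<xi> j = (\<chi> i. of_int (if i = 2 then 0 else if i = 1 then - int j - 1 else k) + ?h i)" for j
    have x: "\<xi> j $ 2 = 0" "\<xi> j $ 1 = - real j - 1 + ?h 1" "\<xi> j $ 4 = of_int k + ?h 4" for j
      using e0 by (simp_all add: \<xi>_def \<nu>)
    have "\<xi> j $ 1 < 0" for j using h(2)[of 1] by (simp add: x)
    then have R1: "R1 (\<xi> j) < 0" for j unfolding R1_def using r1 by (intro mult_pos_neg) auto
    have R2: "R2 (\<xi> j) = 0" for j by (simp add: R2_def x)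
    have rho: "rho (\<xi> j) = - R1 (\<xi> j)" for j using R1[of j] by (simp add: rho_def R2)
    show ?thesis
    proof (rule infinite_multiplicity[where \<xi>=\<xi> and i=1 and s="-1" and b="- 1 + ?h 1"])
      show "admissible (\<xi> j)" for j unfolding \<xi>_def by (rule adm)
      show "rho (\<xi> j) > 0" for j using R1 by (simp add: rho)
      have "bb (\<xi> j) = \<xi> j $ 4" for j using R1[of j] by (simp add: bb_def rho R2)
      then show "level (\<xi> j) = lv" for j by (simp add: level_def x lv_def \<nu> algebra_simps)
    qed (auto simp: x)
  qed
qed

end

theorem mainTheorem4:
  fixes r1 r2 :: int
    and A :: "real \<Rightarrow> real^4^4"
    and g :: "grp \<Rightarrow> grp \<Rightarrow> grp \<Rightarrow> real"
    and nab :: conn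
    and \<epsilon> :: "grp \<Rightarrow> int"
    and \<alpha> :: real
    and eps :: "4 \<Rightarrow> int"
    and D :: "(spinor \<times> spinor) set"
    and \<sigma> :: "complex set"
  assumes "r1 > 0" and "r2 > 0" and "r2 dvd r1"
    and "A = shear r1 r2"
    and "riemannian_metric A g"
    and "orthonormal_frame A g"
    and "metric_connection A g nab"
    and "left_invariant_connection A nab"
    and "\<And>j p. (\<Sum>i\<in>UNIV. g p (nab (frame A i) (frame A j) p) (frame A i p)) = 0"
    and "\<epsilon> \<in> sign_homs A"
    and "\<And>\<nu>. eps \<nu> = \<epsilon> (axis \<nu> 1, 0)"
    and "\<alpha> = alpha A g nab"
    and "D = dirac_closure A g nab \<epsilon>"
    and "\<sigma> = spectrum (spinor_L2 A \<epsilon>) D"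
  shows "(\<forall>\<nu>\<in>{1, 2}. eps \<nu> = 0 \<longrightarrow>
            (\<forall>k::int. eigenvalue D (of_real (\<alpha> + of_int (2 * k + eps (2 + \<nu>)) * pi)) \<and>
                      eigen_multiplicity D (of_real (\<alpha> + of_int (2 * k + eps (2 + \<nu>)) * pi)) = \<infinity>)) \<and>
         (\<sigma> \<subseteq> \<real> \<and> \<not> discrete \<sigma> \<and>
          of_real (\<alpha> + pi * of_int (sgn r2) * of_int (eps 3)) islimpt \<sigma>)"
proof -
  interpret sub_dirac r1 r2 g nab \<epsilon>
    by unfold_locales (use assms in \<open>simp_all only:\<close>)
  have al: "al = \<alpha>" by (simp add: al_def assms)
  have D: "D = Dbar" and \<sigma>: "\<sigma> = spectrum SL2 Dbar" by (simp_all add: assms)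
  note acc = accumulation[OF assms(1,2), unfolded al]
  have 1: "\<sigma> \<subseteq> \<real>"
  proof
    fix z assume "z \<in> \<sigma>"
    then have "Im z = 0" using nonreal_in_resolvent[of z] by (auto simp: \<sigma> spectrum_def)
    then show "z \<in> \<real>" by (simp add: complex_is_Real_iff)
  qed
  \<comment> \<open>Discreteness asks every point of \<sigma> to be isolated, so the contradiction
    needs the limit point to belong to \<sigma>.\<close>
  have 2: "\<not> discrete \<sigma>"
    using acc unfolding \<sigma> discrete_def isolated_in_islimpt_iff by blast
  have 3: "of_real (\<alpha> + pi * of_int (sgn r2) * of_int (eps 3)) islimpt \<sigma>"
    using acc(1) assms(2) unfolding \<sigma> assms(11) by simp
  have 4: "eigenvalue D (of_real (\<alpha> + of_int (2 * k + eps (2 + \<nu>)) * pi)) \<and>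
      eigen_multiplicity D (of_real (\<alpha> + of_int (2 * k + eps (2 + \<nu>)) * pi)) = \<infinity>"
    if "\<nu> \<in> {1, 2}" "eps \<nu> = 0" for \<nu> k
    unfolding D assms(11)[of "2 + \<nu>"] al[symmetric]
    by (rule eigenvalues_infinite_multiplicity[OF assms(1,2) _ _ refl]) (use that in \<open>auto simp: assms(11)\<close>)
  show ?thesis by (intro conjI ballI allI impI 1 2 3) (simp_all only: 4)
qed

end
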